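(* Let $(P,\Lambda,F)$ be a smooth projective plane. The dual plane $(\Lambda,P,F^* )$, $F^*=\{(\lambda,p):(p,\lambda)\in F\}$, is regular if and only if $(P,\Lambda,F)$ is regular.
   Context: A projective plane is a triple $(P,\Lambda,F)$ of a set $P$ of points, a set $\Lambda$ of lines and $F\subset P\times\Lambda$ ($p$ is on $\lambda$ if $(p,\lambda)\in F$) such that any two distinct points are on a unique line $p_1p_2$, any two distinct lines have a unique common point $\lambda_1\lambda_2$, and there are 4 points with no three on a line. It is smooth if $P,\Lambda$ are compact smooth manifolds, $F\subset P\times\Lambda$ is a smooth embedded submanifold, and the maps $(p_1,p_2)\mapsto p_1p_2$, $(\lambda_1,\lambda_2)\mapsto\lambda_1\lambda_2$ are smooth on pairs of distinct elements. Dimension: $\dim P=\dim\Lambda=2n$. $\bar\lambda\subset P$ is the $n$-dimensional submanifold of points on $\lambda$, and $\bar p\subset\Lambda$ the $n$-dimensional submanifold of lines through $p$. The plane is regular if for every $p_0\in P$ and every real line $\ell\subset T_{p_0}P$, the map $\bar p_0\to\widetilde{\mathrm{Gr}}(n,T_{p_0}P)$, $\lambda\mapsto T_{p_0}\bar\lambda$, into the Grassmannian of (oriented) $n$-planes has only transverse intersections (if any) with $\widetilde{\mathrm{Gr}}_\ell(n,T_{p_0}P)$, the submanifold of $n$-planes containing $\ell$. *)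

theory Defs
  imports "HOL-Analysis.Analysis"
begin

section \<open>Smooth maps between open subsets of Euclidean spaces\<close>

fun times_differentiable_on ::
  "nat \<Rightarrow> 'a::real_normed_vector set \<Rightarrow> ('a \<Rightarrow> 'b::real_normed_vector) \<Rightarrow> bool" where
  "times_differentiable_on 0 S f \<longleftrightarrow> continuous_on S f"
| "times_differentiable_on (Suc k) S f \<longleftrightarrow>
     (\<forall>x\<in>S. f differentiable (at x)) \<and>
     (\<forall>v. times_differentiable_on k S (\<lambda>x. frechet_derivative f (at x) v))"

text \<open>\<open>C\<^sup>\<infinity>\<close>-smoothness; only meant for open \<open>S\<close>.\<close>

definition smooth_on ::
  "'a::real_normed_vector set \<Rightarrow> ('a \<Rightarrow> 'b::real_normed_vector) \<Rightarrow> bool" where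
  "smooth_on S f \<longleftrightarrow> (\<forall>k. times_differentiable_on k S f)"

section \<open>Smooth manifolds\<close>

text \<open>
  A manifold is given by an atlas; its set of points is the union of the chart domains. A chart is
  a pair of a domain and a coordinate map, whose values outside the domain are irrelevant.
\<close>

type_synonym ('p, 'e) chart = "'p set \<times> ('p \<Rightarrow> 'e)"

definition points :: "('p, 'e) chart set \<Rightarrow> 'p set" where
  "points A = (\<Union>c\<in>A. fst c)"

definition compatible_charts ::
  "('p, 'e::euclidean_space) chart \<Rightarrow> ('p, 'e) chart \<Rightarrow> bool" where
  "compatible_charts c d \<longleftrightarrow>
     open (snd c ` (fst c \<inter> fst d)) \<and>
     open (snd d ` (fst c \<inter> fst d)) \<and>
     smooth_on (snd c ` (fst c \<inter> fst d)) (snd d \<circ> inv_into (fst c) (snd c)) \<and>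
     smooth_on (snd d ` (fst c \<inter> fst d)) (snd c \<circ> inv_into (fst d) (snd d))"

text \<open>The charts of the maximal atlas determined by \<open>A\<close>.\<close>

definition charts_of :: "('p, 'e::euclidean_space) chart set \<Rightarrow> ('p, 'e) chart set" where
  "charts_of A =
     {c. fst c \<subseteq> points A \<and> inj_on (snd c) (fst c) \<and> open (snd c ` fst c) \<and>
         (\<forall>d\<in>A. compatible_charts c d)}"

text \<open>The topology for which the charts are homeomorphisms from open sets onto open sets.\<close>

definition manifold_topology :: "('p, 'e::euclidean_space) chart set \<Rightarrow> 'p topology" where
  "manifold_topology A =
     topology (\<lambda>U. U \<subseteq> points A \<and> (\<forall>c\<in>A. open (snd c ` (U \<inter> fst c))))"

lemma openin_manifold_topology:
  assumes "\<And>c. c \<in> A \<Longrightarrow> inj_on (snd c) (fst c)"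
  shows "openin (manifold_topology A) U \<longleftrightarrow>
           U \<subseteq> points A \<and> (\<forall>c\<in>A. open (snd c ` (U \<inter> fst c)))"
proof -
  have "istopology (\<lambda>U. U \<subseteq> points A \<and> (\<forall>c\<in>A. open (snd c ` (U \<inter> fst c))))"
    unfolding istopology_def
  proof (intro conjI allI impI ballI)
    fix S T c
    assume S: "S \<subseteq> points A \<and> (\<forall>c\<in>A. open (snd c ` (S \<inter> fst c)))"
      and T: "T \<subseteq> points A \<and> (\<forall>c\<in>A. open (snd c ` (T \<inter> fst c)))" and c: "c \<in> A"
    have "snd c ` (S \<inter> T \<inter> fst c) = snd c ` ((S \<inter> fst c) \<inter> (T \<inter> fst c))"
      by (rule arg_cong[of _ _ "image (snd c)"]) blast
    also have "\<dots> = snd c ` (S \<inter> fst c) \<inter> snd c ` (T \<inter> fst c)"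
      using assms[OF c] by (rule inj_on_image_Int) auto
    finally show "open (snd c ` (S \<inter> T \<inter> fst c))"
      using S T c by auto
  next
    fix K c
    assume K: "\<forall>U\<in>K. U \<subseteq> points A \<and> (\<forall>c\<in>A. open (snd c ` (U \<inter> fst c)))" and c: "c \<in> A"
    have "snd c ` (\<Union>K \<inter> fst c) = (\<Union>U\<in>K. snd c ` (U \<inter> fst c))"
      by blast
    then show "open (snd c ` (\<Union>K \<inter> fst c))"
      using K c by auto
  qed auto
  then show ?thesis
    by (simp add: manifold_topology_def topology_inverse')
qed

definition smooth_manifold :: "('p, 'e::euclidean_space) chart set \<Rightarrow> bool" where
  "smooth_manifold A \<longleftrightarrow>
     A \<subseteq> charts_of A \<and>
     Hausdorff_space (manifold_topology A) \<and> second_countable (manifold_topology A)"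

definition compact_smooth_manifold :: "('p, 'e::euclidean_space) chart set \<Rightarrow> bool" where
  "compact_smooth_manifold A \<longleftrightarrow> smooth_manifold A \<and> compact_space (manifold_topology A)"

definition euclidean_atlas :: "('e::euclidean_space, 'e) chart set" where
  "euclidean_atlas = {(UNIV, \<lambda>x. x)}"

definition product_atlas ::
  "('p, 'e) chart set \<Rightarrow> ('q, 'f) chart set \<Rightarrow> ('p \<times> 'q, 'e \<times> 'f) chart set" where
  "product_atlas A B =
     {(fst c \<times> fst d, map_prod (snd c) (snd d)) | c d. c \<in> A \<and> d \<in> B}"

definition smooth_map_on ::
  "('p, 'e::euclidean_space) chart set \<Rightarrow> ('q, 'f::euclidean_space) chart set \<Rightarrow>
     'p set \<Rightarrow> ('p \<Rightarrow> 'q) \<Rightarrow> bool" where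
  "smooth_map_on A B S f \<longleftrightarrow>
     openin (manifold_topology A) S \<and> f ` S \<subseteq> points B \<and>
     continuous_map (subtopology (manifold_topology A) S) (manifold_topology B) f \<and>
     (\<forall>c\<in>A. \<forall>d\<in>B.
        smooth_on (snd c ` (fst c \<inter> S \<inter> f -` fst d)) (snd d \<circ> f \<circ> inv_into (fst c) (snd c)))"

definition embedded_submanifold :: "('p, 'e::euclidean_space) chart set \<Rightarrow> 'p set \<Rightarrow> bool" where
  "embedded_submanifold A S \<longleftrightarrow>
     S \<subseteq> points A \<and>
     (\<exists>k. \<forall>x\<in>S. \<exists>c\<in>charts_of A. \<exists>E. x \<in> fst c \<and> subspace E \<and> dim E = k \<and>
        snd c ` (fst c \<inter> S) = snd c ` fst c \<inter> E)"

section \<open>Tangent spaces and transversality\<close>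

text \<open>
  A tangent vector at \<open>p\<close> is represented by the family of its coordinate vectors in all charts of
  the atlas around \<open>p\<close>, with value \<open>0\<close> at everything else. Vector space operations on tangent
  vectors are pointwise.
\<close>

type_synonym ('p, 'e) tangent = "('p, 'e) chart \<Rightarrow> 'e"

definition velocity ::
  "('p, 'e::euclidean_space) chart set \<Rightarrow> (real \<Rightarrow> 'p) \<Rightarrow> ('p, 'e) tangent" where
  "velocity A \<gamma> =
     (\<lambda>c. if c \<in> A \<and> \<gamma> 0 \<in> fst c then vector_derivative (snd c \<circ> \<gamma>) (at 0) else 0)"

definition smooth_curve_through ::
  "('p, 'e::euclidean_space) chart set \<Rightarrow> 'p set \<Rightarrow> 'p \<Rightarrow> (real \<Rightarrow> 'p) \<Rightarrow> bool" where
  "smooth_curve_through A S x \<gamma> \<longleftrightarrow>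
     \<gamma> 0 = x \<and>
     (\<exists>\<epsilon>>0. smooth_map_on euclidean_atlas A {-\<epsilon><..<\<epsilon>} \<gamma> \<and> \<gamma> ` {-\<epsilon><..<\<epsilon>} \<subseteq> S)"

text \<open>
  \<open>T\<^sub>x S\<close> as a set of tangent vectors of the ambient manifold, for an embedded submanifold \<open>S\<close>;
  the tangent space of the manifold itself is the case \<open>S = points A\<close>.
\<close>

definition tangent_space ::
  "('p, 'e::euclidean_space) chart set \<Rightarrow> 'p set \<Rightarrow> 'p \<Rightarrow> ('p, 'e) tangent set" where
  "tangent_space A S x = {velocity A \<gamma> | \<gamma>. smooth_curve_through A S x \<gamma>}"

text \<open>
  The image \<open>df(T\<^sub>x S)\<close> of the differential of a smooth map \<open>f\<close> from the submanifold \<open>S\<close>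
  to the manifold \<open>B\<close>, using \<open>df(\<gamma>'(0)) = (f \<circ> \<gamma>)'(0)\<close>.
\<close>

definition differential_image ::
  "('p, 'e::euclidean_space) chart set \<Rightarrow> ('q, 'f::euclidean_space) chart set \<Rightarrow>
     'p set \<Rightarrow> ('p \<Rightarrow> 'q) \<Rightarrow> 'p \<Rightarrow> ('q, 'f) tangent set" where
  "differential_image A B S f x = {velocity B (f \<circ> \<gamma>) | \<gamma>. smooth_curve_through A S x \<gamma>}"

text \<open>
  Transversality of a smooth map \<open>f\<close>, defined on the submanifold \<open>S\<close> of \<open>A\<close>, to the
  submanifold \<open>Z\<close> of \<open>B\<close>: \<open>df(T\<^sub>x S) + T\<^sub>y Z = T\<^sub>y B\<close> at every \<open>x\<close> with
  \<open>y = f x \<in> Z\<close>. Smoothness of \<open>f\<close> on \<open>S\<close> is presupposed.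
\<close>

definition transverse_on ::
  "('p, 'e::euclidean_space) chart set \<Rightarrow> ('q, 'f::euclidean_space) chart set \<Rightarrow>
     'p set \<Rightarrow> ('p \<Rightarrow> 'q) \<Rightarrow> 'q set \<Rightarrow> bool" where
  "transverse_on A B S f Z \<longleftrightarrow>
     (\<forall>x\<in>S. f x \<in> Z \<longrightarrow>
        {\<lambda>c. u c + v c | u v. u \<in> differential_image A B S f x \<and> v \<in> tangent_space B Z (f x)} =
        tangent_space B (points B) (f x))"

definition real_line_in :: "('p, 'e::real_vector) tangent set \<Rightarrow> ('p, 'e) tangent set \<Rightarrow> bool" where
  "real_line_in T l \<longleftrightarrow> (\<exists>v\<in>T. v \<noteq> (\<lambda>c. 0) \<and> l = {\<lambda>c. r *\<^sub>R v c | r. True})"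

section \<open>The Grassmannian of half-dimensional subspaces of a tangent space\<close>

text \<open>
  \<open>\<real>\<^sup>2\<^sup>n\<close> is rendered as \<open>\<real>\<^sup>n \<times> \<real>\<^sup>n\<close> with \<open>n = CARD('n)\<close>.
\<close>

text \<open>Linear isomorphisms of \<open>\<real>\<^sup>2\<^sup>n\<close> onto the tangent space at \<open>p\<close>.\<close>

definition frames ::
  "('p, (real^'n) \<times> (real^'n)) chart set \<Rightarrow> 'p \<Rightarrow>
     ((real^'n) \<times> (real^'n) \<Rightarrow> ('p, (real^'n) \<times> (real^'n)) tangent) set" where
  "frames A p =
     {g. bij_betw g UNIV (tangent_space A (points A) p) \<and> (\<forall>c. linear (\<lambda>x. g x c))}"

definition graph_plane ::
  "((real^'n) \<times> (real^'n) \<Rightarrow> ('p, (real^'n) \<times> (real^'n)) tangent) \<Rightarrow> real^'n^'n \<Rightarrow>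
     ('p, (real^'n) \<times> (real^'n)) tangent set" where
  "graph_plane g M = g ` range (\<lambda>x. (x, M *v x))"

text \<open>
  The standard atlas: for a frame \<open>g\<close>, the \<open>n\<close>-dimensional subspaces complementary to
  \<open>g (0 \<times> \<real>\<^sup>n)\<close> are exactly the graphs \<open>g {(x, M x) | x}\<close> of \<open>n \<times> n\<close> matrices \<open>M\<close>, and \<open>M\<close>
  is the coordinate of the subspace. Every \<open>n\<close>-dimensional subspace lies in the domain for some
  \<open>g\<close>, so the points of this manifold are all \<open>n\<close>-dimensional subspaces of the tangent space at \<open>p\<close>.
\<close>

definition grassmannian ::
  "('p, (real^'n) \<times> (real^'n)) chart set \<Rightarrow> 'p \<Rightarrow>
     (('p, (real^'n) \<times> (real^'n)) tangent set, real^'n^'n) chart set" where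
  "grassmannian A p =
     {(range (graph_plane g), \<lambda>V. THE M. V = graph_plane g M) | g. g \<in> frames A p}"

section \<open>Smooth projective planes\<close>

definition projective_plane :: "'p set \<Rightarrow> 'l set \<Rightarrow> ('p \<times> 'l) set \<Rightarrow> bool" where
  "projective_plane P L F \<longleftrightarrow>
     F \<subseteq> P \<times> L \<and>
     (\<forall>p\<in>P. \<forall>q\<in>P. p \<noteq> q \<longrightarrow> (\<exists>!l. l \<in> L \<and> (p, l) \<in> F \<and> (q, l) \<in> F)) \<and>
     (\<forall>l\<in>L. \<forall>m\<in>L. l \<noteq> m \<longrightarrow> (\<exists>!p. p \<in> P \<and> (p, l) \<in> F \<and> (p, m) \<in> F)) \<and>
     (\<exists>Q\<subseteq>P. card Q = 4 \<and> (\<forall>l\<in>L. card {p\<in>Q. (p, l) \<in> F} < 3))"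

definition join :: "('p \<times> 'l) set \<Rightarrow> 'p \<Rightarrow> 'p \<Rightarrow> 'l" where
  "join F p q = (THE l. (p, l) \<in> F \<and> (q, l) \<in> F)"

definition meet :: "('p \<times> 'l) set \<Rightarrow> 'l \<Rightarrow> 'l \<Rightarrow> 'p" where
  "meet F l m = (THE p. (p, l) \<in> F \<and> (p, m) \<in> F)"

definition smooth_projective_plane ::
  "('p, (real^'n) \<times> (real^'n)) chart set \<Rightarrow> ('l, (real^'n) \<times> (real^'n)) chart set \<Rightarrow>
     ('p \<times> 'l) set \<Rightarrow> bool" where
  "smooth_projective_plane P L F \<longleftrightarrow>
     projective_plane (points P) (points L) F \<and>
     compact_smooth_manifold P \<and> compact_smooth_manifold L \<and>
     embedded_submanifold (product_atlas P L) F \<and>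
     smooth_map_on (product_atlas P P) L
       {(p, q). p \<in> points P \<and> q \<in> points P \<and> p \<noteq> q} (\<lambda>(p, q). join F p q) \<and>
     smooth_map_on (product_atlas L L) P
       {(l, m). l \<in> points L \<and> m \<in> points L \<and> l \<noteq> m} (\<lambda>(l, m). meet F l m)"

definition points_on :: "('p \<times> 'l) set \<Rightarrow> 'l \<Rightarrow> 'p set" where
  "points_on F l = {p. (p, l) \<in> F}"

definition lines_through :: "('p \<times> 'l) set \<Rightarrow> 'p \<Rightarrow> 'l set" where
  "lines_through F p = {l. (p, l) \<in> F}"

text \<open>
  The unoriented Grassmannian is used. It has the same tangent spaces as the oriented one, of which
  it is the quotient by a two-fold covering, so transversality has the same meaning in both.
\<close>

definition regular_plane ::
  "('p, (real^'n) \<times> (real^'n)) chart set \<Rightarrow> ('l, (real^'n) \<times> (real^'n)) chart set \<Rightarrow>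
     ('p \<times> 'l) set \<Rightarrow> bool" where
  "regular_plane P L F \<longleftrightarrow>
     (\<forall>p\<in>points P. \<forall>r. real_line_in (tangent_space P (points P) p) r \<longrightarrow>
        transverse_on L (grassmannian P p) (lines_through F p)
          (\<lambda>l. tangent_space P (points_on F l) p)
          {V \<in> points (grassmannian P p). r \<subseteq> V})"

end

theory Submission
  imports Defs
begin

text \<open>
  Fix a flag \<open>(p, l)\<close> and a point \<open>q\<close> off \<open>l\<close>. Projection from \<open>q\<close>, \<open>x \<mapsto> (xq)l\<close>, is a smooth retraction
  onto \<open>l\<close>, so its derivative at \<open>p\<close> is a projection \<open>\<pi>\<^sub>l\<close> onto \<open>T\<^sub>p l\<close>. The kernel \<open>K\<close> of \<open>\<pi>\<^sub>l\<close> does not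
  change as \<open>l\<close> moves through \<open>p\<close>, since projecting to one line and then to another is projecting to
  the latter; and since \<open>T\<^sub>p l \<oplus> T\<^sub>p m = T\<^sub>p P\<close> for \<open>l \<noteq> m\<close> and there are three lines through \<open>p\<close>, all these
  spaces have dimension \<open>n\<close>. Hence \<open>T\<^sub>p l\<close> is a graph over a fixed complement of \<open>K\<close>, and its velocity
  as \<open>l\<close> moves in direction \<open>\<xi>\<close> is \<open>v \<mapsto> B(\<xi>, v) \<in> K\<close>, the mixed second derivative of \<open>(x, l) \<mapsto> (xq)l\<close>.
  Transversality at \<open>l\<close> for the real line spanned by \<open>v \<in> T\<^sub>p l\<close> means that \<open>B(\<cdot>, v)\<close> maps the tangent
  space at \<open>l\<close> of the pencil of \<open>p\<close> onto \<open>K\<close>; as both have dimension \<open>n\<close>, regularity says that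
  \<open>B(\<xi>, v) = 0\<close> only if \<open>\<xi> = 0\<close> or \<open>v = 0\<close>, a condition symmetric in \<open>\<xi>\<close> and \<open>v\<close>. Finally, for a line \<open>m\<close>
  not through \<open>p\<close>, differentiating \<open>(lm)((xq)l) = l\<close> shows that \<open>B(\<xi>, v) = 0\<close> forces the corresponding
  mixed derivative of the dual plane to vanish.
\<close>

section \<open>Smooth functions\<close>

text \<open>A line is given only as a set of points and its tangent space as a set of velocities of
  curves, so even the linearity of \<open>T_p l\<close> needs an argument: it is the range of the
  derivative of the retraction, a map on an open set of points. Likewise
  \<open>T_p l \<oplus> T_p m = T_p P\<close> because a point is recovered from its projections from
  \<open>q\<close> on \<open>m\<close> to \<open>l\<close> and from \<open>q'\<close> on
  \<open>l\<close> to \<open>m\<close>, as a meet of two joins. The pencil of \<open>p\<close> is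
  never parametrised: \<open>R(x, y) = (xq)y\<close> is smooth for all points \<open>x\<close> near
  \<open>p\<close> and all lines \<open>y\<close> near \<open>l\<close>, and the pencil enters only
  through curves in it. With \<open>H(y, x) = (ym)x\<close>, differentiating
  \<open>H(y, R(x, y)) = y\<close> in \<open>x\<close> gives a derivative of \<open>H\<close>
  applied to the projection of \<open>v\<close>. Differentiating once more along the pencil, the
  term with \<open>B(\<xi>, v)\<close> drops out and a mixed derivative of \<open>H\<close> remains,
  in the order opposite to that of the dual plane; hence the symmetry of second derivatives. Only
  one implication has to be proved: it also applies to the dual plane, whose dual is the original
  plane.\<close>

lemma times_differentiable_on_mono:
  "times_differentiable_on (Suc k) S f \<Longrightarrow> times_differentiable_on k S f"
proof (induction k arbitrary: f)
  case 0
  then show ?case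
    by (auto intro!: differentiable_imp_continuous_on differentiable_at_imp_differentiable_on)
next
  case (Suc k)
  show ?case
    unfolding times_differentiable_on.simps(2)[of k]
  proof (intro conjI allI)
    show "\<forall>x\<in>S. f differentiable at x" using Suc.prems by simp
    show "times_differentiable_on k S (\<lambda>x. frechet_derivative f (at x) v)" for v
      using Suc.prems Suc.IH by (metis times_differentiable_on.simps(2))
  qed
qed

lemma times_differentiable_on_subset:
  "times_differentiable_on k S f \<Longrightarrow> T \<subseteq> S \<Longrightarrow> times_differentiable_on k T f"
  by (induction k arbitrary: f) (auto intro: continuous_on_subset)

lemma frechet_derivative_cong_open:
  assumes "open S" "x \<in> S" "\<And>y. y \<in> S \<Longrightarrow> f y = g y"
  shows "frechet_derivative f (at x) = frechet_derivative g (at x)"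
proof -
  have "(f has_derivative D) (at x) \<longleftrightarrow> (g has_derivative D) (at x)" for D
    using has_derivative_transform_within_open[OF _ assms(1,2)] assms(3) by metis
  then show ?thesis by (simp add: frechet_derivative_def)
qed

lemma differentiable_cong_open:
  assumes "open S" "x \<in> S" "\<And>y. y \<in> S \<Longrightarrow> f y = g y" "f differentiable at x"
  shows "g differentiable at x"
  using assms has_derivative_transform_within_open[OF _ assms(1,2)]
  unfolding differentiable_def by metis

lemma times_differentiable_on_cong:
  assumes "open S" "\<And>x. x \<in> S \<Longrightarrow> f x = g x" "times_differentiable_on k S f"
  shows "times_differentiable_on k S g"
  using assms(2,3)
proof (induction k arbitrary: f g)
  case 0
  then show ?case by (simp cong: continuous_on_cong)
next
  case (Suc k)
  have "times_differentiable_on k S (\<lambda>x. frechet_derivative g (at x) v)" for v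
    by (rule Suc.IH[of "\<lambda>x. frechet_derivative f (at x) v"])
      (use Suc.prems frechet_derivative_cong_open[OF assms(1), of _ f g] in auto)
  moreover have "g differentiable at x" if "x \<in> S" for x
    using differentiable_cong_open[OF assms(1) that, of f g] Suc.prems that by auto
  ultimately show ?case by simp
qed

text \<open>\<open>frechet_derivative\<close> is a description and awkward in inductions. By
  uniqueness any explicit derivative \<open>f'\<close> may take its place; openness of
  \<open>S\<close> carries the agreement on \<open>S\<close> over to higher orders.\<close>

lemma times_differentiable_on_SucI:
  assumes "open S" "\<And>x. x \<in> S \<Longrightarrow> (f has_derivative f' x) (at x)"
    and "\<And>v. times_differentiable_on k S (\<lambda>x. f' x v)"
  shows "times_differentiable_on (Suc k) S f"
proof -
  have "frechet_derivative f (at x) = f' x" if "x \<in> S" for x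
    using assms(2)[OF that] frechet_derivative_at by metis
  then have "times_differentiable_on k S (\<lambda>x. frechet_derivative f (at x) v)" for v
    by (intro times_differentiable_on_cong[OF assms(1) _ assms(3)[of v]]) auto
  then show ?thesis using assms(2) by (auto simp: differentiable_def)
qed

lemma times_differentiable_on_SucD:
  assumes "times_differentiable_on (Suc k) S f" "x \<in> S"
  shows "(f has_derivative frechet_derivative f (at x)) (at x)"
  using assms by (auto simp: frechet_derivative_works)

lemma times_differentiable_on_const:
  "open S \<Longrightarrow> times_differentiable_on k S (\<lambda>x. a)"
proof (induction k arbitrary: a)
  case (Suc k)
  then show ?case by (intro times_differentiable_on_SucI[where f'="\<lambda>_ _. 0"]) auto
qed auto

lemma times_differentiable_on_linear:
  assumes "open S" "bounded_linear h"
  shows "times_differentiable_on k S h"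
proof (cases k)
  case 0
  then show ?thesis using assms by (simp add: linear_continuous_on)
next
  case (Suc j)
  then show ?thesis
    using assms
    by (auto intro!: times_differentiable_on_SucI[where f'="\<lambda>_. h"] times_differentiable_on_const
        simp del: times_differentiable_on.simps intro: bounded_linear_imp_has_derivative)
qed

lemma times_differentiable_on_add:
  assumes "open S" "times_differentiable_on k S f" "times_differentiable_on k S g"
  shows "times_differentiable_on k S (\<lambda>x. f x + g x)"
  using assms(2,3)
proof (induction k arbitrary: f g)
  case 0
  then show ?case by (simp add: continuous_on_add)
next
  case (Suc k)
  show ?case
    by (rule times_differentiable_on_SucI[OF assms(1) has_derivative_add])
      (use Suc times_differentiable_on_SucD[OF Suc.prems(1)] times_differentiable_on_SucD[OF Suc.prems(2)] in auto)
qed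

lemma times_differentiable_on_sum:
  assumes "open S" "\<And>i. i \<in> I \<Longrightarrow> times_differentiable_on k S (f i)"
  shows "times_differentiable_on k S (\<lambda>x. \<Sum>i\<in>I. f i x)"
  using assms(2)
  by (induction I rule: infinite_finite_induct)
    (auto intro: times_differentiable_on_add times_differentiable_on_const assms(1))

lemma times_differentiable_on_bilinear:
  assumes h: "bounded_bilinear h" and "open S"
    and "times_differentiable_on k S f" "times_differentiable_on k S g"
  shows "times_differentiable_on k S (\<lambda>x. h (f x) (g x))"
  using assms(3,4)
proof (induction k arbitrary: f g)
  case 0
  then show ?case using bounded_bilinear.continuous_on[OF h] by simp
next
  case (Suc k)
  note fg = times_differentiable_on_SucD[OF Suc.prems(1)] times_differentiable_on_SucD[OF Suc.prems(2)]
  show ?case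
  proof (rule times_differentiable_on_SucI[OF assms(2)])
    show "((\<lambda>x. h (f x) (g x)) has_derivative
       (\<lambda>v. h (f x) (frechet_derivative g (at x) v) + h (frechet_derivative f (at x) v) (g x))) (at x)"
      if "x \<in> S" for x
      by (rule bounded_bilinear.FDERIV[OF h fg(1)[OF that] fg(2)[OF that]])
    show "times_differentiable_on k S (\<lambda>x. h (f x) (frechet_derivative g (at x) v) +
       h (frechet_derivative f (at x) v) (g x))" for v
      using Suc times_differentiable_on_mono[OF Suc.prems(1)] times_differentiable_on_mono[OF Suc.prems(2)]
      by (intro times_differentiable_on_add assms(2) Suc.IH) auto
  qed
qed

text \<open>The chain rule gives \<open>Dg(f x)(Df x v)\<close>, whose direction varies with
  \<open>x\<close>, while the definition speaks of derivatives in fixed directions. Expanding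
  \<open>Df x v\<close> in a basis yields a sum of products with \<open>Dg(f x) i\<close>, to which
  the induction hypothesis applies; hence the Euclidean middle space.\<close>

lemma times_differentiable_on_compose:
  fixes f :: "'a::real_normed_vector \<Rightarrow> 'b::euclidean_space" and g :: "'b \<Rightarrow> 'c::real_normed_vector"
  assumes "open S" "open T" "f ` S \<subseteq> T"
    and "times_differentiable_on k S f" "times_differentiable_on k T g"
  shows "times_differentiable_on k S (\<lambda>x. g (f x))"
  using assms(4,5)
proof (induction k arbitrary: g)
  case 0
  then show ?case using assms(3) by (auto intro: continuous_on_compose2)
next
  case (Suc k)
  let ?Df = "\<lambda>x. frechet_derivative f (at x)" and ?Dg = "\<lambda>y. frechet_derivative g (at y)"
  note f = times_differentiable_on_SucD[OF Suc.prems(1)]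
  note g = times_differentiable_on_SucD[OF Suc.prems(2)]
  show ?case
  proof (rule times_differentiable_on_SucI[OF assms(1)])
    fix x assume x: "x \<in> S"
    then have fx: "f x \<in> T" using assms(3) by auto
    have "((\<lambda>x. g (f x)) has_derivative (\<lambda>v. ?Dg (f x) (?Df x v))) (at x)"
      using has_derivative_compose[OF f[OF x] g[OF fx]] .
    moreover have "?Dg (f x) (?Df x v) = (\<Sum>i\<in>Basis. (?Df x v \<bullet> i) *\<^sub>R ?Dg (f x) i)" for v
    proof -
      have lin: "linear (?Dg (f x))" using g[OF fx] has_derivative_linear by blast
      have "?Dg (f x) (?Df x v) = ?Dg (f x) (\<Sum>i\<in>Basis. (?Df x v \<bullet> i) *\<^sub>R i)"
        by (simp add: euclidean_representation)
      then show ?thesis by (simp add: linear_sum[OF lin] linear_cmul[OF lin])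
    qed
    ultimately show "((\<lambda>x. g (f x)) has_derivative
        (\<lambda>v. \<Sum>i\<in>Basis. (?Df x v \<bullet> i) *\<^sub>R ?Dg (f x) i)) (at x)"
      by simp
  next
    fix v
    have "times_differentiable_on k S (\<lambda>x. ?Dg (f x) i)" for i
      using Suc.IH[OF times_differentiable_on_mono[OF Suc.prems(1)]] Suc.prems(2) by auto
    moreover have "times_differentiable_on k S (\<lambda>x. ?Df x v \<bullet> i)" for i :: 'b
      using Suc.prems(1)
      by (intro times_differentiable_on_bilinear[OF bounded_bilinear_inner assms(1)]
          times_differentiable_on_const assms(1)) auto
    ultimately show "times_differentiable_on k S (\<lambda>x. \<Sum>i\<in>Basis. (?Df x v \<bullet> i) *\<^sub>R ?Dg (f x) i)"
      by (intro times_differentiable_on_sum assms(1)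
          times_differentiable_on_bilinear[OF bounded_bilinear_scaleR])
  qed
qed

text \<open>The derivative of \<open>1/f\<close> is a polynomial in \<open>1/f\<close> and the
  derivative of \<open>f\<close>, both of which are controlled at one order less.\<close>

lemma times_differentiable_on_inverse:
  fixes f :: "'a::real_normed_vector \<Rightarrow> real"
  assumes "open S" "times_differentiable_on k S f" "\<And>x. x \<in> S \<Longrightarrow> f x \<noteq> 0"
  shows "times_differentiable_on k S (\<lambda>x. inverse (f x))"
  using assms(2)
proof (induction k)
  case 0
  then show ?case using assms(3) by (auto intro: continuous_on_inverse)
next
  case (Suc k)
  note IH = Suc.IH[OF times_differentiable_on_mono[OF Suc.prems]]
  show ?case
  proof (rule times_differentiable_on_SucI[OF assms(1)])
    show "((\<lambda>x. inverse (f x)) has_derivative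
       (\<lambda>v. (- 1 * frechet_derivative f (at x) v) * (inverse (f x) * inverse (f x)))) (at x)"
      if "x \<in> S" for x
      using Deriv.has_derivative_inverse[OF assms(3)[OF that] times_differentiable_on_SucD[OF Suc.prems that]]
      by (simp add: algebra_simps)
    show "times_differentiable_on k S
       (\<lambda>x. (- 1 * frechet_derivative f (at x) v) * (inverse (f x) * inverse (f x)))" for v
      using IH Suc.prems
      by (intro times_differentiable_on_bilinear[OF bounded_bilinear_mult assms(1)]
          times_differentiable_on_const assms(1)) auto
  qed
qed

text \<open>Smoothness of the germ at \<open>x\<close>: functions that agree near \<open>x\<close>
  are interchangeable, and compositions need no bookkeeping of domains.\<close>

definition smooth_near :: "('a::real_normed_vector \<Rightarrow> 'b::real_normed_vector) \<Rightarrow> 'a \<Rightarrow> bool" where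
  "smooth_near f x \<longleftrightarrow> (\<exists>S. open S \<and> x \<in> S \<and> smooth_on S f)"

lemma smooth_on_subset: "smooth_on S f \<Longrightarrow> T \<subseteq> S \<Longrightarrow> smooth_on T f"
  by (auto simp: smooth_on_def intro: times_differentiable_on_subset)

lemma smooth_nearI: "smooth_on S f \<Longrightarrow> open S \<Longrightarrow> x \<in> S \<Longrightarrow> smooth_near f x"
  by (auto simp: smooth_near_def)

lemma smooth_near_eventually:
  assumes "smooth_near f x"
  shows "\<forall>\<^sub>F y in nhds x. smooth_near f y"
  using assms unfolding smooth_near_def eventually_nhds by blast

lemma smooth_near_cong:
  assumes "smooth_near f x" "\<forall>\<^sub>F y in nhds x. f y = g y"
  shows "smooth_near g x"
proof -
  obtain S T where "open S" "x \<in> S" "smooth_on S f" "open T" "x \<in> T" "\<And>y. y \<in> T \<Longrightarrow> f y = g y"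
    using assms unfolding smooth_near_def eventually_nhds by blast
  then show ?thesis
    unfolding smooth_near_def smooth_on_def
    by (intro exI[of _ "S \<inter> T"])
      (auto intro!: times_differentiable_on_cong[of "S \<inter> T" f g] elim: times_differentiable_on_subset)
qed

lemma smooth_on_iff_smooth_near:
  assumes "open S"
  shows "smooth_on S f \<longleftrightarrow> (\<forall>x\<in>S. smooth_near f x)"
proof -
  have *: "times_differentiable_on k S f" if "\<forall>x\<in>S. \<exists>T. open T \<and> x \<in> T \<and> times_differentiable_on k T f" for k
    using that
  proof (induction k arbitrary: f)
    case 0
    then show ?case
      by (auto simp: continuous_on_eq_continuous_at assms)
  next
    case (Suc k)
    show ?case
      unfolding times_differentiable_on.simps(2)
    proof (intro conjI allI ballI Suc.IH)
      fix x assume "x \<in> S"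
      then obtain T where T: "open T" "x \<in> T" "times_differentiable_on (Suc k) T f"
        using Suc.prems by blast
      then show "f differentiable at x" by simp
      show "\<exists>T. open T \<and> x \<in> T \<and> times_differentiable_on k T (\<lambda>y. frechet_derivative f (at y) v)" for v
        using T by auto
    qed
  qed
  show ?thesis
    unfolding smooth_near_def smooth_on_def
    using assms * by (metis (no_types, lifting))
qed

lemma isCont_eventually_nhds:
  assumes "isCont f x" "open U" "f x \<in> U"
  shows "\<forall>\<^sub>F y in nhds x. f y \<in> U"
  using assms by (metis isCont_def tendsto_at_iff_tendsto_nhds topological_tendstoD)

lemma smooth_near_has_derivative:
  assumes "smooth_near f x"
  shows "(f has_derivative frechet_derivative f (at x)) (at x)"
  using assms times_differentiable_on_SucD unfolding smooth_near_def smooth_on_def by blast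

lemma smooth_near_isCont: "smooth_near f x \<Longrightarrow> isCont f x"
  using smooth_near_has_derivative has_derivative_continuous by blast

lemma smooth_near_frechet_derivative:
  assumes "smooth_near f x"
  shows "smooth_near (\<lambda>y. frechet_derivative f (at y) v) x"
proof -
  obtain S where "open S" "x \<in> S" "\<And>k. times_differentiable_on (Suc k) S f"
    using assms unfolding smooth_near_def smooth_on_def by blast
  then show ?thesis by (auto simp: smooth_near_def smooth_on_def)
qed

lemma smooth_near_const: "smooth_near (\<lambda>x. a) x"
  unfolding smooth_near_def smooth_on_def using times_differentiable_on_const open_UNIV by blast

lemma smooth_near_linear: "bounded_linear h \<Longrightarrow> smooth_near h x"
  unfolding smooth_near_def smooth_on_def using times_differentiable_on_linear open_UNIV by blast

lemma smooth_near_ident: "smooth_near (\<lambda>x. x) x"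
  by (rule smooth_near_linear[OF bounded_linear_ident])

lemma smooth_near_bilinear:
  assumes "bounded_bilinear h" "smooth_near f x" "smooth_near g x"
  shows "smooth_near (\<lambda>x. h (f x) (g x)) x"
proof -
  obtain S T where "open S" "x \<in> S" "smooth_on S f" "open T" "x \<in> T" "smooth_on T g"
    using assms unfolding smooth_near_def by blast
  then show ?thesis
    unfolding smooth_near_def smooth_on_def
    by (intro exI[of _ "S \<inter> T"])
      (auto intro!: times_differentiable_on_bilinear[OF assms(1)] intro: times_differentiable_on_subset)
qed

lemma smooth_near_add:
  assumes "smooth_near f x" "smooth_near g x"
  shows "smooth_near (\<lambda>x. f x + g x) x"
proof -
  obtain S T where "open S" "x \<in> S" "smooth_on S f" "open T" "x \<in> T" "smooth_on T g"
    using assms unfolding smooth_near_def by blast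
  then show ?thesis
    unfolding smooth_near_def smooth_on_def
    by (intro exI[of _ "S \<inter> T"])
      (auto intro!: times_differentiable_on_add intro: times_differentiable_on_subset)
qed

lemma smooth_near_sum:
  "(\<And>i. i \<in> I \<Longrightarrow> smooth_near (f i) x) \<Longrightarrow> smooth_near (\<lambda>x. \<Sum>i\<in>I. f i x) x"
  by (induction I rule: infinite_finite_induct) (auto intro: smooth_near_add smooth_near_const)

lemma smooth_near_prod:
  fixes f :: "'i \<Rightarrow> 'a::real_normed_vector \<Rightarrow> real"
  shows "(\<And>i. i \<in> I \<Longrightarrow> smooth_near (f i) x) \<Longrightarrow> smooth_near (\<lambda>x. \<Prod>i\<in>I. f i x) x"
  by (induction I rule: infinite_finite_induct)
    (auto intro: smooth_near_bilinear[OF bounded_bilinear_mult] smooth_near_const)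

lemma smooth_near_inverse:
  fixes f :: "'a::real_normed_vector \<Rightarrow> real"
  assumes "smooth_near f x" "f x \<noteq> 0"
  shows "smooth_near (\<lambda>x. inverse (f x)) x"
proof -
  obtain S where S: "open S" "x \<in> S" "smooth_on S f"
    using assms unfolding smooth_near_def by blast
  have "\<forall>\<^sub>F y in nhds x. f y \<noteq> 0"
    using isCont_eventually_nhds[OF smooth_near_isCont[OF assms(1)], of "- {0}"] assms(2) by auto
  then obtain T where "open T" "x \<in> T" "\<And>y. y \<in> T \<Longrightarrow> f y \<noteq> 0"
    unfolding eventually_nhds by blast
  then have "smooth_on (S \<inter> T) (\<lambda>x. inverse (f x))"
    using S smooth_on_subset[OF S(3), of "S \<inter> T"] unfolding smooth_on_def
    by (intro allI times_differentiable_on_inverse) auto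
  with S \<open>open T\<close> \<open>x \<in> T\<close> show ?thesis by (auto intro: smooth_nearI)
qed

lemma smooth_near_compose:
  fixes f :: "'a::real_normed_vector \<Rightarrow> 'b::euclidean_space" and g :: "'b \<Rightarrow> 'c::real_normed_vector"
  assumes f: "smooth_near f x" and "smooth_near g (f x)"
  shows "smooth_near (\<lambda>x. g (f x)) x"
proof -
  obtain T where T: "open T" "f x \<in> T" "smooth_on T g"
    using assms unfolding smooth_near_def by blast
  obtain S where S: "open S" "x \<in> S" "smooth_on S f"
    using assms unfolding smooth_near_def by blast
  have "continuous_on S f"
    using S times_differentiable_on.simps(1) unfolding smooth_on_def by blast
  then have "open (S \<inter> f -` T)"
    using S T by (intro continuous_open_preimage)
  moreover have "smooth_on (S \<inter> f -` T) (\<lambda>x. g (f x))"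
    unfolding smooth_on_def
  proof
    show "times_differentiable_on k (S \<inter> f -` T) (\<lambda>x. g (f x))" for k
    proof (rule times_differentiable_on_compose[of _ T])
      show "times_differentiable_on k (S \<inter> f -` T) f" "times_differentiable_on k T g"
        using S(3) T(3) times_differentiable_on_subset unfolding smooth_on_def by blast+
    qed (use calculation T in auto)
  qed
  ultimately show ?thesis using S T by (auto intro: smooth_nearI)
qed

lemma smooth_near_linear_compose:
  "bounded_linear h \<Longrightarrow> smooth_near f x \<Longrightarrow> smooth_near (\<lambda>x. h (f x)) x"
  for f :: "'a::real_normed_vector \<Rightarrow> 'b::euclidean_space"
  using smooth_near_compose smooth_near_linear by blast

lemma smooth_near_componentwise:
  fixes f :: "'a::real_normed_vector \<Rightarrow> 'b::euclidean_space"
  assumes "\<And>i. i \<in> Basis \<Longrightarrow> smooth_near (\<lambda>x. f x \<bullet> i) x"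
  shows "smooth_near f x"
proof -
  have "smooth_near (\<lambda>x. \<Sum>i\<in>Basis. (f x \<bullet> i) *\<^sub>R i) x"
    using assms by (intro smooth_near_sum smooth_near_bilinear[OF bounded_bilinear_scaleR] smooth_near_const)
  then show ?thesis by (simp add: euclidean_representation)
qed

lemma smooth_near_Pair:
  fixes f :: "'a::real_normed_vector \<Rightarrow> 'b::euclidean_space" and g :: "'a \<Rightarrow> 'c::euclidean_space"
  assumes "smooth_near f x" "smooth_near g x"
  shows "smooth_near (\<lambda>x. (f x, g x)) x"
proof -
  have "smooth_near (\<lambda>x. (f x, 0) + (0, g x)) x"
    by (intro smooth_near_add smooth_near_linear_compose[of "\<lambda>u. (u, 0)"]
        smooth_near_linear_compose[of "\<lambda>u. (0, u)"] assms bounded_linear_Pair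
        bounded_linear_ident bounded_linear_zero)
  then show ?thesis by simp
qed

section \<open>Smooth maps between manifolds\<close>

abbreviation chart_inv :: "('p, 'e) chart \<Rightarrow> 'e \<Rightarrow> 'p" where
  "chart_inv c \<equiv> inv_into (fst c) (snd c)"

text \<open>The local part of being a smooth manifold. Euclidean space, products and Grassmannians
  all enter as atlases of this kind.\<close>

definition smooth_atlas :: "('p, 'e::euclidean_space) chart set \<Rightarrow> bool" where
  "smooth_atlas A \<longleftrightarrow> A \<subseteq> charts_of A"

lemma smooth_manifold_atlas: "smooth_manifold A \<Longrightarrow> smooth_atlas A"
  by (simp add: smooth_manifold_def smooth_atlas_def)

lemma smooth_atlasD:
  assumes "smooth_atlas A" "c \<in> A"
  shows "inj_on (snd c) (fst c)" "open (snd c ` fst c)" "d \<in> A \<Longrightarrow> compatible_charts c d"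
  using assms unfolding smooth_atlas_def charts_of_def by blast+

lemma smooth_atlas_openin:
  "smooth_atlas A \<Longrightarrow> openin (manifold_topology A) U \<longleftrightarrow>
     U \<subseteq> points A \<and> (\<forall>c\<in>A. open (snd c ` (U \<inter> fst c)))"
  by (rule openin_manifold_topology) (rule smooth_atlasD)

lemma smooth_atlas_openin_chart:
  assumes "smooth_atlas A" "c \<in> A"
  shows "openin (manifold_topology A) (fst c)"
  using assms smooth_atlasD(3)[OF assms(1) assms(2)]
  unfolding smooth_atlas_openin[OF assms(1)] points_def compatible_charts_def by auto

lemma topspace_manifold_topology:
  assumes "smooth_atlas A"
  shows "topspace (manifold_topology A) = points A"
proof
  show "topspace (manifold_topology A) \<subseteq> points A"
    by (metis openin_topspace assms smooth_atlas_openin)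
  show "points A \<subseteq> topspace (manifold_topology A)"
    using smooth_atlas_openin_chart[OF assms] openin_subset unfolding points_def by blast
qed

lemma chart_inv_chart: "smooth_atlas A \<Longrightarrow> c \<in> A \<Longrightarrow> x \<in> fst c \<Longrightarrow> chart_inv c (snd c x) = x"
  by (simp add: smooth_atlasD(1) inv_into_f_f)

lemma eventually_chart_image:
  assumes "smooth_atlas A" "c \<in> A" "x \<in> fst c" "openin (manifold_topology A) U" "x \<in> U"
  shows "\<forall>\<^sub>F w in nhds (snd c x). chart_inv c w \<in> U \<and> chart_inv c w \<in> fst c \<and> snd c (chart_inv c w) = w"
proof -
  have "\<forall>\<^sub>F w in nhds (snd c x). w \<in> snd c ` (U \<inter> fst c)"
    using assms smooth_atlas_openin by (intro eventually_nhds_in_open) auto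
  then show ?thesis
    by eventually_elim (use chart_inv_chart[OF assms(1,2)] in auto)
qed

lemma chart_transition:
  assumes A: "smooth_atlas A" and c: "c \<in> A" "x \<in> fst c" and d: "d \<in> A" "x \<in> fst d"
  shows "\<forall>\<^sub>F w in nhds (snd c x). chart_inv c w \<in> fst d"
    and "smooth_near (\<lambda>w. snd d (chart_inv c w)) (snd c x)"
proof -
  have "openin (manifold_topology A) (fst d)"
    using smooth_atlas_openin_chart[OF A d(1)] .
  from eventually_chart_image[OF A c this d(2)]
  show "\<forall>\<^sub>F w in nhds (snd c x). chart_inv c w \<in> fst d"
    by eventually_elim auto
  show "smooth_near (\<lambda>w. snd d (chart_inv c w)) (snd c x)"
    using smooth_atlasD(3)[OF A c(1) d(1)] c d unfolding compatible_charts_def comp_def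
    by (auto intro!: smooth_nearI[of "snd c ` (fst c \<inter> fst d)"])
qed

text \<open>One pair of charts is enough to establish the property; \<open>smooth_map_atD\<close>
  then delivers it for every pair. That nearby values stay in \<open>fst d\<close> encodes
  continuity, since a coordinate map carries no information outside its domain.\<close>

definition smooth_map_at ::
  "('p, 'e::euclidean_space) chart set \<Rightarrow> ('q, 'f::euclidean_space) chart set \<Rightarrow> ('p \<Rightarrow> 'q) \<Rightarrow> 'p \<Rightarrow> bool" where
  "smooth_map_at A B f x \<longleftrightarrow>
     (\<exists>c\<in>A. \<exists>d\<in>B. x \<in> fst c \<and> f x \<in> fst d \<and>
        (\<forall>\<^sub>F w in nhds (snd c x). f (chart_inv c w) \<in> fst d) \<and>
        smooth_near (\<lambda>w. snd d (f (chart_inv c w))) (snd c x))"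

lemma smooth_map_at_points:
  "smooth_map_at A B f x \<Longrightarrow> x \<in> points A" "smooth_map_at A B f x \<Longrightarrow> f x \<in> points B"
  by (auto simp: smooth_map_at_def points_def)

text \<open>Near \<open>snd c x\<close> the expression of \<open>f\<close> in \<open>c\<close> and
  \<open>d\<close> is the one in \<open>c0\<close> and \<open>d0\<close> with transition maps on
  both sides. \<open>T\<close> is the transition at the source, \<open>h\<close> the intermediate
  expression in \<open>c\<close> and \<open>d0\<close>.\<close>

lemma smooth_map_atD:
  assumes A: "smooth_atlas A" and B: "smooth_atlas B" and "smooth_map_at A B f x"
    and c: "c \<in> A" "x \<in> fst c" and d: "d \<in> B" "f x \<in> fst d"
  shows "\<forall>\<^sub>F w in nhds (snd c x). f (chart_inv c w) \<in> fst d"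
    and "smooth_near (\<lambda>w. snd d (f (chart_inv c w))) (snd c x)"
proof -
  obtain c0 d0 where c0: "c0 \<in> A" "x \<in> fst c0" and d0: "d0 \<in> B" "f x \<in> fst d0"
    and ev: "\<forall>\<^sub>F w in nhds (snd c0 x). f (chart_inv c0 w) \<in> fst d0"
    and sm: "smooth_near (\<lambda>w. snd d0 (f (chart_inv c0 w))) (snd c0 x)"
    using assms(3) unfolding smooth_map_at_def by blast
  define T where "T = (\<lambda>w. snd c0 (chart_inv c w))"
  have T: "smooth_near T (snd c x)" and evT: "\<forall>\<^sub>F w in nhds (snd c x). chart_inv c w \<in> fst c0"
    using chart_transition[OF A c c0] by (simp_all add: T_def)
  have Tx: "T (snd c x) = snd c0 x" by (simp add: T_def chart_inv_chart[OF A c])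
  have fT: "chart_inv c0 (T w) = chart_inv c w" if "chart_inv c w \<in> fst c0" for w
    using that by (simp add: T_def chart_inv_chart[OF A c0(1)])
  have "filterlim T (nhds (snd c0 x)) (nhds (snd c x))"
    using smooth_near_isCont[OF T] Tx by (metis isCont_def tendsto_at_iff_tendsto_nhds)
  then have "\<forall>\<^sub>F w in nhds (snd c x). f (chart_inv c0 (T w)) \<in> fst d0"
    using ev by (rule filterlim_iff[THEN iffD1, rule_format])
  with evT have ev0: "\<forall>\<^sub>F w in nhds (snd c x). f (chart_inv c w) \<in> fst d0"
    by eventually_elim (simp add: fT)
  define h where "h = (\<lambda>w. snd d0 (f (chart_inv c w)))"
  have "smooth_near (\<lambda>w. snd d0 (f (chart_inv c0 (T w)))) (snd c x)"
    using smooth_near_compose[OF T, of "\<lambda>w. snd d0 (f (chart_inv c0 w))"] sm Tx by simp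
  then have h: "smooth_near h (snd c x)"
    by (rule smooth_near_cong) (use evT in eventually_elim, simp add: fT h_def)
  have hx: "h (snd c x) = snd d0 (f x)" by (simp add: h_def chart_inv_chart[OF A c])
  have lim: "filterlim h (nhds (snd d0 (f x))) (nhds (snd c x))"
    using smooth_near_isCont[OF h] hx by (metis isCont_def tendsto_at_iff_tendsto_nhds)
  have fh: "chart_inv d0 (h w) = f (chart_inv c w)" if "f (chart_inv c w) \<in> fst d0" for w
    using that by (simp add: h_def chart_inv_chart[OF B d0(1)])
  note tr = chart_transition[OF B d0 d]
  have "\<forall>\<^sub>F w in nhds (snd c x). chart_inv d0 (h w) \<in> fst d"
    using lim tr(1) by (rule filterlim_iff[THEN iffD1, rule_format])
  with ev0 show "\<forall>\<^sub>F w in nhds (snd c x). f (chart_inv c w) \<in> fst d"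
    by eventually_elim (simp add: fh)
  have "smooth_near (\<lambda>w. snd d (chart_inv d0 (h w))) (snd c x)"
    using smooth_near_compose[OF h, of "\<lambda>w. snd d (chart_inv d0 w)"] tr(2) hx by simp
  then show "smooth_near (\<lambda>w. snd d (f (chart_inv c w))) (snd c x)"
    by (rule smooth_near_cong) (use ev0 in eventually_elim, simp add: fh)
qed

lemma smooth_map_at_compose:
  assumes A: "smooth_atlas A" and B: "smooth_atlas B" and C: "smooth_atlas C"
    and f: "smooth_map_at A B f x" and g: "smooth_map_at B C g (f x)"
  shows "smooth_map_at A C (\<lambda>x. g (f x)) x"
proof -
  obtain c d e where c: "c \<in> A" "x \<in> fst c" and d: "d \<in> B" "f x \<in> fst d" and e: "e \<in> C" "g (f x) \<in> fst e"
    using f g unfolding smooth_map_at_def by blast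
  note f' = smooth_map_atD[OF A B f c d] and g' = smooth_map_atD[OF B C g d e]
  let ?h = "\<lambda>w. snd d (f (chart_inv c w))"
  have hx: "?h (snd c x) = snd d (f x)" by (simp add: chart_inv_chart[OF A c])
  have lim: "filterlim ?h (nhds (snd d (f x))) (nhds (snd c x))"
    using smooth_near_isCont[OF f'(2)] hx by (metis isCont_def tendsto_at_iff_tendsto_nhds)
  have fh: "chart_inv d (?h w) = f (chart_inv c w)" if "f (chart_inv c w) \<in> fst d" for w
    using that by (simp add: chart_inv_chart[OF B d(1)])
  have "\<forall>\<^sub>F w in nhds (snd c x). g (chart_inv d (?h w)) \<in> fst e"
    using lim g'(1) by (rule filterlim_iff[THEN iffD1, rule_format])
  with f'(1) have ev: "\<forall>\<^sub>F w in nhds (snd c x). g (f (chart_inv c w)) \<in> fst e"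
    by eventually_elim (simp add: fh)
  have "smooth_near (\<lambda>w. snd e (g (chart_inv d (?h w)))) (snd c x)"
    using smooth_near_compose[OF f'(2), of "\<lambda>w. snd e (g (chart_inv d w))"] g'(2) hx by simp
  then have "smooth_near (\<lambda>w. snd e (g (f (chart_inv c w)))) (snd c x)"
    by (rule smooth_near_cong) (use f'(1) in eventually_elim, simp add: fh)
  with ev c e show ?thesis unfolding smooth_map_at_def by blast
qed

lemma smooth_map_at_eventually:
  assumes A: "smooth_atlas A" and f: "smooth_map_at A B f x" and c: "c \<in> A" "x \<in> fst c"
    and B: "smooth_atlas B"
  shows "\<forall>\<^sub>F w in nhds (snd c x). smooth_map_at A B f (chart_inv c w)"
proof -
  obtain d where d: "d \<in> B" "f x \<in> fst d" using f unfolding smooth_map_at_def by blast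
  note f' = smooth_map_atD[OF A B f c d]
  have 1: "\<forall>\<^sub>F w in nhds (snd c x). chart_inv c w \<in> fst c \<and> snd c (chart_inv c w) = w"
    using eventually_chart_image[OF A c smooth_atlas_openin_chart[OF A c(1)] c(2)] by simp
  have 2: "\<forall>\<^sub>F w in nhds (snd c x). \<forall>\<^sub>F w' in nhds w. f (chart_inv c w') \<in> fst d"
    using f'(1) by (simp add: eventually_eventually)
  from 1 2 smooth_near_eventually[OF f'(2)] f'(1)
  show ?thesis
  proof eventually_elim
    case (elim w)
    then show ?case unfolding smooth_map_at_def using c(1) d(1) by metis
  qed
qed

lemma smooth_map_at_const:
  assumes "x \<in> points A" "a \<in> points B"
  shows "smooth_map_at A B (\<lambda>_. a) x"
  using assms unfolding smooth_map_at_def points_def by (auto simp: smooth_near_const)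

text \<open>Continuity makes the preimage of a chart domain open, so that the smoothness clause is
  about an open set of coordinates, as \<open>smooth_on\<close> presupposes.\<close>

lemma smooth_map_on_imp_at:
  assumes A: "smooth_atlas A" and B: "smooth_atlas B" and f: "smooth_map_on A B S f" and x: "x \<in> S"
  shows "smooth_map_at A B f x"
proof -
  have S: "openin (manifold_topology A) S" "f ` S \<subseteq> points B"
    "continuous_map (subtopology (manifold_topology A) S) (manifold_topology B) f"
    using f unfolding smooth_map_on_def by auto
  have "x \<in> points A" using S(1) x smooth_atlas_openin[OF A] by blast
  then obtain c where c: "c \<in> A" "x \<in> fst c" unfolding points_def by blast
  obtain d where d: "d \<in> B" "f x \<in> fst d" using S(2) x unfolding points_def by blast
  let ?Q = "S \<inter> f -` fst d"
  have "openin (subtopology (manifold_topology A) S) {y \<in> topspace (subtopology (manifold_topology A) S). f y \<in> fst d}"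
    (is "openin _ ?R")
    using openin_continuous_map_preimage[OF S(3) smooth_atlas_openin_chart[OF B d(1)]] .
  moreover have "topspace (subtopology (manifold_topology A) S) = S"
    using S(1) openin_subset by (metis topspace_subtopology_subset)
  then have "?R = ?Q" by auto
  ultimately have Q: "openin (manifold_topology A) ?Q"
    using S(1) by (metis openin_open_subtopology)
  have xQ: "x \<in> ?Q" using x d by simp
  have "snd c ` (?Q \<inter> fst c) = snd c ` (fst c \<inter> S \<inter> f -` fst d)"
    by (rule arg_cong[of _ _ "image (snd c)"]) blast
  then have "open (snd c ` (fst c \<inter> S \<inter> f -` fst d))"
    using Q c smooth_atlas_openin[OF A] by metis
  moreover have "smooth_on (snd c ` (fst c \<inter> S \<inter> f -` fst d)) (\<lambda>w. snd d (f (chart_inv c w)))"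
    using f c d unfolding smooth_map_on_def comp_def by auto
  ultimately have "smooth_near (\<lambda>w. snd d (f (chart_inv c w))) (snd c x)"
    using c x d by (intro smooth_nearI) auto
  moreover have "\<forall>\<^sub>F w in nhds (snd c x). f (chart_inv c w) \<in> fst d"
    using eventually_chart_image[OF A c Q xQ] by eventually_elim auto
  ultimately show ?thesis using c d unfolding smooth_map_at_def by blast
qed

section \<open>Maps from Euclidean spaces, in particular curves\<close>

lemma chart_inv_euclidean: "inv_into UNIV (\<lambda>x::'a. x) = (\<lambda>x. x)"
  by (rule ext) (simp add: inv_f_eq)

lemma smooth_atlas_euclidean: "smooth_atlas euclidean_atlas"
proof -
  have "smooth_on UNIV (\<lambda>x::'a. x)"
    by (auto simp: smooth_on_iff_smooth_near smooth_near_ident)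
  then show ?thesis
    by (auto simp: chart_inv_euclidean smooth_atlas_def charts_of_def compatible_charts_def euclidean_atlas_def points_def comp_def)
qed

lemma points_euclidean [simp]: "points euclidean_atlas = UNIV"
  by (simp add: points_def euclidean_atlas_def)

lemma manifold_topology_euclidean: "manifold_topology euclidean_atlas = euclidean"
  unfolding topology_eq smooth_atlas_openin[OF smooth_atlas_euclidean]
  by (simp add: euclidean_atlas_def points_def)

lemma smooth_map_at_euclidean_euclidean:
  "smooth_map_at euclidean_atlas euclidean_atlas f x \<longleftrightarrow> smooth_near f x"
  by (simp add: smooth_map_at_def euclidean_atlas_def chart_inv_euclidean)

lemma smooth_map_at_chart_inv:
  assumes "smooth_atlas A" "c \<in> A" "w \<in> snd c ` fst c"
  shows "smooth_map_at euclidean_atlas A (chart_inv c) w"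
proof -
  obtain x where x: "x \<in> fst c" "w = snd c x" using assms by blast
  show ?thesis
    using assms chart_transition[OF assms(1,2) x(1) assms(2) x(1)] x chart_inv_chart[OF assms(1,2) x(1)]
    unfolding smooth_map_at_def
    by (auto simp: euclidean_atlas_def chart_inv_euclidean)
qed

lemma smooth_map_at_euclidean_eventually:
  assumes B: "smooth_atlas B" and f: "smooth_map_at euclidean_atlas B f x"
  shows "\<forall>\<^sub>F y in nhds x. smooth_map_at euclidean_atlas B f y"
  using smooth_map_at_eventually[OF smooth_atlas_euclidean f _ _ B, of "(UNIV, \<lambda>x. x)"]
  by (simp add: euclidean_atlas_def chart_inv_euclidean)

lemma smooth_map_at_euclidean_chart:
  assumes B: "smooth_atlas B" and f: "smooth_map_at euclidean_atlas B f x" and d: "d \<in> B" "f x \<in> fst d"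
  shows "\<forall>\<^sub>F y in nhds x. f y \<in> fst d" "smooth_near (\<lambda>y. snd d (f y)) x"
  using smooth_map_atD[OF smooth_atlas_euclidean B f, of "(UNIV, \<lambda>x. x)" d] d
  by (simp_all add: euclidean_atlas_def chart_inv_euclidean)

lemma smooth_map_at_euclideanI:
  assumes "d \<in> B" "f x \<in> fst d" "\<forall>\<^sub>F y in nhds x. f y \<in> fst d" "smooth_near (\<lambda>y. snd d (f y)) x"
  shows "smooth_map_at euclidean_atlas B f x"
  unfolding smooth_map_at_def using assms
  by (auto simp: euclidean_atlas_def chart_inv_euclidean)

lemma smooth_map_at_euclidean_eventually_in:
  assumes B: "smooth_atlas B" and f: "smooth_map_at euclidean_atlas B f x"
    and U: "openin (manifold_topology B) U" "f x \<in> U"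
  shows "\<forall>\<^sub>F y in nhds x. f y \<in> U"
proof -
  obtain d where d: "d \<in> B" "f x \<in> fst d"
    using smooth_map_at_points(2)[OF f] unfolding points_def by blast
  note f' = smooth_map_at_euclidean_chart[OF B f d]
  have "open (snd d ` (U \<inter> fst d))" using U d smooth_atlas_openin[OF B] by blast
  then have "\<forall>\<^sub>F y in nhds x. snd d (f y) \<in> snd d ` (U \<inter> fst d)"
    using U d by (intro isCont_eventually_nhds[OF smooth_near_isCont[OF f'(2)]]) auto
  with f'(1) show ?thesis
    by eventually_elim (use smooth_atlasD(1)[OF B d(1)] in \<open>auto simp: inj_on_def\<close>)
qed

text \<open>The bridge from the curves in the definition of tangent spaces to germs: being smooth at
  each point makes preimages of open sets open, which supplies the continuity that
  \<open>smooth_map_on\<close> asks for.\<close>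

lemma smooth_map_on_euclidean:
  assumes B: "smooth_atlas B"
  shows "smooth_map_on euclidean_atlas B S f \<longleftrightarrow> open S \<and> (\<forall>x\<in>S. smooth_map_at euclidean_atlas B f x)"
proof
  assume f: "smooth_map_on euclidean_atlas B S f"
  then show "open S \<and> (\<forall>x\<in>S. smooth_map_at euclidean_atlas B f x)"
    using smooth_map_on_imp_at[OF smooth_atlas_euclidean B f]
    by (simp add: smooth_map_on_def manifold_topology_euclidean)
next
  assume "open S \<and> (\<forall>x\<in>S. smooth_map_at euclidean_atlas B f x)"
  then have S: "open S" and f: "\<And>x. x \<in> S \<Longrightarrow> smooth_map_at euclidean_atlas B f x" by auto
  have fB: "f ` S \<subseteq> points B" using smooth_map_at_points(2)[OF f] by auto
  have pre: "open (S \<inter> f -` U)" if U: "openin (manifold_topology B) U" for U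
  proof (subst open_subopen, intro ballI)
    fix x assume x: "x \<in> S \<inter> f -` U"
    have "\<forall>\<^sub>F y in nhds x. y \<in> S" using x S eventually_nhds_in_open by auto
    with smooth_map_at_euclidean_eventually_in[OF B f U, of x] x
    have "\<forall>\<^sub>F y in nhds x. y \<in> S \<inter> f -` U" by (simp add: eventually_conj_iff)
    then show "\<exists>T. open T \<and> x \<in> T \<and> T \<subseteq> S \<inter> f -` U"
      unfolding eventually_nhds by blast
  qed
  have "continuous_map (top_of_set S) (manifold_topology B) f"
    unfolding continuous_map
  proof (intro conjI allI impI)
    show "f ` topspace (top_of_set S) \<subseteq> topspace (manifold_topology B)"
      using fB by (simp add: topspace_manifold_topology[OF B])
    fix U assume "openin (manifold_topology B) U"
    from pre[OF this] show "openin (top_of_set S) {x \<in> topspace (top_of_set S). f x \<in> U}"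
      using S by (auto simp: openin_open_eq Collect_conj_eq vimage_def)
  qed
  moreover have "smooth_on (S \<inter> f -` fst d) (\<lambda>x. snd d (f x))" if d: "d \<in> B" for d
    unfolding smooth_on_iff_smooth_near[OF pre[OF smooth_atlas_openin_chart[OF B d]]]
    using smooth_map_at_euclidean_chart(2)[OF B f d] by auto
  ultimately show "smooth_map_on euclidean_atlas B S f"
    using S fB unfolding smooth_map_on_def manifold_topology_euclidean
    by (simp add: euclidean_atlas_def chart_inv_euclidean comp_def)
qed

section \<open>Products\<close>

lemma chart_inv_product:
  assumes "w \<in> snd c ` fst c" "v \<in> snd d ` fst d" "inj_on (snd c) (fst c)" "inj_on (snd d) (fst d)"
  shows "inv_into (fst c \<times> fst d) (map_prod (snd c) (snd d)) (w, v) = (chart_inv c w, chart_inv d v)"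
  by (rule inv_into_f_eq)
    (use assms in \<open>auto intro: map_prod_inj_on inv_into_into simp: f_inv_into_f\<close>)

lemma points_product [simp]: "points (product_atlas A B) = points A \<times> points B"
proof -
  have "points (product_atlas A B) = (\<Union>c\<in>A. \<Union>d\<in>B. fst c \<times> fst d)"
    unfolding points_def product_atlas_def by force
  then show ?thesis by (auto simp: points_def)
qed

lemma smooth_near_fst: "smooth_near fst x" and smooth_near_snd: "smooth_near snd x"
  by (auto intro!: smooth_near_linear bounded_linear_fst bounded_linear_snd)

lemma product_compatible:
  assumes "compatible_charts c c'" "compatible_charts d d'"
    and "inj_on (snd c) (fst c)" "inj_on (snd d) (fst d)" "inj_on (snd c') (fst c')" "inj_on (snd d') (fst d')"
  shows "compatible_charts (fst c \<times> fst d, map_prod (snd c) (snd d)) (fst c' \<times> fst d', map_prod (snd c') (snd d'))"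
proof -
  \<comment> \<open>One half of compatibility for arbitrary pairs of charts; exchanging the two
    pairs gives the other half.\<close>
  have *: "open (map_prod (snd c) (snd d) ` (fst c \<times> fst d \<inter> fst c' \<times> fst d')) \<and>
    smooth_on (map_prod (snd c) (snd d) ` (fst c \<times> fst d \<inter> fst c' \<times> fst d'))
     (map_prod (snd c') (snd d') \<circ> inv_into (fst c \<times> fst d) (map_prod (snd c) (snd d)))"
    if cc: "compatible_charts c c'" "compatible_charts d d'"
    and inj: "inj_on (snd c) (fst c)" "inj_on (snd d) (fst d)"
    for c c' :: "('a, 'b) chart" and d d' :: "('c, 'd) chart"
  proof -
    define S where "S = snd c ` (fst c \<inter> fst c')"
    define T where "T = snd d ` (fst d \<inter> fst d')"
    have o: "open S" "open T" "smooth_on S (\<lambda>x. snd c' (chart_inv c x))" "smooth_on T (\<lambda>x. snd d' (chart_inv d x))"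
      using cc unfolding compatible_charts_def S_def T_def comp_def by auto
    have im: "map_prod (snd c) (snd d) ` (fst c \<times> fst d \<inter> fst c' \<times> fst d') = S \<times> T"
      unfolding S_def T_def Times_Int_Times by (simp add: map_prod_image)
    have "smooth_on (S \<times> T) (map_prod (snd c') (snd d') \<circ> inv_into (fst c \<times> fst d) (map_prod (snd c) (snd d)))"
      unfolding smooth_on_iff_smooth_near[OF open_Times[OF o(1,2)]]
    proof
      fix x assume x: "x \<in> S \<times> T"
      then have "smooth_near (\<lambda>x. (snd c' (chart_inv c (fst x)), snd d' (chart_inv d (snd x)))) x"
        using o by (intro smooth_near_Pair smooth_near_compose[OF smooth_near_fst] smooth_near_compose[OF smooth_near_snd])
          (auto simp: smooth_on_iff_smooth_near)
      then show "smooth_near (map_prod (snd c') (snd d') \<circ> inv_into (fst c \<times> fst d) (map_prod (snd c) (snd d))) x"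
      proof (rule smooth_near_cong)
        have "\<forall>\<^sub>F y in nhds x. y \<in> S \<times> T"
          using x o open_Times eventually_nhds_in_open by blast
        then show "\<forall>\<^sub>F y in nhds x. (snd c' (chart_inv c (fst y)), snd d' (chart_inv d (snd y))) =
            (map_prod (snd c') (snd d') \<circ> inv_into (fst c \<times> fst d) (map_prod (snd c) (snd d))) y"
          by eventually_elim (use inj in \<open>auto simp: chart_inv_product S_def T_def\<close>)
      qed
    qed
    with im o show ?thesis by (simp add: open_Times)
  qed
  have "compatible_charts c' c" "compatible_charts d' d"
    using assms unfolding compatible_charts_def by (auto simp: Int_commute)
  from *[OF assms(1-4)] *[OF this assms(5,6)] show ?thesis
    unfolding compatible_charts_def by (simp add: Int_commute)
qed

lemma smooth_atlas_product:
  assumes A: "smooth_atlas A" and B: "smooth_atlas B"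
  shows "smooth_atlas (product_atlas A B)"
  unfolding smooth_atlas_def
proof
  fix e assume "e \<in> product_atlas A B"
  then obtain c d where e: "e = (fst c \<times> fst d, map_prod (snd c) (snd d))" and cd: "c \<in> A" "d \<in> B"
    unfolding product_atlas_def by blast
  note c = smooth_atlasD[OF A cd(1)] and d = smooth_atlasD[OF B cd(2)]
  have "fst e \<subseteq> points (product_atlas A B)"
    using cd unfolding points_product by (auto simp: e points_def)
  moreover have "inj_on (snd e) (fst e)"
    using c(1) d(1) by (simp add: e map_prod_inj_on)
  moreover have "open (snd e ` fst e)"
    using c(2) d(2) by (simp add: e map_prod_image open_Times)
  moreover have "compatible_charts e e'" if e': "e' \<in> product_atlas A B" for e'
  proof -
    obtain c' d' where "e' = (fst c' \<times> fst d', map_prod (snd c') (snd d'))" "c' \<in> A" "d' \<in> B"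
      using e' unfolding product_atlas_def by blast
    then show ?thesis
      using product_compatible[OF c(3) d(3) c(1) d(1), of c' d'] smooth_atlasD(1)[OF A, of c']
        smooth_atlasD(1)[OF B, of d'] e by simp
  qed
  ultimately show "e \<in> charts_of (product_atlas A B)"
    by (auto simp: charts_of_def)
qed

lemma smooth_map_at_Pair:
  assumes A: "smooth_atlas A" and B: "smooth_atlas B" and C: "smooth_atlas C"
    and f: "smooth_map_at A B f x" and g: "smooth_map_at A C g x"
  shows "smooth_map_at A (product_atlas B C) (\<lambda>x. (f x, g x)) x"
proof -
  obtain c d where c: "c \<in> A" "x \<in> fst c" and d: "d \<in> B" "f x \<in> fst d"
    using f unfolding smooth_map_at_def by blast
  obtain e where e: "e \<in> C" "g x \<in> fst e" using g unfolding smooth_map_at_def by blast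
  note f' = smooth_map_atD[OF A B f c d] and g' = smooth_map_atD[OF A C g c e]
  have "(fst d \<times> fst e, map_prod (snd d) (snd e)) \<in> product_atlas B C"
    using d e unfolding product_atlas_def by blast
  moreover have "\<forall>\<^sub>F w in nhds (snd c x). (f (chart_inv c w), g (chart_inv c w)) \<in> fst d \<times> fst e"
    using f'(1) g'(1) by eventually_elim simp
  ultimately show ?thesis
    unfolding smooth_map_at_def using c d e smooth_near_Pair[OF f'(2) g'(2)]
    by (intro bexI[of _ c] bexI[of _ "(fst d \<times> fst e, map_prod (snd d) (snd e))"]) auto
qed

section \<open>Tangent vectors in a chart\<close>

text \<open>The tangent vector whose coordinate in \<open>c\<close> is \<open>u\<close>; its other
  coordinates are forced by the derivatives of the transition maps. This identifies the tangent
  space at \<open>x\<close> with the model space.\<close>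

definition tangent_vector ::
  "('p, 'e::euclidean_space) chart set \<Rightarrow> ('p, 'e) chart \<Rightarrow> 'p \<Rightarrow> 'e \<Rightarrow> ('p, 'e) tangent" where
  "tangent_vector A c x u =
     (\<lambda>d. if d \<in> A \<and> x \<in> fst d then frechet_derivative (\<lambda>w. snd d (chart_inv c w)) (at (snd c x)) u else 0)"

text \<open>\<open>T_x S\<close> read in the chart \<open>c\<close>. Nothing here makes it a
  subspace; for lines this is proved later by means of retractions.\<close>

definition tangent_coords ::
  "('p, 'e::euclidean_space) chart set \<Rightarrow> ('p, 'e) chart \<Rightarrow> 'p set \<Rightarrow> 'p \<Rightarrow> 'e set" where
  "tangent_coords A c S x =
     {u. \<exists>\<gamma>. smooth_curve_through A S x \<gamma> \<and> ((\<lambda>t. snd c (\<gamma> t)) has_vector_derivative u) (at 0)}"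

lemma smooth_curve_through_iff:
  assumes A: "smooth_atlas A"
  shows "smooth_curve_through A S x \<gamma> \<longleftrightarrow>
    \<gamma> 0 = x \<and> smooth_map_at euclidean_atlas A \<gamma> 0 \<and> (\<forall>\<^sub>F t in nhds 0. \<gamma> t \<in> S)"
proof
  assume "smooth_curve_through A S x \<gamma>"
  then obtain \<epsilon> where "\<gamma> 0 = x" "\<epsilon> > 0" "smooth_map_on euclidean_atlas A {-\<epsilon><..<\<epsilon>} \<gamma>"
    and sub: "\<gamma> ` {-\<epsilon><..<\<epsilon>} \<subseteq> S"
    unfolding smooth_curve_through_def by blast
  moreover from this have "\<forall>\<^sub>F t in nhds 0. t \<in> {-\<epsilon><..<\<epsilon>}"
    by (intro eventually_nhds_in_open) auto
  then have "\<forall>\<^sub>F t in nhds 0. \<gamma> t \<in> S"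
    by eventually_elim (use sub in blast)
  ultimately show "\<gamma> 0 = x \<and> smooth_map_at euclidean_atlas A \<gamma> 0 \<and> (\<forall>\<^sub>F t in nhds 0. \<gamma> t \<in> S)"
    by (simp add: smooth_map_on_euclidean[OF A])
next
  assume r: "\<gamma> 0 = x \<and> smooth_map_at euclidean_atlas A \<gamma> 0 \<and> (\<forall>\<^sub>F t in nhds 0. \<gamma> t \<in> S)"
  then have "\<forall>\<^sub>F t in nhds 0. smooth_map_at euclidean_atlas A \<gamma> t \<and> \<gamma> t \<in> S"
    using smooth_map_at_euclidean_eventually[OF A, of \<gamma> 0] by (simp add: eventually_conj_iff)
  then obtain \<epsilon> where \<epsilon>: "\<epsilon> > 0" "\<And>t. dist t 0 < \<epsilon> \<Longrightarrow> smooth_map_at euclidean_atlas A \<gamma> t \<and> \<gamma> t \<in> S"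
    unfolding eventually_nhds_metric by blast
  moreover have "dist t 0 < \<epsilon>" if "t \<in> {-\<epsilon><..<\<epsilon>}" for t :: real
    using that by (simp add: dist_real_def abs_less_iff)
  ultimately show "smooth_curve_through A S x \<gamma>"
    using r unfolding smooth_curve_through_def by (auto simp: smooth_map_on_euclidean[OF A])
qed

lemma smooth_curve_through_chart:
  assumes A: "smooth_atlas A" and \<gamma>: "smooth_curve_through A S x \<gamma>" and c: "c \<in> A" "x \<in> fst c"
  shows "\<gamma> 0 = x" "smooth_near (\<lambda>t. snd c (\<gamma> t)) 0" "\<forall>\<^sub>F t in nhds 0. \<gamma> t \<in> fst c"
    "\<forall>\<^sub>F t in nhds 0. \<gamma> t \<in> S"
    "((\<lambda>t. snd c (\<gamma> t)) has_vector_derivative vector_derivative (\<lambda>t. snd c (\<gamma> t)) (at 0)) (at 0)"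
proof -
  show "\<gamma> 0 = x" "\<forall>\<^sub>F t in nhds 0. \<gamma> t \<in> S"
    using \<gamma> smooth_curve_through_iff[OF A] by auto
  then show s: "smooth_near (\<lambda>t. snd c (\<gamma> t)) 0" "\<forall>\<^sub>F t in nhds 0. \<gamma> t \<in> fst c"
    using \<gamma> smooth_curve_through_iff[OF A] c smooth_map_at_euclidean_chart[OF A _ c(1)] by auto
  show "((\<lambda>t. snd c (\<gamma> t)) has_vector_derivative vector_derivative (\<lambda>t. snd c (\<gamma> t)) (at 0)) (at 0)"
    using smooth_near_has_derivative[OF s(1)]
    unfolding vector_derivative_works[symmetric] differentiable_def by blast
qed

context
  fixes A :: "('p, 'e::euclidean_space) chart set" and c x
  assumes A: "smooth_atlas A" and c: "c \<in> A" "x \<in> fst c"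
begin

lemma linear_tangent_vector: "linear (\<lambda>u. tangent_vector A c x u d)"
  using has_derivative_linear[OF smooth_near_has_derivative[OF chart_transition(2)[OF A c, of d]]]
  by (cases "d \<in> A \<and> x \<in> fst d") (auto simp: tangent_vector_def linear_zero)

lemma tangent_vector_chart: "tangent_vector A c x u c = u"
proof -
  have "\<forall>\<^sub>F w in nhds (snd c x). snd c (chart_inv c w) = w"
    using eventually_chart_image[OF A c smooth_atlas_openin_chart[OF A c(1)] c(2)]
    by eventually_elim simp
  then obtain S where "open S" "snd c x \<in> S" "\<And>w. w \<in> S \<Longrightarrow> snd c (chart_inv c w) = w"
    unfolding eventually_nhds by blast
  then have "frechet_derivative (\<lambda>w. snd c (chart_inv c w)) (at (snd c x)) =
      frechet_derivative (\<lambda>w. w) (at (snd c x))"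
    by (intro frechet_derivative_cong_open) auto
  then show ?thesis using c by (simp add: tangent_vector_def)
qed

lemma inj_tangent_vector: "inj (tangent_vector A c x)"
  by (metis injI tangent_vector_chart)

text \<open>By the chain rule with the transition maps, the velocity in one chart determines the
  whole family.\<close>

lemma velocity_eq:
  assumes \<gamma>: "smooth_map_at euclidean_atlas A \<gamma> 0" "\<gamma> 0 = x"
    and u: "((\<lambda>t. snd c (\<gamma> t)) has_vector_derivative u) (at 0)"
  shows "velocity A \<gamma> = tangent_vector A c x u"
proof
  fix d
  show "velocity A \<gamma> d = tangent_vector A c x u d"
  proof (cases "d \<in> A \<and> x \<in> fst d")
    case True
    let ?T = "\<lambda>w. snd d (chart_inv c w)"
    let ?D = "frechet_derivative ?T (at (snd c x))"
    have "(?T has_derivative ?D) (at (snd c (\<gamma> 0)))"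
      using smooth_near_has_derivative[OF chart_transition(2)[OF A c, of d]] True \<gamma> by simp
    then have "((\<lambda>t. ?T (snd c (\<gamma> t))) has_derivative (\<lambda>s. ?D (s *\<^sub>R u))) (at 0)"
      using has_derivative_compose[of "\<lambda>t. snd c (\<gamma> t)" _ 0 UNIV ?T ?D] u
      unfolding has_vector_derivative_def by simp
    moreover have "?D (s *\<^sub>R u) = s *\<^sub>R ?D u" for s
      using linear_tangent_vector[of d] True by (auto simp: tangent_vector_def linear_cmul)
    ultimately have *: "((\<lambda>t. ?T (snd c (\<gamma> t))) has_vector_derivative ?D u) (at 0)"
      by (simp add: has_vector_derivative_def)
    have "\<forall>\<^sub>F t in nhds 0. \<gamma> t \<in> fst c"
      using smooth_map_at_euclidean_chart[OF A \<gamma>(1)] c \<gamma> by auto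
    then have "\<forall>\<^sub>F t in nhds 0. ?T (snd c (\<gamma> t)) = snd d (\<gamma> t)"
      by eventually_elim (simp add: chart_inv_chart[OF A c(1)])
    then obtain U where "open U" "0 \<in> U" "\<And>t. t \<in> U \<Longrightarrow> ?T (snd c (\<gamma> t)) = snd d (\<gamma> t)"
      unfolding eventually_nhds by blast
    with * have "((\<lambda>t. snd d (\<gamma> t)) has_vector_derivative ?D u) (at 0)"
      by (rule has_vector_derivative_transform_within_open)
    then show ?thesis
      using True \<gamma> by (simp add: velocity_def tangent_vector_def comp_def vector_derivative_at)
  qed (auto simp: velocity_def tangent_vector_def \<gamma>(2))
qed

lemma tangent_space_eq: "tangent_space A S x = tangent_vector A c x ` tangent_coords A c S x"
proof -
  have v: "velocity A \<gamma> = tangent_vector A c x u"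
    if "smooth_curve_through A S x \<gamma>" "((\<lambda>t. snd c (\<gamma> t)) has_vector_derivative u) (at 0)" for \<gamma> u
    using that smooth_curve_through_iff[OF A, of S x \<gamma>] by (intro velocity_eq) auto
  have "velocity A \<gamma> \<in> tangent_vector A c x ` tangent_coords A c S x"
    if \<gamma>: "smooth_curve_through A S x \<gamma>" for \<gamma>
    using v[OF \<gamma> smooth_curve_through_chart(5)[OF A \<gamma> c]] smooth_curve_through_chart(5)[OF A \<gamma> c] \<gamma>
    unfolding tangent_coords_def by blast
  moreover have "tangent_vector A c x u \<in> tangent_space A S x" if u: "u \<in> tangent_coords A c S x" for u
  proof -
    obtain \<gamma> where \<gamma>: "smooth_curve_through A S x \<gamma>" "((\<lambda>t. snd c (\<gamma> t)) has_vector_derivative u) (at 0)"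
      using u unfolding tangent_coords_def by blast
    from v[OF this] \<gamma>(1) show ?thesis unfolding tangent_space_def by force
  qed
  ultimately show ?thesis unfolding tangent_space_def by blast
qed

text \<open>Allows curves to be written down in coordinates and transported by
  \<open>chart_inv c\<close>.\<close>

lemma tangent_coordsI:
  fixes \<gamma> :: "real \<Rightarrow> 'e"
  assumes s: "smooth_near \<gamma> 0" and 0: "\<gamma> 0 = snd c x" and u: "(\<gamma> has_vector_derivative u) (at 0)"
    and S: "\<forall>\<^sub>F t in nhds 0. chart_inv c (\<gamma> t) \<in> S"
  shows "u \<in> tangent_coords A c S x"
proof -
  have "\<forall>\<^sub>F t in nhds 0. \<gamma> t \<in> snd c ` fst c"
    using 0 c smooth_atlasD(2)[OF A c(1)]
    by (intro isCont_eventually_nhds[OF smooth_near_isCont[OF s]]) auto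
  then have ev: "\<forall>\<^sub>F t in nhds 0. chart_inv c (\<gamma> t) \<in> fst c \<and> snd c (chart_inv c (\<gamma> t)) = \<gamma> t"
    by eventually_elim (auto simp: f_inv_into_f inv_into_into)
  then obtain U where U: "open U" "0 \<in> U" "\<And>t. t \<in> U \<Longrightarrow> snd c (chart_inv c (\<gamma> t)) = \<gamma> t"
    unfolding eventually_nhds by blast
  have "smooth_near (\<lambda>t. snd c (chart_inv c (\<gamma> t))) 0"
    using s by (rule smooth_near_cong) (use ev in eventually_elim, simp)
  then have "smooth_map_at euclidean_atlas A (\<lambda>t. chart_inv c (\<gamma> t)) 0"
    using ev 0 c chart_inv_chart[OF A c] by (intro smooth_map_at_euclideanI[of c]) (auto elim: eventually_mono)
  then have "smooth_curve_through A S x (\<lambda>t. chart_inv c (\<gamma> t))"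
    using 0 S chart_inv_chart[OF A c] smooth_curve_through_iff[OF A] by simp
  moreover have "((\<lambda>t. snd c (chart_inv c (\<gamma> t))) has_vector_derivative u) (at 0)"
    by (rule has_vector_derivative_transform_within_open[OF u U(1,2)]) (use U(3) in simp)
  ultimately show ?thesis unfolding tangent_coords_def by blast
qed

lemma tangent_coords_points: "tangent_coords A c (points A) x = UNIV"
proof -
  have "u \<in> tangent_coords A c (points A) x" for u
  proof (rule tangent_coordsI)
    show "smooth_near (\<lambda>t. snd c x + t *\<^sub>R u) 0"
      by (intro smooth_near_add smooth_near_const smooth_near_linear) (rule bounded_linear_scaleR_left)
    show "((\<lambda>t. snd c x + t *\<^sub>R u) has_vector_derivative u) (at 0)"
      by (auto intro!: derivative_eq_intros)
    have "\<forall>\<^sub>F t in nhds 0. snd c x + t *\<^sub>R u \<in> snd c ` fst c"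
      using c smooth_atlasD(2)[OF A c(1)]
      by (intro isCont_eventually_nhds) (auto intro!: continuous_intros)
    then show "\<forall>\<^sub>F t in nhds 0. chart_inv c (snd c x + t *\<^sub>R u) \<in> points A"
      by eventually_elim (use c(1) in \<open>auto simp: points_def intro!: bexI[of _ c] inv_into_into\<close>)
  qed simp
  then show ?thesis by blast
qed

lemma tangent_space_points: "tangent_space A (points A) x = range (tangent_vector A c x)"
  by (simp add: tangent_space_eq tangent_coords_points)

text \<open>The identification of the tangent space with the model space is linear and injective, so
  transversality can be checked on coordinate vectors.\<close>

lemma transverse_tangent_vectors:
  "{\<lambda>d. u d + v d | u v. u \<in> tangent_vector A c x ` X \<and> v \<in> tangent_vector A c x ` Y} =
     range (tangent_vector A c x) \<longleftrightarrow> (\<forall>w. \<exists>u\<in>X. \<exists>v\<in>Y. w = u + v)"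
proof -
  have add: "(\<lambda>d. tangent_vector A c x u d + tangent_vector A c x v d) = tangent_vector A c x (u + v)" for u v
    using linear_add[OF linear_tangent_vector] by auto
  have "{\<lambda>d. u d + v d | u v. u \<in> tangent_vector A c x ` X \<and> v \<in> tangent_vector A c x ` Y} =
      {\<lambda>d. tangent_vector A c x u d + tangent_vector A c x v d | u v. u \<in> X \<and> v \<in> Y}"
    by blast
  also have "\<dots> = tangent_vector A c x ` {u + v | u v. u \<in> X \<and> v \<in> Y}"
    unfolding add by blast
  finally have sum: "{\<lambda>d. u d + v d | u v. u \<in> tangent_vector A c x ` X \<and> v \<in> tangent_vector A c x ` Y} =
      tangent_vector A c x ` {u + v | u v. u \<in> X \<and> v \<in> Y}" .
  show ?thesis
    unfolding sum inj_image_eq_iff[OF inj_tangent_vector] by blast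
qed

end

text \<open>Smoothness of \<open>f\<close> is asked only along curves in \<open>S\<close>: the
  tangent space of a line at \<open>p\<close> makes sense only for lines through \<open>p\<close>,
  so there is no open set of lines on which to differentiate it.\<close>

lemma differential_image_eq:
  assumes A: "smooth_atlas A" and c: "c \<in> A" "x \<in> fst c"
    and B: "smooth_atlas B" "d \<in> B" "f x \<in> fst d"
    and f: "\<And>\<gamma>. smooth_curve_through A S x \<gamma> \<Longrightarrow> smooth_map_at euclidean_atlas B (\<lambda>t. f (\<gamma> t)) 0"
  shows "differential_image A B S f x = tangent_vector B d (f x) `
    {u. \<exists>\<gamma>. smooth_curve_through A S x \<gamma> \<and> ((\<lambda>t. snd d (f (\<gamma> t))) has_vector_derivative u) (at 0)}"
    (is "_ = _ ` ?X")
proof -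
  have *: "velocity B (f \<circ> \<gamma>) = tangent_vector B d (f x) u"
    if "smooth_curve_through A S x \<gamma>" "((\<lambda>t. snd d (f (\<gamma> t))) has_vector_derivative u) (at 0)" for \<gamma> u
    using f[OF that(1)] that smooth_curve_through_iff[OF A]
    by (intro velocity_eq[OF B]) (auto simp: comp_def)
  have ex: "\<exists>u. ((\<lambda>t. snd d (f (\<gamma> t))) has_vector_derivative u) (at 0)"
    if \<gamma>: "smooth_curve_through A S x \<gamma>" for \<gamma>
  proof -
    have "smooth_curve_through B UNIV (f x) (\<lambda>t. f (\<gamma> t))"
      using \<gamma> f[OF \<gamma>] smooth_curve_through_iff[OF A] smooth_curve_through_iff[OF B(1)] by simp
    from smooth_curve_through_chart(5)[OF B(1) this B(2,3)] show ?thesis by blast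
  qed
  show ?thesis
  proof (intro equalityI subsetI)
    fix y assume "y \<in> differential_image A B S f x"
    then obtain \<gamma> where \<gamma>: "smooth_curve_through A S x \<gamma>" "y = velocity B (f \<circ> \<gamma>)"
      unfolding differential_image_def by blast
    with ex[OF \<gamma>(1)] * show "y \<in> tangent_vector B d (f x) ` ?X" by blast
  next
    fix y assume "y \<in> tangent_vector B d (f x) ` ?X"
    then obtain u \<gamma> where \<gamma>: "y = tangent_vector B d (f x) u" "smooth_curve_through A S x \<gamma>"
      "((\<lambda>t. snd d (f (\<gamma> t))) has_vector_derivative u) (at 0)"
      by blast
    from *[OF \<gamma>(2,3)] \<gamma>(1,2) show "y \<in> differential_image A B S f x"
      unfolding differential_image_def by force
  qed
qed

text \<open>In the chart \<open>c\<close> a frame is a linear automorphism of the model space. The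
  automorphism is recovered from a frame \<open>g\<close> as its coordinate
  \<open>g u c\<close>.\<close>

lemma frames_eq:
  fixes A :: "('p, (real^'n) \<times> (real^'n)) chart set"
  assumes A: "smooth_atlas A" and c: "c \<in> A" "x \<in> fst c"
  shows "frames A x = {\<lambda>u. tangent_vector A c x (G u) | G. linear G \<and> bij G}"
proof (intro equalityI subsetI)
  fix g assume g: "g \<in> frames A x"
  then have b: "bij_betw g UNIV (range (tangent_vector A c x))" and l: "linear (\<lambda>u. g u c)"
    unfolding frames_def tangent_space_points[OF A c] by blast+
  have gG: "g u = tangent_vector A c x (g u c)" for u
  proof -
    have "g u \<in> range (tangent_vector A c x)" using b unfolding bij_betw_def by auto
    then obtain v where "g u = tangent_vector A c x v" by auto
    then show ?thesis by (simp add: tangent_vector_chart[OF A c])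
  qed
  have "inj (\<lambda>u. g u c)"
  proof (rule injI)
    fix u v assume "g u c = g v c"
    then have "g u = g v" using gG[of u] gG[of v] by simp
    then show "u = v" using b unfolding bij_betw_def inj_def by blast
  qed
  moreover have "\<exists>u. v = g u c" for v
  proof -
    have "tangent_vector A c x v \<in> range g" using b unfolding bij_betw_def by auto
    then obtain u where "g u = tangent_vector A c x v" by auto
    then have "v = g u c" by (simp add: tangent_vector_chart[OF A c])
    then show ?thesis ..
  qed
  then have "surj (\<lambda>u. g u c)" by (simp add: surj_def)
  ultimately show "g \<in> {\<lambda>u. tangent_vector A c x (G u) | G. linear G \<and> bij G}"
    using l gG by (auto simp: bij_def intro!: exI[of _ "\<lambda>u. g u c"])
next
  fix g :: "(real^'n) \<times> (real^'n) \<Rightarrow> ('p, (real^'n) \<times> (real^'n)) tangent"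
  assume "g \<in> {\<lambda>u. tangent_vector A c x (G u) | G. linear G \<and> bij G}"
  then obtain G where g: "g = tangent_vector A c x \<circ> G" and G: "linear G" "bij G"
    by (auto simp: comp_def)
  have "bij_betw g UNIV (range (tangent_vector A c x))"
    unfolding g using G(2) inj_tangent_vector[OF A c] by (intro bij_betw_trans[of G UNIV UNIV] inj_on_imp_bij_betw)
  moreover have "linear (\<lambda>u. g u d)" for d
  proof -
    have "linear ((\<lambda>u. tangent_vector A c x u d) \<circ> G)"
      by (rule linear_compose[OF G(1)]) (rule linear_tangent_vector[OF A c])
    then show ?thesis by (simp add: g comp_def)
  qed
  ultimately show "g \<in> frames A x"
    unfolding frames_def tangent_space_points[OF A c] by blast
qed

section \<open>The Grassmannian as a manifold\<close>

lemma smooth_near_matrix: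
  fixes f :: "'a::real_normed_vector \<Rightarrow> real^'n^'n"
  assumes "\<And>i j. smooth_near (\<lambda>x. f x $ i $ j) x"
  shows "smooth_near f x"
proof (rule smooth_near_componentwise)
  fix b :: "real^'n^'n" assume "b \<in> Basis"
  then obtain i j where b: "b = axis i (axis j 1)"
    by (auto simp: Basis_vec_def)
  show "smooth_near (\<lambda>x. f x \<bullet> b) x"
    using assms[of i j] by (simp add: b inner_axis)
qed

lemma smooth_near_det:
  fixes f :: "'a::real_normed_vector \<Rightarrow> real^'n^'n"
  assumes "\<And>i j. smooth_near (\<lambda>x. f x $ i $ j) x"
  shows "smooth_near (\<lambda>x. det (f x)) x"
  unfolding det_def
  by (intro smooth_near_sum smooth_near_bilinear[OF bounded_bilinear_mult] smooth_near_const
      smooth_near_prod assms)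

lemma
  fixes A :: "real^'n^'n"
  assumes "invertible A"
  shows matrix_inv_right: "A ** matrix_inv A = mat 1" and matrix_inv_left: "matrix_inv A ** A = mat 1"
  using someI_ex[OF assms[unfolded invertible_def]] by (simp_all add: matrix_inv_def)

text \<open>Column \<open>j\<close> of the inverse solves \<open>A x = e_j\<close>, so Cramer's rule
  applies. It reduces smoothness of inversion to smoothness of determinants.\<close>

lemma matrix_inv_cramer:
  fixes A :: "real^'n^'n"
  assumes "det A \<noteq> 0"
  shows "matrix_inv A $ i $ j =
    det (\<chi> k l. if l = i then (axis j 1 :: real^'n) $ k else A $ k $ l) * inverse (det A)"
proof -
  have "A ** matrix_inv A = mat 1"
    using assms by (simp add: invertible_det_nz matrix_inv_right)
  then have "A *v (matrix_inv A *v axis j 1) = axis j 1"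
    by (simp add: matrix_vector_mul_assoc)
  then have "matrix_inv A *v axis j 1 =
      (\<chi> k. det (\<chi> i' j'. if j' = k then (axis j 1 :: real^'n) $ i' else A $ i' $ j') / det A)"
    using cramer[OF assms] by blast
  moreover have "matrix_inv A $ i $ j = (matrix_inv A *v axis j 1) $ i"
    by (simp add: matrix_vector_mult_basis column_def)
  ultimately show ?thesis by (simp add: divide_inverse)
qed

lemma smooth_near_matrix_inv:
  fixes f :: "'a::real_normed_vector \<Rightarrow> real^'n^'n"
  assumes f: "\<And>i j. smooth_near (\<lambda>x. f x $ i $ j) x" and 0: "det (f x) \<noteq> 0"
  shows "smooth_near (\<lambda>x. matrix_inv (f x) $ i $ j) x"
proof -
  note d = smooth_near_det[OF f]
  have "smooth_near (\<lambda>x. det (\<chi> k l. if l = i then (axis j 1 :: real^'n) $ k else f x $ k $ l)) x"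
  proof (rule smooth_near_det)
    show "smooth_near (\<lambda>x. (\<chi> k l. if l = i then (axis j 1 :: real^'n) $ k else f x $ k $ l) $ k $ l) x" for k l
      using f by (cases "l = i") (simp_all add: smooth_near_const)
  qed
  then have "smooth_near (\<lambda>x. det (\<chi> k l. if l = i then (axis j 1 :: real^'n) $ k else f x $ k $ l)
      * inverse (det (f x))) x"
    by (intro smooth_near_bilinear[OF bounded_bilinear_mult] smooth_near_inverse[OF d 0])
  moreover have "\<forall>\<^sub>F y in nhds x. det (f y) \<in> - {0}"
    using 0 by (intro isCont_eventually_nhds[OF smooth_near_isCont[OF d]]) auto
  then have "\<forall>\<^sub>F y in nhds x. det (\<chi> k l. if l = i then (axis j 1 :: real^'n) $ k else f y $ k $ l)
      * inverse (det (f y)) = matrix_inv (f y) $ i $ j"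
    by eventually_elim (simp add: matrix_inv_cramer)
  ultimately show ?thesis by (rule smooth_near_cong)
qed

text \<open>\<open>H\<close> maps the graph of \<open>M\<close> onto the set of all
  \<open>(W x, U x)\<close>; this matrix is \<open>W\<close>, and
  \<open>graph_transition_snd\<close> is \<open>U\<close>. In block form
  \<open>W = H11 + H12 M\<close> and \<open>U = H21 + H22 M\<close>.\<close>

definition graph_transition_fst :: "((real^'n) \<times> (real^'n) \<Rightarrow> (real^'n) \<times> (real^'n)) \<Rightarrow> real^'n^'n \<Rightarrow> real^'n^'n" where
  "graph_transition_fst H M = matrix (\<lambda>x. fst (H (x, M *v x)))"

definition graph_transition_snd :: "((real^'n) \<times> (real^'n) \<Rightarrow> (real^'n) \<times> (real^'n)) \<Rightarrow> real^'n^'n \<Rightarrow> real^'n^'n" where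
  "graph_transition_snd H M = matrix (\<lambda>x. snd (H (x, M *v x)))"

lemma graph_transition:
  fixes H :: "(real^'n) \<times> (real^'n) \<Rightarrow> (real^'n) \<times> (real^'n)"
  assumes H: "linear H"
  shows "H (x, M *v x) = (graph_transition_fst H M *v x, graph_transition_snd H M *v x)"
proof -
  have "linear (\<lambda>x. (x, M *v x))"
    by (intro linearI) (simp_all add: matrix_vector_right_distrib matrix_vector_mult_scaleR)
  then have l: "linear (\<lambda>x. H (x, M *v x))"
    using linear_compose[OF _ H] by (simp add: comp_def)
  have mw: "matrix f *v x = f x" if "linear f" for f :: "real^'n \<Rightarrow> real^'n"
    using that by (simp add: matrix_works linear_matrix_vector_mul_eq)
  show ?thesis
    using mw[OF linear_compose[OF l linear_fst]] mw[OF linear_compose[OF l linear_snd]]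
    by (simp add: graph_transition_fst_def graph_transition_snd_def comp_def)
qed

text \<open>The set of all \<open>(W x, U x)\<close> is a graph exactly if \<open>W\<close> is
  invertible, and then it is the graph of \<open>U W^-1\<close>.\<close>

lemma graph_transition_iff:
  fixes H :: "(real^'n) \<times> (real^'n) \<Rightarrow> (real^'n) \<times> (real^'n)"
  assumes H: "linear H" "inj H"
  shows "H ` range (\<lambda>x. (x, M *v x)) = range (\<lambda>x. (x, N *v x)) \<longleftrightarrow>
    det (graph_transition_fst H M) \<noteq> 0 \<and>
    N = graph_transition_snd H M ** matrix_inv (graph_transition_fst H M)"
proof -
  let ?W = "graph_transition_fst H M" and ?U = "graph_transition_snd H M"
  note HM = graph_transition[OF H(1), of _ M]
  have im: "H ` range (\<lambda>x. (x, M *v x)) = range (\<lambda>x. (?W *v x, ?U *v x))"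
    by (simp add: image_image HM)
  show ?thesis
  proof
    assume eq: "H ` range (\<lambda>x. (x, M *v x)) = range (\<lambda>x. (x, N *v x))"
    have NW: "?U *v x = N *v (?W *v x)" for x
    proof -
      have "(?W *v x, ?U *v x) \<in> range (\<lambda>x. (x, N *v x))" using eq unfolding im by blast
      then show ?thesis by auto
    qed
    \<comment> \<open>If \<open>W x = 0\<close>, then also \<open>U x = N W x = 0\<close>, so
      \<open>H\<close> maps \<open>(x, M x)\<close> to zero; injectivity of \<open>H\<close> gives
      \<open>x = 0\<close>.\<close>
    have "x = 0" if "?W *v x = 0" for x
    proof -
      have "H (x, M *v x) = H 0" using that NW[of x] HM[of x] linear_0[OF H(1)] by (simp add: zero_prod_def)
      then show ?thesis using H(2) by (auto simp: inj_def zero_prod_def)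
    qed
    then have inv: "invertible ?W"
      using matrix_left_invertible_ker[of ?W] invertible_left_inverse by blast
    have "N ** ?W = ?U" using NW by (simp add: matrix_eq matrix_vector_mul_assoc)
    then have "?U ** matrix_inv ?W = N ** (?W ** matrix_inv ?W)" by (simp add: matrix_mul_assoc)
    then show "det ?W \<noteq> 0 \<and> N = ?U ** matrix_inv ?W"
      using inv by (simp add: invertible_det_nz matrix_inv_right)
  next
    assume r: "det ?W \<noteq> 0 \<and> N = ?U ** matrix_inv ?W"
    then have inv: "invertible ?W" by (simp add: invertible_det_nz)
    have "N *v (?W *v x) = (?U ** (matrix_inv ?W ** ?W)) *v x" for x
      using r by (simp add: matrix_vector_mul_assoc matrix_mul_assoc)
    then have NW: "N *v (?W *v x) = ?U *v x" for x
      by (simp add: matrix_inv_left[OF inv])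
    have "y = ?W *v (matrix_inv ?W *v y)" for y
      by (simp add: matrix_vector_mul_assoc matrix_inv_right[OF inv])
    then have "surj (\<lambda>x. ?W *v x)" by (metis surjI)
    then have "range (\<lambda>x. (?W *v x, N *v (?W *v x))) = range (\<lambda>x. (x, N *v x))"
      using image_image[of "\<lambda>x. (x, N *v x)" "\<lambda>x. ?W *v x" UNIV] by simp
    then show "H ` range (\<lambda>x. (x, M *v x)) = range (\<lambda>x. (x, N *v x))"
      unfolding im NW by simp
  qed
qed

text \<open>Both matrices are affine functions of \<open>M\<close>.\<close>

lemma smooth_near_graph_transition:
  fixes H :: "(real^'n) \<times> (real^'n) \<Rightarrow> (real^'n) \<times> (real^'n)"
  assumes H: "linear H"
  shows "smooth_near (\<lambda>M. graph_transition_fst H M $ i $ j) M"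
    and "smooth_near (\<lambda>M. graph_transition_snd H M $ i $ j) M"
proof -
  have *: "smooth_near (\<lambda>M. h (H (axis j 1, M *v axis j 1)) $ i) M"
    if h: "linear h" for h :: "(real^'n) \<times> (real^'n) \<Rightarrow> real^'n"
  proof -
    have hH: "linear (\<lambda>y. h (H y))" using linear_compose[OF H h] by (simp add: comp_def)
    have "h (H (axis j 1, M *v axis j 1)) = h (H (axis j 1, 0)) + h (H (0, M *v axis j 1))" for M :: "real^'n^'n"
      using linear_add[OF hH, of "(axis j 1, 0)" "(0, M *v axis j 1)"] by simp
    moreover have "linear (\<lambda>M. h (H (0, M *v axis j 1)) $ i)"
    proof (rule linearI)
      fix M N :: "real^'n^'n"
      show "h (H (0, (M + N) *v axis j 1)) $ i = h (H (0, M *v axis j 1)) $ i + h (H (0, N *v axis j 1)) $ i"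
        using linear_add[OF hH, of "(0, M *v axis j 1)" "(0, N *v axis j 1)"]
        by (simp add: matrix_vector_mult_add_rdistrib)
      show "h (H (0, (r *\<^sub>R M) *v axis j 1)) $ i = r *\<^sub>R (h (H (0, M *v axis j 1)) $ i)" for r
        using linear_cmul[OF hH, of r "(0, M *v axis j 1)"]
        by (simp add: scaleR_matrix_vector_assoc[symmetric])
    qed
    ultimately show ?thesis
      by (simp add: smooth_near_add smooth_near_const smooth_near_linear linear_conv_bounded_linear)
  qed
  show "smooth_near (\<lambda>M. graph_transition_fst H M $ i $ j) M"
    "smooth_near (\<lambda>M. graph_transition_snd H M $ i $ j) M"
    using *[OF linear_fst] *[OF linear_snd]
    by (simp_all add: graph_transition_fst_def graph_transition_snd_def matrix_def)
qed

lemma graph_plane_compose: "graph_plane (\<lambda>u. f (G u)) M = f ` G ` range (\<lambda>x. (x, M *v x))"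
  by (simp add: graph_plane_def image_image)

text \<open>Charts are indexed by automorphisms \<open>G\<close> of the model space instead of
  frames, so that two of them are compared through the linear map
  \<open>inv H \<circ> G\<close>.\<close>

definition grassmannian_chart ::
  "('p, (real^'n) \<times> (real^'n)) chart set \<Rightarrow> ('p, (real^'n) \<times> (real^'n)) chart \<Rightarrow> 'p \<Rightarrow>
     ((real^'n) \<times> (real^'n) \<Rightarrow> (real^'n) \<times> (real^'n)) \<Rightarrow>
     (('p, (real^'n) \<times> (real^'n)) tangent set, real^'n^'n) chart" where
  "grassmannian_chart A c x G =
     (range (graph_plane (\<lambda>u. tangent_vector A c x (G u))),
      \<lambda>V. THE M. V = graph_plane (\<lambda>u. tangent_vector A c x (G u)) M)"

context
  fixes A :: "('p, (real^'n) \<times> (real^'n)) chart set" and c x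
  assumes A: "smooth_atlas A" and c: "c \<in> A" "x \<in> fst c"
begin

abbreviation "plane_of G M \<equiv> graph_plane (\<lambda>u. tangent_vector A c x (G u)) M"

lemma grassmannian_eq: "grassmannian A x = {grassmannian_chart A c x G | G. linear G \<and> bij G}"
  unfolding grassmannian_def frames_eq[OF A c] grassmannian_chart_def by blast

lemma plane_of_eq_iff:
  assumes G: "linear G" "bij G" and H: "linear H" "bij H"
  shows "plane_of G M = plane_of H N \<longleftrightarrow>
    (inv H \<circ> G) ` range (\<lambda>x. (x, M *v x)) = range (\<lambda>x. (x, N *v x))"
proof -
  have "plane_of G M = plane_of H N \<longleftrightarrow> G ` range (\<lambda>x. (x, M *v x)) = H ` range (\<lambda>x. (x, N *v x))"
    unfolding graph_plane_compose inj_image_eq_iff[OF inj_tangent_vector[OF A c]] ..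
  also have "\<dots> \<longleftrightarrow> inv H ` G ` range (\<lambda>x. (x, M *v x)) = range (\<lambda>x. (x, N *v x))"
    (is "?X = ?Y \<longleftrightarrow> _ = ?Z")
  proof
    assume "?X = ?Y"
    then show "inv H ` ?X = ?Z" by (simp only: image_inv_f_f[OF bij_is_inj[OF H(2)]])
  next
    assume "inv H ` ?X = ?Z"
    then have "H ` inv H ` ?X = ?Y" by (simp only:)
    then show "?X = ?Y" by (simp only: image_f_inv_f[OF bij_is_surj[OF H(2)]])
  qed
  finally show ?thesis by (simp add: image_comp)
qed

lemma plane_of_inj:
  assumes G: "linear G" "bij G"
  shows "plane_of G M = plane_of G N \<longleftrightarrow> M = N"
proof
  assume "plane_of G M = plane_of G N"
  then have eq: "range (\<lambda>x. (x, M *v x)) = range (\<lambda>x. (x, N *v x))"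
    using plane_of_eq_iff[OF G G] G(2) by (simp add: bij_def)
  have "M *v x = N *v x" for x
  proof -
    have "(x, M *v x) \<in> range (\<lambda>x. (x, N *v x))" unfolding eq[symmetric] by blast
    then show ?thesis by auto
  qed
  then show "M = N" by (simp add: matrix_eq)
qed simp

lemma grassmannian_chart_simps:
  assumes G: "linear G" "bij G"
  shows "fst (grassmannian_chart A c x G) = range (plane_of G)"
    "snd (grassmannian_chart A c x G) (plane_of G M) = M"
    "chart_inv (grassmannian_chart A c x G) M = plane_of G M"
proof -
  show *: "fst (grassmannian_chart A c x G) = range (plane_of G)"
    "snd (grassmannian_chart A c x G) (plane_of G M) = M" for M
    using plane_of_inj[OF G] by (auto simp: grassmannian_chart_def)
  have "inj_on (snd (grassmannian_chart A c x G)) (range (plane_of G))"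
    using *(2) by (auto simp: inj_on_def)
  then show "chart_inv (grassmannian_chart A c x G) M = plane_of G M"
    by (intro inv_into_f_eq) (auto simp: *)
qed

text \<open>The coordinate change is \<open>M \<mapsto> U W^-1\<close> on the open set where
  \<open>det W\<close> does not vanish; its entries are rational in those of
  \<open>M\<close>.\<close>

lemma grassmannian_transition:
  assumes G: "linear G" "bij G" and H: "linear H" "bij H"
  defines "K \<equiv> inv H \<circ> G" and "c1 \<equiv> grassmannian_chart A c x G" and "c2 \<equiv> grassmannian_chart A c x H"
  shows "snd c1 ` (fst c1 \<inter> fst c2) = {M. det (graph_transition_fst K M) \<noteq> 0}"
    "open (snd c1 ` (fst c1 \<inter> fst c2))"
    "smooth_on (snd c1 ` (fst c1 \<inter> fst c2)) (snd c2 \<circ> chart_inv c1)"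
proof -
  have K: "linear K" "inj K"
    using linear_compose[OF G(1) inj_linear_imp_inv_linear[OF H(1) bij_is_inj[OF H(2)]]]
      bij_is_inj[OF bij_comp[OF G(2) bij_imp_bij_inv[OF H(2)]]] by (simp_all add: K_def)
  define N where "N = (\<lambda>M. graph_transition_snd K M ** matrix_inv (graph_transition_fst K M))"
  have iff: "plane_of G M = plane_of H M' \<longleftrightarrow> det (graph_transition_fst K M) \<noteq> 0 \<and> M' = N M" for M M'
    unfolding plane_of_eq_iff[OF G H] K_def[symmetric] graph_transition_iff[OF K] N_def ..
  show im: "snd c1 ` (fst c1 \<inter> fst c2) = {M. det (graph_transition_fst K M) \<noteq> 0}"
  proof (intro equalityI subsetI)
    fix M assume "M \<in> snd c1 ` (fst c1 \<inter> fst c2)"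
    then obtain V where V: "V \<in> range (plane_of G)" "V \<in> range (plane_of H)" "M = snd c1 V"
      using grassmannian_chart_simps(1)[OF G] grassmannian_chart_simps(1)[OF H] unfolding c1_def c2_def by auto
    then obtain M' M'' where "V = plane_of G M'" "V = plane_of H M''" by (elim rangeE)
    then have "M = M'" "plane_of G M' = plane_of H M''"
      using V(3) by (simp_all add: c1_def grassmannian_chart_simps(2)[OF G])
    then show "M \<in> {M. det (graph_transition_fst K M) \<noteq> 0}"
      using iff[of M' M''] by simp
  next
    fix M assume "M \<in> {M. det (graph_transition_fst K M) \<noteq> 0}"
    then have "plane_of G M = plane_of H (N M)" using iff by blast
    then have "plane_of G M \<in> fst c1 \<inter> fst c2"
      unfolding c1_def c2_def grassmannian_chart_simps(1)[OF G] grassmannian_chart_simps(1)[OF H]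
      by (metis IntI rangeI)
    then show "M \<in> snd c1 ` (fst c1 \<inter> fst c2)"
      by (rule rev_image_eqI) (simp add: c1_def grassmannian_chart_simps[OF G])
  qed
  note sm = smooth_near_graph_transition[OF K(1)]
  have "continuous_on UNIV (\<lambda>M. det (graph_transition_fst K M))"
    using smooth_near_isCont[OF smooth_near_det[OF sm(1)]] by (simp add: continuous_on_eq_continuous_at)
  then have "open ((\<lambda>M. det (graph_transition_fst K M)) -` (- {0}))"
    by (intro open_vimage) auto
  then show o: "open (snd c1 ` (fst c1 \<inter> fst c2))"
    unfolding im by (simp add: vimage_def)
  show "smooth_on (snd c1 ` (fst c1 \<inter> fst c2)) (snd c2 \<circ> chart_inv c1)"
    unfolding smooth_on_iff_smooth_near[OF o]
  proof
    fix M assume M: "M \<in> snd c1 ` (fst c1 \<inter> fst c2)"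
    have "smooth_near (\<lambda>M. (graph_transition_snd K M ** matrix_inv (graph_transition_fst K M)) $ i $ j) M" for i j
      using M unfolding matrix_matrix_mult_def im
      by (simp, intro smooth_near_sum smooth_near_bilinear[OF bounded_bilinear_mult] sm smooth_near_matrix_inv) auto
    then have "smooth_near N M" unfolding N_def by (rule smooth_near_matrix)
    then show "smooth_near (snd c2 \<circ> chart_inv c1) M"
    proof (rule smooth_near_cong)
      have "\<forall>\<^sub>F M' in nhds M. M' \<in> snd c1 ` (fst c1 \<inter> fst c2)"
        using M o eventually_nhds_in_open by blast
      then show "\<forall>\<^sub>F M' in nhds M. N M' = (snd c2 \<circ> chart_inv c1) M'"
      proof eventually_elim
        case (elim M')
        then have "plane_of G M' = plane_of H (N M')" using iff im by auto
        then show ?case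
          by (simp add: c1_def c2_def grassmannian_chart_simps(3)[OF G] grassmannian_chart_simps(2)[OF H])
      qed
    qed
  qed
qed

lemma smooth_atlas_grassmannian: "smooth_atlas (grassmannian A x)"
  unfolding smooth_atlas_def
proof
  fix e assume "e \<in> grassmannian A x"
  then obtain G where e: "e = grassmannian_chart A c x G" and G: "linear G" "bij G"
    unfolding grassmannian_eq by blast
  note s = grassmannian_chart_simps[OF G]
  have "fst e \<subseteq> points (grassmannian A x)"
    using \<open>e \<in> grassmannian A x\<close> unfolding points_def by blast
  moreover have "inj_on (snd e) (fst e)"
    unfolding e s using s(2) by (auto simp: inj_on_def)
  moreover have "open (snd e ` fst e)"
  proof -
    have "snd e ` fst e = UNIV"
      unfolding e s image_image using s(2) by simp
    then show ?thesis by simp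
  qed
  moreover have "compatible_charts e e'" if e': "e' \<in> grassmannian A x" for e'
  proof -
    obtain H where "e' = grassmannian_chart A c x H" and H: "linear H" "bij H"
      using e' unfolding grassmannian_eq by blast
    then show ?thesis
      using grassmannian_transition(2,3)[OF G H] grassmannian_transition(2,3)[OF H G]
      unfolding compatible_charts_def e by (simp add: Int_commute)
  qed
  ultimately show "e \<in> charts_of (grassmannian A x)"
    by (simp add: charts_of_def)
qed

lemma grassmannian_chart_in: "linear G \<Longrightarrow> bij G \<Longrightarrow> grassmannian_chart A c x G \<in> grassmannian A x"
  unfolding grassmannian_eq by blast

text \<open>In the chart of \<open>G\<close>, containing a given real line is an affine condition on
  the matrix.\<close>

lemma real_line_plane_of:
  assumes G: "linear G" "bij G"
  shows "{\<lambda>d. r *\<^sub>R tangent_vector A c x (G (a, b)) d | r. True} \<subseteq> plane_of G M \<longleftrightarrow> b = M *v a"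
proof -
  note J = inj_tangent_vector[OF A c]
  have tv: "(\<lambda>d. r *\<^sub>R tangent_vector A c x (G u) d) = tangent_vector A c x (G (r *\<^sub>R u))" for r u
    by (rule ext) (simp only: linear_cmul[OF linear_tangent_vector[OF A c]] linear_cmul[OF G(1)])
  have mem: "tangent_vector A c x (G u) \<in> plane_of G M \<longleftrightarrow> snd u = M *v fst u" for u
    unfolding graph_plane_def
    using inj_image_mem_iff[of "\<lambda>u. tangent_vector A c x (G u)" u "range (\<lambda>x. (x, M *v x))"]
      inj_compose[OF J bij_is_inj[OF G(2)]] by (cases u) (auto simp: comp_def)
  show ?thesis
  proof
    assume "{\<lambda>d. r *\<^sub>R tangent_vector A c x (G (a, b)) d | r. True} \<subseteq> plane_of G M"
    then have "(\<lambda>d. 1 *\<^sub>R tangent_vector A c x (G (a, b)) d) \<in> plane_of G M" by blast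
    then show "b = M *v a" using mem[of "(a, b)"] by simp
  next
    assume "b = M *v a"
    then have "tangent_vector A c x (G (r *\<^sub>R (a, b))) \<in> plane_of G M" for r
      unfolding mem by (simp add: matrix_vector_mult_scaleR)
    then show "{\<lambda>d. r *\<^sub>R tangent_vector A c x (G (a, b)) d | r. True} \<subseteq> plane_of G M"
      unfolding tv by blast
  qed
qed

text \<open>In the chart of \<open>G\<close> the planes containing the line spanned by
  \<open>(a, M a)\<close> form the affine space of all \<open>M'\<close> with
  \<open>M' a = M a\<close>. Along a curve in it the value at \<open>a\<close> is constant, and
  conversely the segments \<open>M + t N\<close> with \<open>N a = 0\<close> stay inside.\<close>

lemma tangent_coords_line_planes:
  fixes a :: "real^'n" and M :: "real^'n^'n"
  assumes G: "linear G" "bij G"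
  shows "tangent_coords (grassmannian A x) (grassmannian_chart A c x G)
      {V \<in> points (grassmannian A x). {\<lambda>d. r *\<^sub>R tangent_vector A c x (G (a, M *v a)) d | r. True} \<subseteq> V}
      (plane_of G M) = {N. N *v a = 0}"
    (is "tangent_coords ?Gr ?e ?Z ?V = _")
proof -
  note s = grassmannian_chart_simps[OF G]
  note Gr = smooth_atlas_grassmannian
  have e: "?e \<in> ?Gr" "?V \<in> fst ?e" using grassmannian_chart_in[OF G] s by auto
  have lin: "bounded_linear (\<lambda>N::real^'n^'n. N *v a)"
    unfolding linear_conv_bounded_linear[symmetric]
    by (intro linearI) (simp_all add: matrix_vector_mult_add_rdistrib scaleR_matrix_vector_assoc)
  show ?thesis
  proof (intro equalityI subsetI)
    fix N assume "N \<in> tangent_coords ?Gr ?e ?Z ?V"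
    then obtain \<gamma> where \<gamma>: "smooth_curve_through ?Gr ?Z ?V \<gamma>"
      and N: "((\<lambda>t. snd ?e (\<gamma> t)) has_vector_derivative N) (at 0)"
      unfolding tangent_coords_def by blast
    have 1: "((\<lambda>t. snd ?e (\<gamma> t) *v a) has_vector_derivative N *v a) (at 0)"
      using bounded_linear.has_vector_derivative[OF lin N] .
    note \<gamma>' = smooth_curve_through_chart[OF Gr \<gamma> e]
    have "\<forall>\<^sub>F t in nhds 0. snd ?e (\<gamma> t) *v a = M *v a"
      using \<gamma>'(3,4)
    proof eventually_elim
      case (elim t)
      then obtain M' where M': "\<gamma> t = plane_of G M'" unfolding s by blast
      then show ?case using elim real_line_plane_of[OF G, of a "M *v a" M'] s(2) by simp
    qed
    then obtain U where "open U" "0 \<in> U" "\<And>t. t \<in> U \<Longrightarrow> snd ?e (\<gamma> t) *v a = M *v a"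
      unfolding eventually_nhds by blast
    with 1 have "((\<lambda>t. M *v a) has_vector_derivative N *v a) (at 0)"
      by (rule has_vector_derivative_transform_within_open)
    then show "N \<in> {N. N *v a = 0}"
      using vector_derivative_at[OF has_vector_derivative_const[of "M *v a" "at 0"]] vector_derivative_at by force
  next
    fix N :: "real^'n^'n" assume "N \<in> {N. N *v a = 0}"
    then have N: "(M + t *\<^sub>R N) *v a = M *v a" for t
      by (simp add: matrix_vector_mult_add_rdistrib scaleR_matrix_vector_assoc[symmetric])
    show "N \<in> tangent_coords ?Gr ?e ?Z ?V"
    proof (rule tangent_coordsI[OF Gr e])
      show "smooth_near (\<lambda>t. M + t *\<^sub>R N) 0"
        by (intro smooth_near_add smooth_near_const smooth_near_linear) (rule bounded_linear_scaleR_left)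
      show "((\<lambda>t. M + t *\<^sub>R N) has_vector_derivative N) (at 0)"
        by (auto intro!: derivative_eq_intros)
      have "plane_of G (M + t *\<^sub>R N) \<in> ?Z" for t
        using real_line_plane_of[OF G, of a "M *v a" "M + t *\<^sub>R N"] N e(1) s(1) unfolding points_def by auto
      then show "\<forall>\<^sub>F t in nhds 0. chart_inv ?e (M + t *\<^sub>R N) \<in> ?Z"
        unfolding s(3) by simp
    qed (simp add: s(2))
  qed
qed

end

section \<open>Symmetry of second derivatives\<close>

lemma smooth_near_has_vector_derivative_line:
  fixes f :: "'a::euclidean_space \<Rightarrow> 'b::real_normed_vector"
  assumes "smooth_near f (x + s *\<^sub>R u)"
  shows "((\<lambda>s. f (x + s *\<^sub>R u)) has_vector_derivative frechet_derivative f (at (x + s *\<^sub>R u)) u) (at s)"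
proof -
  have "((\<lambda>s. x + s *\<^sub>R u) has_derivative (\<lambda>h. h *\<^sub>R u)) (at s)"
    by (auto intro!: derivative_eq_intros)
  from has_derivative_compose[OF this smooth_near_has_derivative[OF assms]]
  show ?thesis
    using linear_cmul[OF has_derivative_linear[OF smooth_near_has_derivative[OF assms]]]
    by (simp add: has_vector_derivative_def)
qed

text \<open>Two uses of the mean value theorem: first in direction \<open>u\<close> for the
  difference of \<open>f\<close> along two opposite sides, then in direction \<open>v\<close> for
  the derivative in direction \<open>u\<close>.\<close>

lemma second_difference_mvt:
  fixes f :: "'a::euclidean_space \<Rightarrow> real"
  assumes h: "h > 0"
    and f: "\<And>s t. 0 \<le> s \<Longrightarrow> s \<le> h \<Longrightarrow> 0 \<le> t \<Longrightarrow> t \<le> h \<Longrightarrow> smooth_near f (x + s *\<^sub>R u + t *\<^sub>R v)"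
  shows "\<exists>a b. 0 < a \<and> a < h \<and> 0 < b \<and> b < h \<and>
    f (x + h *\<^sub>R u + h *\<^sub>R v) - f (x + h *\<^sub>R u) - (f (x + h *\<^sub>R v) - f x) =
    h * (h * frechet_derivative (\<lambda>y. frechet_derivative f (at y) u) (at (x + a *\<^sub>R u + b *\<^sub>R v)) v)"
proof -
  let ?D = "\<lambda>y. frechet_derivative f (at y) u"
  have line: "((\<lambda>s. f (x + s *\<^sub>R u + t *\<^sub>R v)) has_real_derivative ?D (x + s *\<^sub>R u + t *\<^sub>R v)) (at s)"
    if "0 \<le> s" "s \<le> h" "0 \<le> t" "t \<le> h" for s t
    using smooth_near_has_vector_derivative_line[of f "x + t *\<^sub>R v" s u] f[OF that]
    by (simp add: has_real_derivative_iff_has_vector_derivative algebra_simps)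
  have "\<exists>a. 0 < a \<and> a < h \<and>
    (f (x + h *\<^sub>R u + h *\<^sub>R v) - f (x + h *\<^sub>R u)) - (f (x + h *\<^sub>R v) - f x) =
    (h - 0) * (?D (x + a *\<^sub>R u + h *\<^sub>R v) - ?D (x + a *\<^sub>R u))"
  proof -
    have "((\<lambda>s. f (x + s *\<^sub>R u + h *\<^sub>R v) - f (x + s *\<^sub>R u)) has_real_derivative
        ?D (x + s *\<^sub>R u + h *\<^sub>R v) - ?D (x + s *\<^sub>R u)) (at s)" if "0 \<le> s" "s \<le> h" for s
      using DERIV_diff[OF line[of s h] line[of s 0]] that h by simp
    from MVT2[OF h this] show ?thesis by simp
  qed
  then obtain a where a: "0 < a" "a < h"
    "(f (x + h *\<^sub>R u + h *\<^sub>R v) - f (x + h *\<^sub>R u)) - (f (x + h *\<^sub>R v) - f x) =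
      h * (?D (x + a *\<^sub>R u + h *\<^sub>R v) - ?D (x + a *\<^sub>R u))"
    by auto
  have "((\<lambda>t. ?D (x + a *\<^sub>R u + t *\<^sub>R v)) has_real_derivative
      frechet_derivative ?D (at (x + a *\<^sub>R u + t *\<^sub>R v)) v) (at t)" if "0 \<le> t" "t \<le> h" for t
    using smooth_near_has_vector_derivative_line[of ?D "x + a *\<^sub>R u" t v] a that
      smooth_near_frechet_derivative[OF f[of a t]]
    by (simp add: has_real_derivative_iff_has_vector_derivative)
  from MVT2[OF h this] obtain b where "0 < b" "b < h"
    "?D (x + a *\<^sub>R u + h *\<^sub>R v) - ?D (x + a *\<^sub>R u + 0 *\<^sub>R v) =
      (h - 0) * frechet_derivative ?D (at (x + a *\<^sub>R u + b *\<^sub>R v)) v"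
    by blast
  with a show ?thesis by (intro exI[of _ a] exI[of _ b]) simp
qed

text \<open>The second difference over a parallelogram is symmetric in \<open>u\<close> and
  \<open>v\<close>. Hence the mixed derivatives of the two orders take equal values at points,
  possibly different ones, arbitrarily close to \<open>x\<close>, and both are continuous at
  \<open>x\<close>.\<close>

lemma second_derivative_symmetric_real:
  fixes f :: "'a::euclidean_space \<Rightarrow> real"
  assumes f: "smooth_near f x"
  shows "frechet_derivative (\<lambda>y. frechet_derivative f (at y) u) (at x) v =
    frechet_derivative (\<lambda>y. frechet_derivative f (at y) v) (at x) u"
proof (rule ccontr)
  define D where "D = (\<lambda>u v y. frechet_derivative (\<lambda>y. frechet_derivative f (at y) u) (at y) v)"
  assume "\<not> ?thesis"
  then have "D u v x - D v u x \<noteq> 0" by (simp add: D_def)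
  \<comment> \<open>Half of the supposed gap: two equal values that are each within \<open>e\<close>
    of their limits contradict it.\<close>
  define e where "e = \<bar>D u v x - D v u x\<bar> / 2"
  have e: "e > 0" using \<open>D u v x - D v u x \<noteq> 0\<close> by (simp add: e_def)
  have cont: "isCont (D u v) x" for u v
    unfolding D_def by (intro smooth_near_isCont smooth_near_frechet_derivative f)
  obtain r where r: "r > 0" "\<And>y. dist y x < r \<Longrightarrow> smooth_near f y"
    using smooth_near_eventually[OF f] unfolding eventually_nhds_metric by blast
  obtain r1 where r1: "r1 > 0" "\<And>y. dist y x < r1 \<Longrightarrow> dist (D u v y) (D u v x) < e"
    using cont[of u v] e unfolding continuous_at_eps_delta by blast
  obtain r2 where r2: "r2 > 0" "\<And>y. dist y x < r2 \<Longrightarrow> dist (D v u y) (D v u x) < e"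
    using cont[of v u] e unfolding continuous_at_eps_delta by blast
  define \<delta> where "\<delta> = min r (min r1 r2)"
  \<comment> \<open>The parallelogram with sides \<open>h u\<close> and \<open>h v\<close> stays
    within distance \<open>\<delta>\<close> of \<open>x\<close>; the summand 1 makes the bound
    strict and covers \<open>u = v = 0\<close>.\<close>
  define h where "h = \<delta> / (norm u + norm v + 1)"
  have \<delta>: "\<delta> > 0" using r r1 r2 by (simp add: \<delta>_def)
  have pos: "norm u + norm v + 1 > 0" by (simp add: add_nonneg_pos)
  have h: "h > 0" using \<delta> pos by (simp add: h_def)
  have near: "dist (x + s *\<^sub>R u + t *\<^sub>R v) x < \<delta>" if "0 \<le> s" "s \<le> h" "0 \<le> t" "t \<le> h" for s t
  proof -
    have "dist (x + s *\<^sub>R u + t *\<^sub>R v) x = norm (s *\<^sub>R u + t *\<^sub>R v)" by (simp add: dist_norm)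
    also have "\<dots> \<le> s * norm u + t * norm v"
      using norm_triangle_ineq[of "s *\<^sub>R u" "t *\<^sub>R v"] that by simp
    also have "\<dots> \<le> h * norm u + h * norm v"
      using that by (intro add_mono mult_right_mono) auto
    also have "\<dots> < h * (norm u + norm v + 1)" using h by (simp add: algebra_simps)
    also have "\<dots> = \<delta>" using pos by (simp add: h_def)
    finally show ?thesis .
  qed
  have sm: "smooth_near f (x + s *\<^sub>R u + t *\<^sub>R v)" "smooth_near f (x + t *\<^sub>R v + s *\<^sub>R u)"
    if "0 \<le> s" "s \<le> h" "0 \<le> t" "t \<le> h" for s t
    using r(2) near[OF that] by (simp_all add: \<delta>_def algebra_simps)
  obtain a b where ab: "0 < a" "a < h" "0 < b" "b < h"
    "f (x + h *\<^sub>R u + h *\<^sub>R v) - f (x + h *\<^sub>R u) - (f (x + h *\<^sub>R v) - f x) =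
      h * (h * D u v (x + a *\<^sub>R u + b *\<^sub>R v))"
    using second_difference_mvt[OF h sm(1)] unfolding D_def by blast
  obtain a' b' where ab': "0 < a'" "a' < h" "0 < b'" "b' < h"
    "f (x + h *\<^sub>R v + h *\<^sub>R u) - f (x + h *\<^sub>R v) - (f (x + h *\<^sub>R u) - f x) =
      h * (h * D v u (x + a' *\<^sub>R v + b' *\<^sub>R u))"
    using second_difference_mvt[OF h, of f x v u] sm(2) unfolding D_def by blast
  have "f (x + h *\<^sub>R v + h *\<^sub>R u) = f (x + h *\<^sub>R u + h *\<^sub>R v)" by (simp add: algebra_simps)
  then have "h * (h * D u v (x + a *\<^sub>R u + b *\<^sub>R v)) = h * (h * D v u (x + a' *\<^sub>R v + b' *\<^sub>R u))"
    using ab(5) ab'(5) by linarith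
  then have eq: "D u v (x + a *\<^sub>R u + b *\<^sub>R v) = D v u (x + a' *\<^sub>R v + b' *\<^sub>R u)"
    using h by simp
  have "dist (x + a *\<^sub>R u + b *\<^sub>R v) x < \<delta>" "dist (x + a' *\<^sub>R v + b' *\<^sub>R u) x < \<delta>"
    using near[of a b] near[of b' a'] ab ab' by (simp_all add: algebra_simps)
  then have "dist (D u v (x + a *\<^sub>R u + b *\<^sub>R v)) (D u v x) < e"
    "dist (D v u (x + a' *\<^sub>R v + b' *\<^sub>R u)) (D v u x) < e"
    using r1 r2 by (simp_all add: \<delta>_def)
  then have "\<bar>D u v x - D v u x\<bar> < 2 * e"
    unfolding eq dist_real_def by linarith
  then show False by (simp add: e_def)
qed

lemma frechet_derivative_inner:
  fixes f :: "'a::real_normed_vector \<Rightarrow> 'b::real_inner"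
  assumes "smooth_near f x"
  shows "frechet_derivative (\<lambda>y. f y \<bullet> i) (at x) v = frechet_derivative f (at x) v \<bullet> i"
proof -
  have "((\<lambda>y. f y \<bullet> i) has_derivative (\<lambda>v. frechet_derivative f (at x) v \<bullet> i)) (at x)"
    using smooth_near_has_derivative[OF assms] by (rule has_derivative_inner_left)
  from frechet_derivative_at[OF this] show ?thesis by metis
qed

lemma second_derivative_symmetric:
  fixes f :: "'a::euclidean_space \<Rightarrow> 'b::euclidean_space"
  assumes f: "smooth_near f x"
  shows "frechet_derivative (\<lambda>y. frechet_derivative f (at y) u) (at x) v =
    frechet_derivative (\<lambda>y. frechet_derivative f (at y) v) (at x) u"
proof (rule euclidean_eqI)
  fix i :: 'b
  have fi: "smooth_near (\<lambda>y. f y \<bullet> i) x"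
    using smooth_near_linear_compose[OF bounded_linear_inner_left f] .
  have *: "frechet_derivative (\<lambda>y. frechet_derivative (\<lambda>y. f y \<bullet> i) (at y) u) (at x) v =
      frechet_derivative (\<lambda>y. frechet_derivative f (at y) u) (at x) v \<bullet> i" for u v
  proof -
    obtain S where S: "open S" "x \<in> S" "\<And>y. y \<in> S \<Longrightarrow> smooth_near f y"
      using smooth_near_eventually[OF f] unfolding eventually_nhds by blast
    have "frechet_derivative (\<lambda>y. frechet_derivative (\<lambda>y. f y \<bullet> i) (at y) u) (at x) =
        frechet_derivative (\<lambda>y. frechet_derivative f (at y) u \<bullet> i) (at x)"
      using S by (intro frechet_derivative_cong_open[OF S(1,2)] frechet_derivative_inner)
    then show ?thesis
      using frechet_derivative_inner[OF smooth_near_frechet_derivative[OF f]] by simp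
  qed
  show "frechet_derivative (\<lambda>y. frechet_derivative f (at y) u) (at x) v \<bullet> i =
    frechet_derivative (\<lambda>y. frechet_derivative f (at y) v) (at x) u \<bullet> i"
    using second_derivative_symmetric_real[OF fi] unfolding * .
qed

section \<open>Partial derivatives and chain rules along curves\<close>

lemma smooth_near_Pair_const:
  fixes f :: "'a::euclidean_space \<times> 'b::euclidean_space \<Rightarrow> 'c::real_normed_vector"
  shows "smooth_near f (x, y) \<Longrightarrow> smooth_near (\<lambda>x. f (x, y)) x"
    and "smooth_near f (x, y) \<Longrightarrow> smooth_near (\<lambda>y. f (x, y)) y"
  using smooth_near_compose[of "\<lambda>x. (x, y)" x f] smooth_near_compose[of "\<lambda>y. (x, y)" y f]
  by (simp_all add: smooth_near_Pair smooth_near_ident smooth_near_const)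

lemma frechet_derivative_Pair_const:
  assumes "smooth_near f (x, y)"
  shows "frechet_derivative (\<lambda>x. f (x, y)) (at x) u = frechet_derivative f (at (x, y)) (u, 0)"
    and "frechet_derivative (\<lambda>y. f (x, y)) (at y) v = frechet_derivative f (at (x, y)) (0, v)"
proof -
  have "((\<lambda>x. (x, y)) has_derivative (\<lambda>u. (u, 0))) (at x)" "((\<lambda>y. (x, y)) has_derivative (\<lambda>v. (0, v))) (at y)"
    by (auto intro!: derivative_eq_intros)
  then have "((\<lambda>x. f (x, y)) has_derivative (\<lambda>u. frechet_derivative f (at (x, y)) (u, 0))) (at x)"
    "((\<lambda>y. f (x, y)) has_derivative (\<lambda>v. frechet_derivative f (at (x, y)) (0, v))) (at y)"
    using has_derivative_compose smooth_near_has_derivative[OF assms] by blast+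
  from frechet_derivative_at[OF this(1)] frechet_derivative_at[OF this(2)]
  show "frechet_derivative (\<lambda>x. f (x, y)) (at x) u = frechet_derivative f (at (x, y)) (u, 0)"
    and "frechet_derivative (\<lambda>y. f (x, y)) (at y) v = frechet_derivative f (at (x, y)) (0, v)"
    by metis+
qed

lemma frechet_derivative_compose_smooth:
  fixes f :: "'a::euclidean_space \<Rightarrow> 'b::euclidean_space"
  assumes "smooth_near f x" "smooth_near g (f x)"
  shows "frechet_derivative (\<lambda>x. g (f x)) (at x) u =
    frechet_derivative g (at (f x)) (frechet_derivative f (at x) u)"
proof -
  have "((\<lambda>x. g (f x)) has_derivative (\<lambda>u. frechet_derivative g (at (f x)) (frechet_derivative f (at x) u))) (at x)"
    by (rule has_derivative_compose[OF smooth_near_has_derivative[OF assms(1)] smooth_near_has_derivative[OF assms(2)]])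
  from frechet_derivative_at[OF this] show ?thesis by metis
qed

lemma frechet_derivative_linear_compose:
  assumes "bounded_linear h" "smooth_near f x"
  shows "frechet_derivative (\<lambda>x. h (f x)) (at x) u = h (frechet_derivative f (at x) u)"
  using frechet_derivative_at[OF bounded_linear.has_derivative[OF assms(1) smooth_near_has_derivative[OF assms(2)]]]
  by metis

lemma frechet_derivative_eventually_cong:
  assumes "\<forall>\<^sub>F y in nhds x. f y = g y"
  shows "frechet_derivative f (at x) = frechet_derivative g (at x)"
  using assms frechet_derivative_cong_open unfolding eventually_nhds by blast

lemma has_vector_derivative_eventually_cong:
  assumes "\<forall>\<^sub>F t in nhds s. f t = g t" "(f has_vector_derivative u) (at s)"
  shows "(g has_vector_derivative u) (at s)"
  using assms has_vector_derivative_transform_within_open unfolding eventually_nhds by metis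

lemma has_vector_derivative_compose_smooth:
  assumes "(\<gamma> has_vector_derivative u) (at s)" "smooth_near f (\<gamma> s)"
  shows "((\<lambda>t. f (\<gamma> t)) has_vector_derivative frechet_derivative f (at (\<gamma> s)) u) (at s)"
proof -
  note f = smooth_near_has_derivative[OF assms(2)]
  have "((\<lambda>t. f (\<gamma> t)) has_derivative (\<lambda>h. frechet_derivative f (at (\<gamma> s)) (h *\<^sub>R u))) (at s)"
    by (rule has_derivative_compose[OF assms(1)[unfolded has_vector_derivative_def] f])
  then show ?thesis
    using linear_cmul[OF has_derivative_linear[OF f]] by (simp add: has_vector_derivative_def)
qed

lemma has_vector_derivative_unique:
  "(f has_vector_derivative u) (at (s::real)) \<Longrightarrow> (f has_vector_derivative v) (at s) \<Longrightarrow> u = v"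
  using vector_derivative_at by metis

section \<open>Smooth planes and their tangent spaces\<close>

lemma dim_add_le:
  fixes S T :: "'a::euclidean_space set"
  assumes "subspace S" "subspace T" "\<And>x. x \<in> S \<Longrightarrow> x \<in> T \<Longrightarrow> x = 0"
  shows "dim S + dim T \<le> DIM('a)"
proof -
  have "S \<inter> T \<subseteq> {0}" using assms(3) by auto
  then have "dim (S \<inter> T) = 0" by (simp add: dim_eq_0)
  then show ?thesis
    using dim_sums_Int[OF assms(1,2)] dim_subset_UNIV[of "{x + y |x y. x \<in> S \<and> y \<in> T}"] by linarith
qed

text \<open>The quadrangle axiom is not visibly self-dual. It is replaced here by consequences that
  come in dual pairs, so that passing to the dual plane only exchanges assumptions.\<close>

locale smooth_plane =
  fixes P :: "('p, (real^'n) \<times> (real^'n)) chart set"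
    and L :: "('l, (real^'n) \<times> (real^'n)) chart set"
    and F :: "('p \<times> 'l) set"
  assumes P: "smooth_atlas P" and L: "smooth_atlas L"
    and F: "F \<subseteq> points P \<times> points L"
    and join_ex1: "\<And>p q. p \<in> points P \<Longrightarrow> q \<in> points P \<Longrightarrow> p \<noteq> q \<Longrightarrow> \<exists>!l. (p, l) \<in> F \<and> (q, l) \<in> F"
    and meet_ex1: "\<And>l m. l \<in> points L \<Longrightarrow> m \<in> points L \<Longrightarrow> l \<noteq> m \<Longrightarrow> \<exists>!p. (p, l) \<in> F \<and> (p, m) \<in> F"
    and join_smooth: "smooth_map_on (product_atlas P P) L
       {(p, q). p \<in> points P \<and> q \<in> points P \<and> p \<noteq> q} (\<lambda>(p, q). join F p q)"
    and meet_smooth: "smooth_map_on (product_atlas L L) P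
       {(l, m). l \<in> points L \<and> m \<in> points L \<and> l \<noteq> m} (\<lambda>(l, m). meet F l m)"
    and point_off: "\<And>l. l \<in> points L \<Longrightarrow> \<exists>q\<in>points P. (q, l) \<notin> F"
    and line_off: "\<And>p. p \<in> points P \<Longrightarrow> \<exists>m\<in>points L. (p, m) \<notin> F"
    and three_lines: "\<And>p. p \<in> points P \<Longrightarrow> \<exists>l m k. (p, l) \<in> F \<and> (p, m) \<in> F \<and> (p, k) \<in> F \<and> l \<noteq> m \<and> l \<noteq> k \<and> m \<noteq> k"
    and three_points: "\<And>l. l \<in> points L \<Longrightarrow> \<exists>p q r. (p, l) \<in> F \<and> (q, l) \<in> F \<and> (r, l) \<in> F \<and> p \<noteq> q \<and> p \<noteq> r \<and> q \<noteq> r"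

lemma join_converse: "join (F\<inverse>) = meet F" and meet_converse: "meet (F\<inverse>) = join F"
  by (auto simp: fun_eq_iff join_def meet_def)

lemma points_on_converse: "points_on (F\<inverse>) p = lines_through F p"
  and lines_through_converse: "lines_through (F\<inverse>) l = points_on F l"
  by (auto simp: points_on_def lines_through_def)

context smooth_plane
begin

lemma dual: "smooth_plane L P (F\<inverse>)"
proof
  show "smooth_atlas L" "smooth_atlas P" using L P .
  show "F\<inverse> \<subseteq> points L \<times> points P" using F by blast
  show "\<exists>p q r. (p, l) \<in> F\<inverse> \<and> (q, l) \<in> F\<inverse> \<and> (r, l) \<in> F\<inverse> \<and> p \<noteq> q \<and> p \<noteq> r \<and> q \<noteq> r"
    if "l \<in> points P" for l using three_lines[OF that] by simp
  show "\<exists>l m k. (p, l) \<in> F\<inverse> \<and> (p, m) \<in> F\<inverse> \<and> (p, k) \<in> F\<inverse> \<and> l \<noteq> m \<and> l \<noteq> k \<and> m \<noteq> k"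
    if "p \<in> points L" for p using three_points[OF that] by simp
qed (simp_all add: join_converse meet_converse join_ex1 meet_ex1 join_smooth meet_smooth
    point_off line_off)

lemma join_incident:
  assumes "p \<in> points P" "q \<in> points P" "p \<noteq> q"
  shows "(p, join F p q) \<in> F" "(q, join F p q) \<in> F"
  using theI'[OF join_ex1[OF assms]] by (simp_all add: join_def)

lemma join_eq:
  assumes "(p, l) \<in> F" "(q, l) \<in> F" "p \<noteq> q"
  shows "join F p q = l"
proof -
  have "p \<in> points P" "q \<in> points P" using assms F by auto
  from the1_equality[OF join_ex1[OF this assms(3)]] assms show ?thesis by (simp add: join_def)
qed

lemma meet_incident:
  assumes "l \<in> points L" "m \<in> points L" "l \<noteq> m"
  shows "(meet F l m, l) \<in> F" "(meet F l m, m) \<in> F"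
  using theI'[OF meet_ex1[OF assms]] by (simp_all add: meet_def)

lemma meet_eq:
  assumes "(p, l) \<in> F" "(p, m) \<in> F" "l \<noteq> m"
  shows "meet F l m = p"
proof -
  have "l \<in> points L" "m \<in> points L" using assms F by auto
  from the1_equality[OF meet_ex1[OF this assms(3)]] assms show ?thesis by (simp add: meet_def)
qed

lemma join_points: "p \<in> points P \<Longrightarrow> q \<in> points P \<Longrightarrow> p \<noteq> q \<Longrightarrow> join F p q \<in> points L"
  using join_incident F by blast

lemma smooth_map_at_join:
  assumes f: "smooth_map_at euclidean_atlas P f t" and g: "smooth_map_at euclidean_atlas P g t" and "f t \<noteq> g t"
  shows "smooth_map_at euclidean_atlas L (\<lambda>t. join F (f t) (g t)) t"
    and "\<forall>\<^sub>F t in nhds t. f t \<in> points P \<and> g t \<in> points P \<and> f t \<noteq> g t"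
proof -
  let ?S = "{(p, q). p \<in> points P \<and> q \<in> points P \<and> p \<noteq> q}"
  have PP: "smooth_atlas (product_atlas P P)" by (rule smooth_atlas_product[OF P P])
  have fg: "smooth_map_at euclidean_atlas (product_atlas P P) (\<lambda>t. (f t, g t)) t"
    by (rule smooth_map_at_Pair[OF smooth_atlas_euclidean P P f g])
  have S: "(f t, g t) \<in> ?S"
    using smooth_map_at_points(2)[OF f] smooth_map_at_points(2)[OF g] assms(3) by simp
  have "smooth_map_at (product_atlas P P) L (\<lambda>(p, q). join F p q) (f t, g t)"
    by (rule smooth_map_on_imp_at[OF PP L join_smooth S])
  from smooth_map_at_compose[OF smooth_atlas_euclidean PP L fg this]
  show "smooth_map_at euclidean_atlas L (\<lambda>t. join F (f t) (g t)) t" by simp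
  have "openin (manifold_topology (product_atlas P P)) ?S"
    using join_smooth unfolding smooth_map_on_def by blast
  from smooth_map_at_euclidean_eventually_in[OF PP fg this S]
  show "\<forall>\<^sub>F t in nhds t. f t \<in> points P \<and> g t \<in> points P \<and> f t \<noteq> g t"
    by eventually_elim simp
qed

lemma smooth_map_at_meet:
  assumes "smooth_map_at euclidean_atlas L f t" "smooth_map_at euclidean_atlas L g t" "f t \<noteq> g t"
  shows "smooth_map_at euclidean_atlas P (\<lambda>t. meet F (f t) (g t)) t"
    and "\<forall>\<^sub>F t in nhds t. f t \<in> points L \<and> g t \<in> points L \<and> f t \<noteq> g t"
  using smooth_plane.smooth_map_at_join[OF dual assms] by (simp_all add: join_converse)

section \<open>Perspectivities \<open>x \<mapsto> (xq)l\<close> and their derivatives\<close>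

lemma perspectivity_fixed:
  assumes "(x, l) \<in> F" "(q, l) \<notin> F" "q \<in> points P"
  shows "x \<noteq> q" "join F x q \<noteq> l" "meet F (join F x q) l = x"
proof -
  show xq: "x \<noteq> q" using assms by blast
  have x: "x \<in> points P" using assms F by auto
  show jl: "join F x q \<noteq> l" using join_incident[OF x assms(3) xq] assms by auto
  show "meet F (join F x q) l = x"
    using join_incident[OF x assms(3) xq] assms jl by (intro meet_eq) auto
qed

lemma smooth_map_at_perspectivity:
  assumes f: "smooth_map_at euclidean_atlas P f t" and g: "smooth_map_at euclidean_atlas L g t"
    and q: "q \<in> points P" "f t \<noteq> q" "join F (f t) q \<noteq> g t"
  shows "smooth_map_at euclidean_atlas P (\<lambda>t. meet F (join F (f t) q) (g t)) t"
    and "\<forall>\<^sub>F t in nhds t. f t \<in> points P \<and> f t \<noteq> q \<and> g t \<in> points L \<and> join F (f t) q \<noteq> g t"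
proof -
  have c: "smooth_map_at euclidean_atlas P (\<lambda>_. q) t"
    using q by (intro smooth_map_at_const) simp_all
  note j = smooth_map_at_join[OF f c q(2)]
  note m = smooth_map_at_meet[OF j(1) g q(3)]
  show "smooth_map_at euclidean_atlas P (\<lambda>t. meet F (join F (f t) q) (g t)) t" by (rule m(1))
  from j(2) m(2) show "\<forall>\<^sub>F t in nhds t. f t \<in> points P \<and> f t \<noteq> q \<and> g t \<in> points L \<and> join F (f t) q \<noteq> g t"
    by eventually_elim simp
qed

lemma perspectivity_incident:
  assumes "x \<in> points P" "q \<in> points P" "x \<noteq> q" "l \<in> points L" "join F x q \<noteq> l"
  shows "(meet F (join F x q) l, l) \<in> F" "(meet F (join F x q) l, join F x q) \<in> F"
  using meet_incident[of "join F x q" l] join_points assms by auto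

text \<open>The projection \<open>\<pi>_l\<close> of the overview in the chart \<open>c\<close>. It
  is formed for every \<open>l\<close>, but is a projection onto a tangent space only for lines
  through \<open>p\<close> that miss \<open>q\<close>.\<close>

definition line_projection where
  "line_projection c q l p = frechet_derivative (\<lambda>x. snd c (meet F (join F (chart_inv c x) q) l)) (at (snd c p))"

lemma obtain_point_off:
  assumes "(p, l) \<in> F"
  obtains q where "q \<in> points P" "(q, l) \<notin> F"
  using point_off[of l] assms F by auto

lemma obtain_other_point:
  assumes "(p, l) \<in> F"
  obtains q where "q \<in> points P" "(q, l) \<in> F" "q \<noteq> p"
proof -
  have "l \<in> points L" using assms F by auto
  from three_points[OF this] show ?thesis using that F by blast
qed

lemma other_point_off:
  assumes "(p, l) \<in> F" "(p, m) \<in> F" "l \<noteq> m" "(q, m) \<in> F" "q \<noteq> p"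
  shows "(q, l) \<notin> F"
  using join_eq[of p l q] join_eq[of p m q] assms by auto

context
  fixes c p
  assumes c: "c \<in> P" "p \<in> fst c"
begin

lemma smooth_map_at_chart_inv_point: "smooth_map_at euclidean_atlas P (chart_inv c) (snd c p)"
  by (rule smooth_map_at_chart_inv[OF P c(1)]) (use c in auto)

lemma chart_inv_point: "chart_inv c (snd c p) = p"
  by (rule chart_inv_chart[OF P c])

lemma point: "p \<in> points P"
  using c unfolding points_def by blast

lemma eventually_chart: "\<forall>\<^sub>F x in nhds (snd c p). chart_inv c x \<in> fst c \<and> snd c (chart_inv c x) = x"
  using eventually_chart_image[OF P c smooth_atlas_openin_chart[OF P c(1)] c(2)] by eventually_elim simp

lemma perspectivity_near:
  assumes l: "(p, l) \<in> F" and q: "q \<in> points P" "(q, l) \<notin> F"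
  shows "smooth_near (\<lambda>x. snd c (meet F (join F (chart_inv c x) q) l)) (snd c p)"
    and "\<forall>\<^sub>F x in nhds (snd c p). chart_inv c x \<in> points P \<and> chart_inv c x \<noteq> q \<and>
        join F (chart_inv c x) q \<noteq> l \<and> meet F (join F (chart_inv c x) q) l \<in> fst c"
proof -
  have lL: "l \<in> points L" using l F by auto
  note f = perspectivity_fixed[OF l q(2,1)]
  have s: "smooth_map_at euclidean_atlas P (\<lambda>x. meet F (join F (chart_inv c x) q) l) (snd c p)"
    and ev: "\<forall>\<^sub>F x in nhds (snd c p). chart_inv c x \<in> points P \<and> chart_inv c x \<noteq> q \<and> l \<in> points L \<and> join F (chart_inv c x) q \<noteq> l"
    using smooth_map_at_perspectivity[OF smooth_map_at_chart_inv_point smooth_map_at_const[of _ euclidean_atlas l L], of q]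
      lL q f by (simp_all add: chart_inv_point)
  note s' = smooth_map_at_euclidean_chart[OF P s c(1)]
  show "smooth_near (\<lambda>x. snd c (meet F (join F (chart_inv c x) q) l)) (snd c p)"
    using s'(2) c f by (simp add: chart_inv_point)
  have "\<forall>\<^sub>F x in nhds (snd c p). meet F (join F (chart_inv c x) q) l \<in> fst c"
    using s'(1) c f by (simp add: chart_inv_point)
  with ev show "\<forall>\<^sub>F x in nhds (snd c p). chart_inv c x \<in> points P \<and> chart_inv c x \<noteq> q \<and>
        join F (chart_inv c x) q \<noteq> l \<and> meet F (join F (chart_inv c x) q) l \<in> fst c"
    by eventually_elim simp
qed

text \<open>The claims come from following curves through the perspectivity: images of straight
  segments lie on \<open>l\<close>, curves on \<open>l\<close> are fixed, and curves on the line
  joining \<open>p\<close> and \<open>q\<close> collapse to the single point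
  \<open>p\<close>.\<close>

lemma line_projection:
  assumes l: "(p, l) \<in> F" and q: "q \<in> points P" "(q, l) \<notin> F"
  shows "linear (line_projection c q l p)"
    and "line_projection c q l p u \<in> tangent_coords P c (points_on F l) p"
    and "u \<in> tangent_coords P c (points_on F l) p \<Longrightarrow> line_projection c q l p u = u"
    and "(p, m) \<in> F \<Longrightarrow> (q, m) \<in> F \<Longrightarrow> u \<in> tangent_coords P c (points_on F m) p \<Longrightarrow> line_projection c q l p u = 0"
proof -
  let ?r = "\<lambda>x. snd c (meet F (join F (chart_inv c x) q) l)"
  note near = perspectivity_near[OF assms]
  note f = perspectivity_fixed[OF l q(2,1)]
  have lL: "l \<in> points L" using l F by auto
  have r0: "?r (snd c p) = snd c p" using f by (simp add: chart_inv_point)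
  show "linear (line_projection c q l p)"
    unfolding line_projection_def using has_derivative_linear[OF smooth_near_has_derivative[OF near(1)]] .
  have along: "((\<lambda>t. ?r (\<gamma> t)) has_vector_derivative line_projection c q l p u) (at 0)"
    if "(\<gamma> has_vector_derivative u) (at 0)" "\<gamma> 0 = snd c p" for \<gamma> :: "real \<Rightarrow> _" and u
    using has_vector_derivative_compose_smooth[OF that(1), of ?r] near(1) that(2)
    by (simp add: line_projection_def)
  show "line_projection c q l p u \<in> tangent_coords P c (points_on F l) p"
  proof (rule tangent_coordsI[OF P c])
    let ?\<gamma> = "\<lambda>t. snd c p + t *\<^sub>R u"
    have sg: "smooth_near ?\<gamma> 0"
      by (intro smooth_near_add smooth_near_const smooth_near_linear) (rule bounded_linear_scaleR_left)
    show "smooth_near (\<lambda>t. ?r (?\<gamma> t)) 0"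
      using smooth_near_compose[OF sg, of ?r] near(1) by simp
    show "((\<lambda>t. ?r (?\<gamma> t)) has_vector_derivative line_projection c q l p u) (at 0)"
      by (rule along) (auto intro!: derivative_eq_intros)
    have "filterlim ?\<gamma> (nhds (snd c p)) (nhds 0)"
      using smooth_near_isCont[OF sg] tendsto_at_iff_tendsto_nhds[of ?\<gamma> 0] by (simp add: isCont_def)
    then have "\<forall>\<^sub>F t in nhds 0. chart_inv c (?\<gamma> t) \<in> points P \<and> chart_inv c (?\<gamma> t) \<noteq> q \<and>
        join F (chart_inv c (?\<gamma> t)) q \<noteq> l \<and> meet F (join F (chart_inv c (?\<gamma> t)) q) l \<in> fst c"
      using near(2) by (rule filterlim_iff[THEN iffD1, rule_format])
    then show "\<forall>\<^sub>F t in nhds 0. chart_inv c (?r (?\<gamma> t)) \<in> points_on F l"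
      by eventually_elim
        (use lL q perspectivity_incident in \<open>auto simp: chart_inv_chart[OF P c(1)] points_on_def\<close>)
  qed (simp add: r0)
  show "line_projection c q l p u = u" if u: "u \<in> tangent_coords P c (points_on F l) p"
  proof -
    obtain \<gamma> where \<gamma>: "smooth_curve_through P (points_on F l) p \<gamma>"
      and d: "((\<lambda>t. snd c (\<gamma> t)) has_vector_derivative u) (at 0)"
      using u unfolding tangent_coords_def by blast
    note g = smooth_curve_through_chart[OF P \<gamma> c]
    from g(3,4) have "\<forall>\<^sub>F t in nhds 0. ?r (snd c (\<gamma> t)) = snd c (\<gamma> t)"
      by eventually_elim (use q perspectivity_fixed(3) in \<open>auto simp: chart_inv_chart[OF P c(1)] points_on_def\<close>)
    from has_vector_derivative_eventually_cong[OF this along[OF d]]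
    show ?thesis using d g(1) has_vector_derivative_unique by auto
  qed
  show "line_projection c q l p u = 0"
    if m: "(p, m) \<in> F" "(q, m) \<in> F" and u: "u \<in> tangent_coords P c (points_on F m) p"
  proof -
    obtain \<gamma> where \<gamma>: "smooth_curve_through P (points_on F m) p \<gamma>"
      and d: "((\<lambda>t. snd c (\<gamma> t)) has_vector_derivative u) (at 0)"
      using u unfolding tangent_coords_def by blast
    note g = smooth_curve_through_chart[OF P \<gamma> c]
    have lm: "m \<noteq> l" using m q by auto
    have "smooth_map_at euclidean_atlas P \<gamma> 0"
      using \<gamma> smooth_curve_through_iff[OF P] by blast
    then have "\<forall>\<^sub>F t in nhds 0. \<gamma> t \<in> points P \<and> q \<in> points P \<and> \<gamma> t \<noteq> q"
      using smooth_map_at_join(2)[of \<gamma> 0 "\<lambda>_. q"] smooth_map_at_const[of 0 euclidean_atlas q P] q f(1) g(1) by simp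
    with g(3,4) have "\<forall>\<^sub>F t in nhds 0. ?r (snd c (\<gamma> t)) = snd c p"
    proof eventually_elim
      case (elim t)
      then have "join F (\<gamma> t) q = m" using m by (intro join_eq) (auto simp: points_on_def)
      moreover have "meet F m l = p" using m l lm by (intro meet_eq)
      ultimately show ?case using elim by (simp add: chart_inv_chart[OF P c(1)])
    qed
    from has_vector_derivative_eventually_cong[OF this along[OF d]] g(1)
    have "((\<lambda>t. snd c p) has_vector_derivative line_projection c q l p u) (at 0)" by simp
    from has_vector_derivative_unique[OF this has_vector_derivative_const] show ?thesis .
  qed
qed

text \<open>The velocities of curves on \<open>l\<close> are exactly the range of a linear map, the
  derivative of the retraction onto \<open>l\<close>.\<close>

lemma subspace_tangent_coords:
  assumes l: "(p, l) \<in> F"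
  shows "subspace (tangent_coords P c (points_on F l) p)"
proof -
  obtain q where q: "q \<in> points P" "(q, l) \<notin> F" using obtain_point_off[OF l] .
  note lp = line_projection[OF l q]
  have "tangent_coords P c (points_on F l) p = range (line_projection c q l p)"
    using lp(2) by (auto intro: range_eqI lp(3)[symmetric])
  then show ?thesis using linear_subspace_image[OF lp(1) subspace_UNIV] by simp
qed

text \<open>A point \<open>x\<close> near \<open>p\<close> is recovered from
  \<open>y = (xq)l\<close> and \<open>y' = (xq')m\<close> as \<open>(yq)(y'q')\<close>. This
  \<open>?\<Psi>\<close> is a smooth left inverse of the pair of perspectivities, so the derivative
  of the pair is injective.\<close>

lemma line_projections_injective:
  assumes l: "(p, l) \<in> F" and m: "(p, m) \<in> F" and lm: "l \<noteq> m"
    and q: "(q, m) \<in> F" "q \<noteq> p" and q': "(q', l) \<in> F" "q' \<noteq> p"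
    and 0: "line_projection c q l p u = 0" "line_projection c q' m p u = 0"
  shows "u = 0"
proof -
  have qP: "q \<in> points P" "q' \<in> points P" and ml: "m \<in> points L" "l \<in> points L" using l m q q' F by auto
  have off: "(q, l) \<notin> F" "(q', m) \<notin> F"
    using other_point_off[OF l m lm q] other_point_off[OF m l lm[symmetric] q'] .
  let ?r = "\<lambda>x. snd c (meet F (join F (chart_inv c x) q) l)"
  let ?r' = "\<lambda>x. snd c (meet F (join F (chart_inv c x) q') m)"
  let ?\<Psi> = "\<lambda>z. snd c (meet F (join F (chart_inv c (fst z)) q) (join F (chart_inv c (snd z)) q'))"
  note r = perspectivity_near[OF l qP(1) off(1)] and r' = perspectivity_near[OF m qP(2) off(2)]
  have r0: "?r (snd c p) = snd c p" "?r' (snd c p) = snd c p"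
    using perspectivity_fixed(3)[OF l off(1) qP(1)] perspectivity_fixed(3)[OF m off(2) qP(2)]
    by (simp_all add: chart_inv_point)
  let ?a = "(snd c p, snd c p)"
  have X: "smooth_map_at euclidean_atlas P (\<lambda>z. chart_inv c (fst z)) ?a"
    "smooth_map_at euclidean_atlas P (\<lambda>z. chart_inv c (snd z)) ?a"
    using smooth_map_at_compose[OF smooth_atlas_euclidean smooth_atlas_euclidean P, of fst ?a "chart_inv c"]
      smooth_map_at_compose[OF smooth_atlas_euclidean smooth_atlas_euclidean P, of snd ?a "chart_inv c"]
      smooth_map_at_chart_inv_point
    by (simp_all add: smooth_map_at_euclidean_euclidean smooth_near_fst smooth_near_snd)
  \<comment> \<open>The centres lie on the two lines themselves, so at \<open>p\<close> the two
    joins are \<open>m\<close> and \<open>l\<close>. These are distinct, which makes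
    \<open>?\<Psi>\<close> smooth at the base point.\<close>
  have jm: "join F p q = m" "join F p q' = l" using l m q q' by (auto intro: join_eq)
  have J: "smooth_map_at euclidean_atlas L (\<lambda>z. join F (chart_inv c (fst z)) q) ?a"
    "smooth_map_at euclidean_atlas L (\<lambda>z. join F (chart_inv c (snd z)) q') ?a"
    using X q q' qP by (intro smooth_map_at_join(1) smooth_map_at_const; simp add: chart_inv_point)+
  have "smooth_map_at euclidean_atlas P
      (\<lambda>z. meet F (join F (chart_inv c (fst z)) q) (join F (chart_inv c (snd z)) q')) ?a"
    using lm by (intro smooth_map_at_meet(1) J) (simp add: chart_inv_point jm)
  then have \<Psi>: "smooth_near ?\<Psi> ?a"
    by (rule smooth_map_at_euclidean_chart(2)[OF P _ c(1)])
      (use c l m lm in \<open>simp add: chart_inv_point jm meet_eq\<close>)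
  have jx: "smooth_map_at euclidean_atlas L (\<lambda>x. join F (chart_inv c x) q) (snd c p)"
    "smooth_map_at euclidean_atlas L (\<lambda>x. join F (chart_inv c x) q') (snd c p)"
    using smooth_map_at_chart_inv_point q q' qP
    by (intro smooth_map_at_join(1) smooth_map_at_const; simp add: chart_inv_point)+
  have ev: "\<forall>\<^sub>F x in nhds (snd c p). join F (chart_inv c x) q \<noteq> join F (chart_inv c x) q'"
    using smooth_map_at_meet(2)[OF jx] lm by (auto simp: chart_inv_point jm elim: eventually_mono)
  have "\<forall>\<^sub>F x in nhds (snd c p). ?\<Psi> (?r x, ?r' x) = x"
    using r(2) r'(2) ev eventually_chart
  proof eventually_elim
    case (elim x)
    define y where "y = chart_inv c x"
    have y: "y \<in> points P" "y \<noteq> q" "y \<noteq> q'" "join F y q \<noteq> l" "join F y q' \<noteq> m"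
      using elim by (auto simp: y_def)
    note i = perspectivity_incident[OF y(1) qP(1) y(2) ml(2) y(4)]
    note i' = perspectivity_incident[OF y(1) qP(2) y(3) ml(1) y(5)]
    \<comment> \<open>A projected point lies on \<open>l\<close> while its centre \<open>q\<close>
      does not; hence it can be joined to \<open>q\<close>, and the join is the old line
      \<open>yq\<close>. The same holds for \<open>q'\<close> and \<open>m\<close>.\<close>
    have "meet F (join F y q) l \<noteq> q" "meet F (join F y q') m \<noteq> q'" using i i' off by auto
    then have "join F (meet F (join F y q) l) q = join F y q" "join F (meet F (join F y q') m) q' = join F y q'"
      using i(2) i'(2) join_incident[OF y(1) qP(1) y(2)] join_incident[OF y(1) qP(2) y(3)]
      by (auto intro!: join_eq)
    moreover have "meet F (join F y q) (join F y q') = y"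
      using join_incident[OF y(1) qP(1) y(2)] join_incident[OF y(1) qP(2) y(3)] elim
      by (intro meet_eq) (auto simp: y_def)
    ultimately show ?case using elim by (simp add: chart_inv_chart[OF P c(1)] flip: y_def)
  qed
  then have "frechet_derivative (\<lambda>x. ?\<Psi> (?r x, ?r' x)) (at (snd c p)) u = frechet_derivative (\<lambda>x. x) (at (snd c p)) u"
    by (simp add: frechet_derivative_eventually_cong)
  also have "frechet_derivative (\<lambda>x. ?\<Psi> (?r x, ?r' x)) (at (snd c p)) u =
      frechet_derivative ?\<Psi> (at ?a) (frechet_derivative (\<lambda>x. (?r x, ?r' x)) (at (snd c p)) u)"
    using frechet_derivative_compose_smooth[OF smooth_near_Pair[OF r(1) r'(1)], of ?\<Psi> u] \<Psi> r0 by simp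
  also have "frechet_derivative (\<lambda>x. (?r x, ?r' x)) (at (snd c p)) u = 0"
  proof -
    have "((\<lambda>x. (?r x, ?r' x)) has_derivative (\<lambda>u. (line_projection c q l p u, line_projection c q' m p u))) (at (snd c p))"
      unfolding line_projection_def
      by (intro has_derivative_Pair smooth_near_has_derivative r(1) r'(1))
    from frechet_derivative_at[OF this] show ?thesis using 0 by (metis zero_prod_def)
  qed
  also have "frechet_derivative ?\<Psi> (at ?a) 0 = 0"
    using linear_0[OF has_derivative_linear[OF smooth_near_has_derivative[OF \<Psi>]]] .
  finally show ?thesis by simp
qed

text \<open>Upper bound: the projection to \<open>l\<close> from a point of \<open>m\<close> is the
  identity on \<open>T_p l\<close> and zero on \<open>T_p m\<close>, so the two meet only in zero.
  Lower bound: the pair of projections embeds the whole space into their product.\<close>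

lemma dim_tangent_coords_add:
  assumes l: "(p, l) \<in> F" and m: "(p, m) \<in> F" and lm: "l \<noteq> m"
  shows "dim (tangent_coords P c (points_on F l) p) + dim (tangent_coords P c (points_on F m) p) = 2 * CARD('n)"
    (is "dim ?E + dim ?E' = _")
proof -
  obtain q where q: "q \<in> points P" "(q, m) \<in> F" "q \<noteq> p" using obtain_other_point[OF m] .
  obtain q' where q': "q' \<in> points P" "(q', l) \<in> F" "q' \<noteq> p" using obtain_other_point[OF l] .
  have off: "(q, l) \<notin> F" "(q', m) \<notin> F"
    using other_point_off[OF l m lm q(2,3)] other_point_off[OF m l lm[symmetric] q'(2,3)] .
  note E = subspace_tangent_coords[OF l] and E' = subspace_tangent_coords[OF m]
  note lp = line_projection[OF l q(1) off(1)] and lp' = line_projection[OF m q'(1) off(2)]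
  have "u = 0" if "u \<in> ?E" "u \<in> ?E'" for u
    using lp(3)[OF that(1)] lp(4)[OF m q(2) that(2)] by simp
  then have le: "dim ?E + dim ?E' \<le> 2 * CARD('n)"
    using dim_add_le[OF E E'] by fastforce
  let ?h = "\<lambda>u. (line_projection c q l p u, line_projection c q' m p u)"
  have h: "linear ?h" by (intro linearI) (simp_all add: linear_add[OF lp(1)] linear_add[OF lp'(1)] linear_cmul[OF lp(1)] linear_cmul[OF lp'(1)])
  have "inj ?h"
    unfolding linear_injective_0[OF h]
    using line_projections_injective[OF l m lm q(2,3) q'(2,3)] by (simp add: zero_prod_def)
  then have "dim (range ?h) = dim (UNIV :: ((real^'n) \<times> (real^'n)) set)"
    using dim_image_eq[OF h, of UNIV] by simp
  moreover have "dim (range ?h) \<le> dim (?E \<times> ?E')"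
    using lp(2) lp'(2) by (intro dim_subset) auto
  ultimately show ?thesis using le dim_Times[OF E E'] by simp
qed

lemma dim_tangent_coords:
  assumes l: "(p, l) \<in> F"
  shows "dim (tangent_coords P c (points_on F l) p) = CARD('n)"
proof -
  let ?d = "\<lambda>l. dim (tangent_coords P c (points_on F l) p)"
  obtain m k where "(p, m) \<in> F" "(p, k) \<in> F" "l \<noteq> m" "l \<noteq> k" "m \<noteq> k"
  proof -
    obtain a b e where "(p, a) \<in> F" "(p, b) \<in> F" "(p, e) \<in> F" "a \<noteq> b" "a \<noteq> e" "b \<noteq> e"
      using three_lines[OF point] by blast
    then show ?thesis using that by metis
  qed
  then have "?d l + ?d m = 2 * CARD('n)" "?d l + ?d k = 2 * CARD('n)" "?d m + ?d k = 2 * CARD('n)"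
    using l by (intro dim_tangent_coords_add; simp)+
  then show ?thesis by simp
qed

text \<open>The kernel contains the tangent space of the line \<open>pq\<close>, which has dimension
  \<open>n\<close>, and it meets the \<open>n\<close>-dimensional \<open>T_p l\<close>, on which the
  projection is the identity, only in zero.\<close>

lemma dim_kernel_line_projection:
  assumes l: "(p, l) \<in> F" and q: "q \<in> points P" "(q, l) \<notin> F"
  shows "dim {u. line_projection c q l p u = 0} = CARD('n)" (is "dim ?K = _")
proof -
  have pq: "p \<noteq> q" using l q by auto
  let ?E = "tangent_coords P c (points_on F l) p"
  note lp = line_projection[OF l q]
  note m = join_incident[OF point q(1) pq]
  have K: "subspace ?K" by (rule linear_subspace_kernel[OF lp(1)])
  have "tangent_coords P c (points_on F (join F p q)) p \<subseteq> ?K" using lp(4)[OF m] by auto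
  then have 1: "CARD('n) \<le> dim ?K" using dim_subset dim_tangent_coords[OF m(1)] by metis
  have "u = 0" if "u \<in> ?E" "u \<in> ?K" for u
    using lp(3)[OF that(1)] that(2) by simp
  then have "dim ?E + dim ?K \<le> 2 * CARD('n)"
    using dim_add_le[OF subspace_tangent_coords[OF l] K] by fastforce
  with 1 show ?thesis using dim_tangent_coords[OF l] by simp
qed

text \<open>Both perspectivities have centre \<open>q\<close>, and the line from
  \<open>(xq)l\<close> to \<open>q\<close> is again \<open>xq\<close>; so the intermediate point
  does not change the final one.\<close>

lemma line_projection_compose:
  assumes l: "(p, l) \<in> F" and m: "(p, m) \<in> F" and q: "q \<in> points P" "(q, l) \<notin> F" "(q, m) \<notin> F"
  shows "line_projection c q m p (line_projection c q l p u) = line_projection c q m p u"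
proof -
  let ?r = "\<lambda>l x. snd c (meet F (join F (chart_inv c x) q) l)"
  note r = perspectivity_near[OF l q(1,2)] and r' = perspectivity_near[OF m q(1,3)]
  have lL: "l \<in> points L" using l F by auto
  have r0: "?r l (snd c p) = snd c p"
    using perspectivity_fixed(3)[OF l q(2,1)] by (simp add: chart_inv_point)
  have "\<forall>\<^sub>F x in nhds (snd c p). ?r m (?r l x) = ?r m x"
    using r(2)
  proof eventually_elim
    case (elim x)
    then have y: "chart_inv c x \<in> points P" "chart_inv c x \<noteq> q" "join F (chart_inv c x) q \<noteq> l" by auto
    note i = perspectivity_incident[OF y(1) q(1) y(2) lL y(3)]
    have "meet F (join F (chart_inv c x) q) l \<noteq> q" using i q by auto
    then have "join F (meet F (join F (chart_inv c x) q) l) q = join F (chart_inv c x) q"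
      using i(2) join_incident[OF y(1) q(1) y(2)] by (intro join_eq)
    then show ?case using elim by (simp add: chart_inv_chart[OF P c(1)])
  qed
  then have "frechet_derivative (\<lambda>x. ?r m (?r l x)) (at (snd c p)) u = frechet_derivative (?r m) (at (snd c p)) u"
    by (simp add: frechet_derivative_eventually_cong)
  then show ?thesis
    using frechet_derivative_compose_smooth[OF r(1), of "?r m" u] r'(1) r0 by (simp add: line_projection_def)
qed

end

end

section \<open>Regularity at a flag\<close>

text \<open>A linear parametrisation of \<open>S\<close> by the target space reduces this to
  endomorphisms.\<close>

lemma linear_onto_iff_injective_on:
  fixes f :: "'a::euclidean_space \<Rightarrow> 'b::euclidean_space"
  assumes f: "linear f" and S: "subspace S" "dim S = DIM('b)"
  shows "(\<forall>w. \<exists>x\<in>S. f x = w) \<longleftrightarrow> (\<forall>x\<in>S. f x = 0 \<longrightarrow> x = 0)"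
proof -
  obtain h :: "'b \<Rightarrow> 'a" where h: "linear h" "h ` UNIV = S" "inj h"
    using subspace_isomorphism[OF subspace_UNIV S(1)] S(2) by auto
  have fh: "linear (f \<circ> h)" using linear_compose[OF h(1) f] .
  have "(\<forall>w. \<exists>x\<in>S. f x = w) \<longleftrightarrow> surj (f \<circ> h)"
    unfolding h(2)[symmetric] surj_def comp_def by (simp add: eq_commute)
  also have "\<dots> \<longleftrightarrow> inj (f \<circ> h)"
    using linear_surjective_imp_injective[OF fh] linear_injective_imp_surjective[OF fh] by auto
  also have "\<dots> \<longleftrightarrow> (\<forall>x\<in>S. f x = 0 \<longrightarrow> x = 0)"
    unfolding linear_injective_0[OF fh] h(2)[symmetric]
    using linear_0[OF h(1)] linear_injective_0[OF h(1)] h(3) by auto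
  finally show ?thesis .
qed

text \<open>The rank one matrix \<open>w a^T / (a \<bullet> a)\<close>. It makes evaluation of
  matrices at \<open>a\<close> surjective.\<close>

lemma obtain_matrix:
  fixes a w :: "real^'n"
  assumes "a \<noteq> 0"
  obtains M :: "real^'n^'n" where "M *v a = w"
proof
  have "linear (\<lambda>x. ((x \<bullet> a) / (a \<bullet> a)) *\<^sub>R w)"
    by (intro linearI) (simp_all add: inner_add_left add_divide_distrib scaleR_add_left)
  then have "matrix (\<lambda>x. ((x \<bullet> a) / (a \<bullet> a)) *\<^sub>R w) *v a = ((a \<bullet> a) / (a \<bullet> a)) *\<^sub>R w"
    by (simp add: matrix_works linear_matrix_vector_mul_eq)
  then show "matrix (\<lambda>x. ((x \<bullet> a) / (a \<bullet> a)) *\<^sub>R w) *v a = w" using assms by simp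
qed

text \<open>A frame adapted to the splitting into range and kernel of a projection: in its
  Grassmannian chart the domain consists of the complements of the kernel, and the range itself is
  the graph of the zero matrix.\<close>

lemma projection_frame:
  fixes D :: "(real^'n) \<times> (real^'n) \<Rightarrow> (real^'n) \<times> (real^'n)"
  assumes D: "linear D" "\<And>u. D (D u) = D u" and dim: "dim (range D) = CARD('n)" "dim {u. D u = 0} = CARD('n)"
  shows "\<exists>G :: (real^'n) \<times> (real^'n) \<Rightarrow> (real^'n) \<times> (real^'n). linear G \<and> bij G \<and> (\<forall>x y. D (G (x, y)) = G (x, 0)) \<and>
    range D = range (\<lambda>x. G (x, 0)) \<and> {u. D u = 0} = range (\<lambda>y. G (0, y))"
proof -
  have R: "subspace (range D)" and K: "subspace {u. D u = 0}"
    using linear_subspace_image[OF D(1) subspace_UNIV] linear_subspace_kernel[OF D(1)] .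
  obtain f :: "real^'n \<Rightarrow> _" where f: "linear f" "f ` UNIV = range D" "inj f"
    using subspace_isomorphism[of "UNIV :: (real^'n) set", OF subspace_UNIV R] dim(1) by auto
  obtain k :: "real^'n \<Rightarrow> _" where k: "linear k" "k ` UNIV = {u. D u = 0}" "inj k"
    using subspace_isomorphism[of "UNIV :: (real^'n) set", OF subspace_UNIV K] dim(2) by auto
  define G where "G = (\<lambda>z. f (fst z) + k (snd z))"
  have f0: "f 0 = 0" "k 0 = 0" using linear_0 f(1) k(1) by auto
  have Df: "D (f x) = f x" for x
  proof -
    have "f x \<in> range D" using f(2) by blast
    then show ?thesis using D(2) by auto
  qed
  have Dk: "D (k y) = 0" for y using k(2) by blast
  have G: "linear G"
    unfolding G_def by (intro linearI)
      (simp_all add: linear_add[OF f(1)] linear_add[OF k(1)] linear_cmul[OF f(1)] linear_cmul[OF k(1)] scaleR_add_right)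
  have DG: "D (G (x, y)) = G (x, 0)" for x y
    by (simp add: G_def linear_add[OF D(1)] Df Dk f0)
  have "z = 0" if "G z = 0" for z
  proof -
    have "f (fst z) = 0" using DG[of "fst z" "snd z"] that linear_0[OF D(1)] by (simp add: G_def f0)
    then have "fst z = 0" using f(3) f0 by (auto simp: inj_def)
    moreover from this have "k (snd z) = 0" using that by (simp add: G_def f0)
    then have "snd z = 0" using k(3) f0 by (auto simp: inj_def)
    ultimately show ?thesis by (simp add: prod_eq_iff)
  qed
  then have "inj G" using linear_injective_0[OF G] by blast
  then have "bij G" using linear_injective_imp_surjective[OF G] by (simp add: bij_def)
  moreover have "range D = range (\<lambda>x. G (x, 0))" "{u. D u = 0} = range (\<lambda>y. G (0, y))"
    using f(2) k(2) by (simp_all add: G_def f0)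
  ultimately show ?thesis using G DG by (intro exI[of _ G] conjI) auto
qed

context smooth_plane
begin

section \<open>The family \<open>(x, y) \<mapsto> (xq)y\<close> of perspectivities and its mixed
  derivative\<close>

definition family where
  "family c d q = (\<lambda>z. snd c (meet F (join F (chart_inv c (fst z)) q) (chart_inv d (snd z))))"

text \<open>\<open>B(\<xi>, v)\<close> of the overview, with the point direction \<open>v\<close>
  differentiated first and the line direction \<open>\<xi>\<close> second. In the dual plane the
  same definition differentiates in the opposite order.\<close>

definition mixed_derivative where
  "mixed_derivative c d q p l \<xi> v =
     frechet_derivative (\<lambda>y. frechet_derivative (family c d q) (at (snd c p, y)) (v, 0)) (at (snd d l)) \<xi>"

text \<open>The equation demanded by \<open>transverse_on\<close> at one line \<open>l\<close>, so
  that each flag can be treated separately.\<close>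

definition transverse_at where
  "transverse_at p l r \<longleftrightarrow>
     {\<lambda>e. u e + v e | u v.
        u \<in> differential_image L (grassmannian P p) (lines_through F p) (\<lambda>l. tangent_space P (points_on F l) p) l \<and>
        v \<in> tangent_space (grassmannian P p) {V \<in> points (grassmannian P p). r \<subseteq> V}
          (tangent_space P (points_on F l) p)} =
     tangent_space (grassmannian P p) (points (grassmannian P p)) (tangent_space P (points_on F l) p)"

context
  fixes c d p l q
  assumes c: "c \<in> P" "p \<in> fst c" and d: "d \<in> L" "l \<in> fst d" and pl: "(p, l) \<in> F"
    and q: "q \<in> points P" "(q, l) \<notin> F"
begin

lemma chart_inv_line: "chart_inv d (snd d l) = l"
  by (rule chart_inv_chart[OF L d])

lemma smooth_map_at_chart_inv_line: "smooth_map_at euclidean_atlas L (chart_inv d) (snd d l)"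
  by (rule smooth_map_at_chart_inv[OF L d(1)]) (use d in auto)

lemma family_near:
  shows "smooth_near (family c d q) (snd c p, snd d l)"
    and "\<forall>\<^sub>F z in nhds (snd c p, snd d l).
      chart_inv c (fst z) \<in> points P \<and> chart_inv c (fst z) \<noteq> q \<and> chart_inv d (snd z) \<in> points L \<and>
      join F (chart_inv c (fst z)) q \<noteq> chart_inv d (snd z) \<and>
      meet F (join F (chart_inv c (fst z)) q) (chart_inv d (snd z)) \<in> fst c"
proof -
  let ?a = "(snd c p, snd d l)"
  note f = perspectivity_fixed[OF pl q(2,1)]
  have X: "smooth_map_at euclidean_atlas P (\<lambda>z. chart_inv c (fst z)) ?a"
    "smooth_map_at euclidean_atlas L (\<lambda>z. chart_inv d (snd z)) ?a"
    using smooth_map_at_compose[OF smooth_atlas_euclidean smooth_atlas_euclidean P, of fst ?a "chart_inv c"]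
      smooth_map_at_compose[OF smooth_atlas_euclidean smooth_atlas_euclidean L, of snd ?a "chart_inv d"]
      smooth_map_at_chart_inv_point[OF c] smooth_map_at_chart_inv_line
    by (simp_all add: smooth_map_at_euclidean_euclidean smooth_near_fst smooth_near_snd)
  note cp = chart_inv_point[OF c] chart_inv_line
  have s: "smooth_map_at euclidean_atlas P
      (\<lambda>z. meet F (join F (chart_inv c (fst z)) q) (chart_inv d (snd z))) ?a"
    "\<forall>\<^sub>F z in nhds ?a. chart_inv c (fst z) \<in> points P \<and> chart_inv c (fst z) \<noteq> q \<and>
      chart_inv d (snd z) \<in> points L \<and> join F (chart_inv c (fst z)) q \<noteq> chart_inv d (snd z)"
    using smooth_map_at_perspectivity[OF X q(1)] f by (simp_all add: cp)
  note s' = smooth_map_at_euclidean_chart[OF P s(1) c(1)]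
  show "smooth_near (family c d q) ?a"
    using s'(2) c(2) f by (simp add: cp family_def)
  have "\<forall>\<^sub>F z in nhds ?a. meet F (join F (chart_inv c (fst z)) q) (chart_inv d (snd z)) \<in> fst c"
    using s'(1) c(2) f by (simp add: cp)
  with s(2) show "\<forall>\<^sub>F z in nhds ?a.
      chart_inv c (fst z) \<in> points P \<and> chart_inv c (fst z) \<noteq> q \<and> chart_inv d (snd z) \<in> points L \<and>
      join F (chart_inv c (fst z)) q \<noteq> chart_inv d (snd z) \<and>
      meet F (join F (chart_inv c (fst z)) q) (chart_inv d (snd z)) \<in> fst c"
    by eventually_elim simp
qed

lemma family_derivative:
  "smooth_near (\<lambda>y. frechet_derivative (family c d q) (at (snd c p, y)) (v, 0)) (snd d l)"
  using smooth_near_Pair_const(2)[OF smooth_near_frechet_derivative[OF family_near(1)]] .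

text \<open>Here \<open>y\<close> runs over all lines near \<open>l\<close>, through
  \<open>p\<close> or not. The identity with \<open>line_projection\<close> is a partial derivative
  for each of them, and incidence with \<open>p\<close> enters only as the premise that yields
  \<open>q\<close> off the line.\<close>

lemma family_nearby_line:
  "\<forall>\<^sub>F y in nhds (snd d l). smooth_near (family c d q) (snd c p, y) \<and>
    ((p, chart_inv d y) \<in> F \<longrightarrow> (q, chart_inv d y) \<notin> F) \<and>
    (\<forall>u. frechet_derivative (family c d q) (at (snd c p, y)) (u, 0) = line_projection c q (chart_inv d y) p u)"
proof -
  have lim: "filterlim (\<lambda>y. (snd c p, y)) (nhds (snd c p, snd d l)) (nhds (snd d l))"
    by (intro tendsto_Pair tendsto_const filterlim_ident)
  have 1: "\<forall>\<^sub>F y in nhds (snd d l). smooth_near (family c d q) (snd c p, y)"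
    using lim smooth_near_eventually[OF family_near(1)] by (rule filterlim_iff[THEN iffD1, rule_format])
  have 2: "\<forall>\<^sub>F y in nhds (snd d l). p \<noteq> q \<and> join F p q \<noteq> chart_inv d y"
    using eventually_mono[OF lim[THEN filterlim_iff[THEN iffD1], rule_format, OF family_near(2)]]
    by (auto simp: chart_inv_point[OF c] elim!: eventually_mono)
  from 1 2 show ?thesis
  proof eventually_elim
    case (elim y)
    then have "(p, chart_inv d y) \<in> F \<longrightarrow> (q, chart_inv d y) \<notin> F"
      using join_eq[of p "chart_inv d y" q] by blast
    with elim show ?case
      using frechet_derivative_Pair_const(1)[of "family c d q" "snd c p" y]
      by (simp add: line_projection_def family_def)
  qed
qed

text \<open>Along a curve in the pencil of \<open>p\<close>, the partial derivative of the family in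
  direction \<open>v\<close> is the moving projection of \<open>v\<close>; the chain rule then
  identifies its velocity.\<close>

lemma mixed_derivative_curve:
  assumes \<gamma>: "smooth_curve_through L (lines_through F p) l \<gamma>"
    and \<xi>: "((\<lambda>t. snd d (\<gamma> t)) has_vector_derivative \<xi>) (at 0)"
  shows "((\<lambda>t. line_projection c q (\<gamma> t) p v) has_vector_derivative mixed_derivative c d q p l \<xi> v) (at 0)"
    and "\<forall>\<^sub>F t in nhds 0. (p, \<gamma> t) \<in> F \<and> (q, \<gamma> t) \<notin> F \<and> \<gamma> t \<in> fst d \<and>
      line_projection c q (\<gamma> t) p v = frechet_derivative (family c d q) (at (snd c p, snd d (\<gamma> t))) (v, 0)"
proof -
  note g = smooth_curve_through_chart[OF L \<gamma> d]
  have "filterlim (\<lambda>t. snd d (\<gamma> t)) (nhds (snd d l)) (nhds 0)"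
    using smooth_near_isCont[OF g(2)] g(1) tendsto_at_iff_tendsto_nhds[of "\<lambda>t. snd d (\<gamma> t)" 0] by (simp add: isCont_def)
  then have "\<forall>\<^sub>F t in nhds 0. smooth_near (family c d q) (snd c p, snd d (\<gamma> t)) \<and>
    ((p, chart_inv d (snd d (\<gamma> t))) \<in> F \<longrightarrow> (q, chart_inv d (snd d (\<gamma> t))) \<notin> F) \<and>
    (\<forall>u. frechet_derivative (family c d q) (at (snd c p, snd d (\<gamma> t))) (u, 0) =
      line_projection c q (chart_inv d (snd d (\<gamma> t))) p u)"
    using family_nearby_line by (rule filterlim_iff[THEN iffD1, rule_format])
  with g(3,4) show ev: "\<forall>\<^sub>F t in nhds 0. (p, \<gamma> t) \<in> F \<and> (q, \<gamma> t) \<notin> F \<and> \<gamma> t \<in> fst d \<and>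
      line_projection c q (\<gamma> t) p v = frechet_derivative (family c d q) (at (snd c p, snd d (\<gamma> t))) (v, 0)"
  proof eventually_elim
    case (elim t)
    have "(p, \<gamma> t) \<in> F" using elim by (simp add: lines_through_def)
    moreover have "chart_inv d (snd d (\<gamma> t)) = \<gamma> t" using chart_inv_chart[OF L d(1)] elim by blast
    ultimately show ?case using elim by metis
  qed
  have "((\<lambda>t. frechet_derivative (family c d q) (at (snd c p, snd d (\<gamma> t))) (v, 0))
      has_vector_derivative mixed_derivative c d q p l \<xi> v) (at 0)"
    using has_vector_derivative_compose_smooth[OF \<xi>, of "\<lambda>y. frechet_derivative (family c d q) (at (snd c p, y)) (v, 0)"]
      family_derivative g(1) by (simp add: mixed_derivative_def)
  then show "((\<lambda>t. line_projection c q (\<gamma> t) p v) has_vector_derivative mixed_derivative c d q p l \<xi> v) (at 0)"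
    by (rule has_vector_derivative_eventually_cong[rotated]) (use ev in eventually_elim, simp)
qed

text \<open>Along a curve of lines \<open>\<gamma> t\<close> through \<open>p\<close>, projecting
  \<open>v\<close> first to \<open>\<gamma> t\<close> and then to \<open>l\<close> gives the
  constant \<open>\<pi>_l v\<close>. Differentiating at zero gives the claim.\<close>

lemma mixed_derivative_kernel:
  assumes "\<xi> \<in> tangent_coords L d (lines_through F p) l"
  shows "line_projection c q l p (mixed_derivative c d q p l \<xi> v) = 0"
proof -
  obtain \<gamma> where \<gamma>: "smooth_curve_through L (lines_through F p) l \<gamma>"
    "((\<lambda>t. snd d (\<gamma> t)) has_vector_derivative \<xi>) (at 0)"
    using assms unfolding tangent_coords_def by blast
  note m = mixed_derivative_curve[OF \<gamma>, of v]
  note lp = line_projection[OF c pl q]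
  have "((\<lambda>t. line_projection c q l p (line_projection c q (\<gamma> t) p v)) has_vector_derivative
      line_projection c q l p (mixed_derivative c d q p l \<xi> v)) (at 0)"
    using bounded_linear.has_vector_derivative[OF _ m(1)] lp(1) linear_conv_bounded_linear by blast
  moreover have "\<forall>\<^sub>F t in nhds 0. line_projection c q l p (line_projection c q (\<gamma> t) p v) = line_projection c q l p v"
    using m(2) by eventually_elim (rule line_projection_compose[OF c _ pl q(1) _ q(2)]; blast)
  ultimately have "((\<lambda>t. line_projection c q l p v) has_vector_derivative
      line_projection c q l p (mixed_derivative c d q p l \<xi> v)) (at (0::real))"
    by (rule has_vector_derivative_eventually_cong[rotated])
  from has_vector_derivative_unique[OF this has_vector_derivative_const] show ?thesis .
qed

lemma linear_mixed_derivative: "linear (\<lambda>\<xi>. mixed_derivative c d q p l \<xi> v)"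
  unfolding mixed_derivative_def
  using has_derivative_linear[OF smooth_near_has_derivative[OF family_derivative]] .

text \<open>In a frame \<open>G\<close> adapted to \<open>T_p l\<close> and the kernel, tangent
  spaces of nearby lines of the pencil are graphs of matrices \<open>M\<close>, and the planes
  containing \<open>v = G (a, 0)\<close> have tangent space \<open>{A. A a = 0}\<close>. So
  transversality says that \<open>\<xi> \<mapsto> DM(\<xi>) a\<close>, which is
  \<open>B(\<xi>, v)\<close> in kernel coordinates, is onto; by dimension this is
  injectivity.\<close>

lemma transverse_at_iff:
  assumes v: "v \<in> tangent_coords P c (points_on F l) p" "v \<noteq> 0"
  shows "transverse_at p l {\<lambda>e. r *\<^sub>R tangent_vector P c p v e | r. True} \<longleftrightarrow>
    (\<forall>\<xi>\<in>tangent_coords L d (lines_through F p) l. mixed_derivative c d q p l \<xi> v = 0 \<longrightarrow> \<xi> = 0)"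
proof -
  let ?E = "tangent_coords P c (points_on F l) p" and ?E' = "tangent_coords L d (lines_through F p) l"
  let ?D = "line_projection c q l p"
  note lp = line_projection[OF c pl q]
  have E: "?E = range ?D" using lp(2) by (auto intro: range_eqI lp(3)[symmetric])
  have "dim (range ?D) = CARD('n)" using dim_tangent_coords[OF c pl] E by simp
  from projection_frame[OF lp(1) lp(3)[OF lp(2)] this dim_kernel_line_projection[OF c pl q]]
  obtain G :: "(real^'n) \<times> (real^'n) \<Rightarrow> (real^'n) \<times> (real^'n)"
    where G: "linear G" "bij G" and DG': "\<forall>x y. ?D (G (x, y)) = G (x, 0)"
    and rD: "range ?D = range (\<lambda>x. G (x, 0))" and kD: "{u. ?D u = 0} = range (\<lambda>y. G (0, y))"
    by (elim exE conjE)
  from DG' have DG: "?D (G (x, y)) = G (x, 0)" for x y by (elim allE)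
  have iG: "linear (inv G)" using inj_linear_imp_inv_linear[OF G(1) bij_is_inj[OF G(2)]] .
  have Gi: "inv G (G z) = z" "G (inv G z) = z" for z
    using G(2) by (simp_all add: bij_is_inj bij_is_surj surj_f_inv_f)
  \<comment> \<open>The block of \<open>D\<close>, in the frame \<open>G\<close>, that leads from
    the range of \<open>?D\<close> to its kernel.\<close>
  define N where "N = (\<lambda>D. matrix (\<lambda>x. snd (inv G (D (G (x, 0))))))"
  have N: "N D *v x = snd (inv G (D (G (x, 0))))" if "linear D" for D x
  proof -
    have "linear (\<lambda>x::real^'n. (x, 0::real^'n))" by (intro linearI) simp_all
    then have "linear (\<lambda>x. snd (inv G (D (G (x, 0)))))"
      using linear_compose[OF _ linear_compose[OF G(1) linear_compose[OF that linear_compose[OF iG linear_snd]]]]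
      by (simp add: comp_def)
    then show ?thesis by (simp add: N_def matrix_works linear_matrix_vector_mul_eq)
  qed
  \<comment> \<open>From \<open>\<pi>_l \<pi>_m = \<pi>_l\<close> and
    \<open>\<pi>_m \<pi>_l = \<pi>_m\<close>, the projection onto \<open>T_p m\<close> sends
    \<open>G (x, y)\<close> to \<open>G (x, N x)\<close>, so its range is a graph over
    \<open>T_p l\<close>.\<close>
  have plane: "tangent_space P (points_on F m) p = plane_of P c p G (N (line_projection c q m p))"
    if m: "(p, m) \<in> F" "(q, m) \<notin> F" for m
  proof -
    let ?D' = "line_projection c q m p"
    note lp' = line_projection[OF c m(1) q(1) m(2)]
    have DD': "?D (?D' u) = ?D u" and D'D: "?D' (?D u) = ?D' u" for u
      using line_projection_compose[OF c m(1) pl q(1) m(2) q(2)]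
        line_projection_compose[OF c pl m(1) q(1) q(2) m(2)] by auto
    have D'G: "?D' (G (x, y)) = G (x, N ?D' *v x)" for x y
    proof -
      have "?D' (G (x, y)) = ?D' (G (x, 0))" using D'D[of "G (x, y)"] DG[of x y] by simp
      also have "\<dots> = G (x, N ?D' *v x)"
      proof -
        have "G (fst (inv G (?D' (G (x, 0)))), 0) = ?D (?D' (G (x, 0)))"
          using DG[of "fst (inv G (?D' (G (x, 0))))" "snd (inv G (?D' (G (x, 0))))"] Gi(2) by simp
        also have "\<dots> = G (x, 0)" using DD' DG by simp
        finally have "fst (inv G (?D' (G (x, 0)))) = x"
          using G(2) by (simp add: bij_is_inj inj_eq)
        then have "inv G (?D' (G (x, 0))) = (x, N ?D' *v x)"
          by (simp add: N[OF lp'(1)] prod_eq_iff)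
        then show ?thesis using Gi(2) by metis
      qed
      finally show ?thesis .
    qed
    have "tangent_coords P c (points_on F m) p = range ?D'"
      using lp'(2) by (auto intro: range_eqI lp'(3)[symmetric])
    also have "\<dots> = ?D' ` range G" using bij_is_surj[OF G(2)] by simp
    also have "\<dots> = G ` range (\<lambda>x. (x, N ?D' *v x))"
      unfolding image_image using D'G by (auto simp: image_iff)
    finally show ?thesis
      unfolding tangent_space_eq[OF P c] graph_plane_compose by simp
  qed
  \<comment> \<open>Defined through the partial derivative of the family, hence also for lines off
    \<open>p\<close>: this gives a smooth function on an open set of line coordinates. On the pencil
    it is the Grassmannian coordinate of the tangent space.\<close>
  define M where "M = (\<lambda>y. N (\<lambda>u. frechet_derivative (family c d q) (at (snd c p, y)) (u, 0)))"
  have sM: "smooth_near M (snd d l)"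
  proof (rule smooth_near_matrix)
    fix i j
    have "linear (\<lambda>w. snd (inv G w) $ i)"
      using linear_compose[OF linear_compose[OF iG linear_snd] bounded_linear.linear[OF bounded_linear_vec_nth[of i]]] by (simp add: comp_def)
    then show "smooth_near (\<lambda>y. M y $ i $ j) (snd d l)"
      unfolding M_def N_def matrix_def
      by (simp, intro smooth_near_linear_compose[OF _ family_derivative]) (simp add: linear_conv_bounded_linear)
  qed
  have M': "frechet_derivative M (at (snd d l)) \<xi> *v x = snd (inv G (mixed_derivative c d q p l \<xi> (G (x, 0))))" for \<xi> x
  proof -
    have 1: "bounded_linear (\<lambda>N::real^'n^'n. N *v x)"
      unfolding linear_conv_bounded_linear[symmetric]
      by (intro linearI) (simp_all add: matrix_vector_mult_add_rdistrib scaleR_matrix_vector_assoc)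
    have 2: "bounded_linear (\<lambda>w. snd (inv G w))"
      using linear_compose[OF iG linear_snd] by (simp add: comp_def linear_conv_bounded_linear)
    have "\<forall>\<^sub>F y in nhds (snd d l). M y *v x =
        snd (inv G (frechet_derivative (family c d q) (at (snd c p, y)) (G (x, 0), 0)))"
      using family_nearby_line
    proof eventually_elim
      case (elim y)
      have "linear (\<lambda>u. (u, 0 :: (real^'n) \<times> (real^'n)))" by (intro linearI) simp_all
      from linear_compose[OF this has_derivative_linear[OF smooth_near_has_derivative]] elim
      have "linear (\<lambda>u. frechet_derivative (family c d q) (at (snd c p, y)) (u, 0))"
        unfolding comp_def by blast
      from N[OF this] show ?case by (simp add: M_def)
    qed
    from frechet_derivative_eventually_cong[OF this] show ?thesis
      using frechet_derivative_linear_compose[OF 1 sM, of \<xi>]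
        frechet_derivative_linear_compose[OF 2 family_derivative, of "G (x, 0)" \<xi>]
      by (simp add: mixed_derivative_def)
  qed
  have Ml: "M (snd d l) = N ?D"
  proof -
    have "frechet_derivative (family c d q) (at (snd c p, snd d l)) (u, 0) = ?D u" for u
      using eventually_nhds_x_imp_x[OF family_nearby_line] unfolding chart_inv_line by blast
    then have "(\<lambda>u. frechet_derivative (family c d q) (at (snd c p, snd d l)) (u, 0)) = ?D" by (rule ext)
    then show ?thesis by (simp only: M_def)
  qed
  \<comment> \<open>\<open>T_p l\<close> is the graph of zero in this frame. So \<open>v\<close> has
    coordinates \<open>(a, 0)\<close>, which is also \<open>(a, N a)\<close>, the form needed for
    the tangent space of the planes containing \<open>v\<close>.\<close>
  obtain a where va: "v = G (a, 0)" using v(1) E rD by auto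
  have a: "a \<noteq> 0" using v(2) va linear_0[OF G(1)] by (auto simp: zero_prod_def)
  have Na: "N ?D *v a = 0" using N[OF lp(1), of a] DG[of a 0] Gi(1) by simp
  let ?Gr = "grassmannian P p" and ?e = "grassmannian_chart P c p G"
  let ?f = "\<lambda>l. tangent_space P (points_on F l) p"
  note Gr = smooth_atlas_grassmannian[OF P c]
  note s = grassmannian_chart_simps[OF P c G]
  have e: "?e \<in> ?Gr" by (rule grassmannian_chart_in[OF P c G])
  have fl: "?f l = plane_of P c p G (N ?D)" by (rule plane[OF pl q(2)])
  have el: "?f l \<in> fst ?e" unfolding fl s by blast
  have curve: "\<forall>\<^sub>F t in nhds 0. ?f (\<gamma> t) = plane_of P c p G (M (snd d (\<gamma> t)))"
    if \<gamma>: "smooth_curve_through L (lines_through F p) l \<gamma>" for \<gamma>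
  proof -
    note g = smooth_curve_through_chart[OF L \<gamma> d]
    have "filterlim (\<lambda>t. snd d (\<gamma> t)) (nhds (snd d l)) (nhds 0)"
      using smooth_near_isCont[OF g(2)] g(1) tendsto_at_iff_tendsto_nhds[of "\<lambda>t. snd d (\<gamma> t)" 0] by (simp add: isCont_def)
    from filterlim_iff[THEN iffD1, rule_format, OF this family_nearby_line] g(3,4)
    show ?thesis
    proof eventually_elim
      case (elim t)
      have t: "(p, \<gamma> t) \<in> F" using elim by (simp add: lines_through_def)
      have "chart_inv d (snd d (\<gamma> t)) = \<gamma> t" using chart_inv_chart[OF L d(1)] elim by blast
      then have off: "(q, \<gamma> t) \<notin> F"
        and *: "frechet_derivative (family c d q) (at (snd c p, snd d (\<gamma> t))) (u, 0) = line_projection c q (\<gamma> t) p u" for u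
        using elim(1) t by metis+
      have "(\<lambda>u. frechet_derivative (family c d q) (at (snd c p, snd d (\<gamma> t))) (u, 0)) = line_projection c q (\<gamma> t) p"
        using * by (rule ext)
      then show ?case using plane[OF t off] by (simp only: M_def)
    qed
  qed
  have coord: "\<forall>\<^sub>F t in nhds 0. snd ?e (?f (\<gamma> t)) = M (snd d (\<gamma> t))"
    if \<gamma>: "smooth_curve_through L (lines_through F p) l \<gamma>" for \<gamma>
    using curve[OF \<gamma>] by eventually_elim (simp add: s(2))
  have di: "differential_image L ?Gr (lines_through F p) ?f l = tangent_vector ?Gr ?e (?f l) `
      {u. \<exists>\<gamma>. smooth_curve_through L (lines_through F p) l \<gamma> \<and> ((\<lambda>t. snd ?e (?f (\<gamma> t))) has_vector_derivative u) (at 0)}"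
  proof (rule differential_image_eq[where f = ?f, OF L d Gr e el])
    fix \<gamma> assume \<gamma>: "smooth_curve_through L (lines_through F p) l \<gamma>"
    note g = smooth_curve_through_chart[OF L \<gamma> d]
    show "smooth_map_at euclidean_atlas ?Gr (\<lambda>t. ?f (\<gamma> t)) 0"
    proof (rule smooth_map_at_euclideanI[OF e])
      show "?f (\<gamma> 0) \<in> fst ?e" using el g(1) by simp
      show "\<forall>\<^sub>F t in nhds 0. ?f (\<gamma> t) \<in> fst ?e"
        using curve[OF \<gamma>] by eventually_elim (simp add: s(1))
      have "smooth_near (\<lambda>t. M (snd d (\<gamma> t))) 0"
        using smooth_near_compose[OF g(2), of M] sM g(1) by simp
      then show "smooth_near (\<lambda>t. snd ?e (?f (\<gamma> t))) 0"
        by (rule smooth_near_cong) (use coord[OF \<gamma>] in eventually_elim, simp)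
    qed
  qed
  also have "{u. \<exists>\<gamma>. smooth_curve_through L (lines_through F p) l \<gamma> \<and> ((\<lambda>t. snd ?e (?f (\<gamma> t))) has_vector_derivative u) (at 0)}
      = frechet_derivative M (at (snd d l)) ` ?E'" (is "?X = _")
  proof -
    have *: "((\<lambda>t. snd ?e (?f (\<gamma> t))) has_vector_derivative frechet_derivative M (at (snd d l)) \<xi>) (at 0)"
      if \<gamma>: "smooth_curve_through L (lines_through F p) l \<gamma>"
        "((\<lambda>t. snd d (\<gamma> t)) has_vector_derivative \<xi>) (at 0)" for \<gamma> \<xi>
    proof -
      have "((\<lambda>t. M (snd d (\<gamma> t))) has_vector_derivative frechet_derivative M (at (snd d l)) \<xi>) (at 0)"
        using has_vector_derivative_compose_smooth[OF \<gamma>(2), of M] sM smooth_curve_through_chart(1)[OF L \<gamma>(1) d] by simp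
      then show ?thesis
        by (rule has_vector_derivative_eventually_cong[rotated]) (use coord[OF \<gamma>(1)] in eventually_elim, simp)
    qed
    show ?thesis
    proof (intro equalityI subsetI)
      fix u assume "u \<in> ?X"
      then obtain \<gamma> where \<gamma>: "smooth_curve_through L (lines_through F p) l \<gamma>"
        "((\<lambda>t. snd ?e (?f (\<gamma> t))) has_vector_derivative u) (at 0)" by blast
      note w = smooth_curve_through_chart(5)[OF L \<gamma>(1) d]
      have "u = frechet_derivative M (at (snd d l)) (vector_derivative (\<lambda>t. snd d (\<gamma> t)) (at 0))"
        using has_vector_derivative_unique[OF \<gamma>(2) *[OF \<gamma>(1) w]] .
      then show "u \<in> frechet_derivative M (at (snd d l)) ` ?E'"
        using w \<gamma>(1) unfolding tangent_coords_def by blast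
    next
      fix u assume "u \<in> frechet_derivative M (at (snd d l)) ` ?E'"
      then show "u \<in> ?X" using * unfolding tangent_coords_def by blast
    qed
  qed
  finally have di: "differential_image L ?Gr (lines_through F p) ?f l =
      tangent_vector ?Gr ?e (?f l) ` frechet_derivative M (at (snd d l)) ` ?E'" .
  let ?r = "{\<lambda>e. r *\<^sub>R tangent_vector P c p v e | r. True}"
  have "v = G (a, N ?D *v a)" using va Na by simp
  then have tz: "tangent_space ?Gr {V \<in> points ?Gr. ?r \<subseteq> V} (?f l) = tangent_vector ?Gr ?e (?f l) ` {A. A *v a = 0}"
    unfolding tangent_space_eq[OF Gr e el] unfolding fl
    using tangent_coords_line_planes[OF P c G, of a "N ?D"] by simp
  have "transverse_at p l ?r \<longleftrightarrow> (\<forall>w. \<exists>u\<in>frechet_derivative M (at (snd d l)) ` ?E'. \<exists>A\<in>{A. A *v a = 0}. w = u + A)"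
    unfolding transverse_at_def di tz tangent_space_points[OF Gr e el]
    by (rule transverse_tangent_vectors[OF Gr e el])
  \<comment> \<open>\<open>W = u + A\<close> with \<open>A a = 0\<close> is solvable in
    \<open>A\<close> exactly if \<open>W a = u a\<close>; and since \<open>a\<close> is not zero,
    \<open>W a\<close> takes every value.\<close>
  also have "\<dots> \<longleftrightarrow> (\<forall>w. \<exists>\<xi>\<in>?E'. frechet_derivative M (at (snd d l)) \<xi> *v a = w)"
  proof (intro iffI allI)
    fix w assume *: "\<forall>w. \<exists>u\<in>frechet_derivative M (at (snd d l)) ` ?E'. \<exists>A\<in>{A. A *v a = 0}. w = u + A"
    obtain W :: "real^'n^'n" where W: "W *v a = w" using obtain_matrix[OF a] .
    from * obtain \<xi> A where "\<xi> \<in> ?E'" "A *v a = 0" "W = frechet_derivative M (at (snd d l)) \<xi> + A" by blast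
    then show "\<exists>\<xi>\<in>?E'. frechet_derivative M (at (snd d l)) \<xi> *v a = w"
      using W by (auto simp: matrix_vector_mult_add_rdistrib)
  next
    fix W :: "real^'n^'n" assume "\<forall>w. \<exists>\<xi>\<in>?E'. frechet_derivative M (at (snd d l)) \<xi> *v a = w"
    then obtain \<xi> where "\<xi> \<in> ?E'" "frechet_derivative M (at (snd d l)) \<xi> *v a = W *v a" by blast
    then show "\<exists>u\<in>frechet_derivative M (at (snd d l)) ` ?E'. \<exists>A\<in>{A. A *v a = 0}. W = u + A"
      by (intro bexI[of _ "frechet_derivative M (at (snd d l)) \<xi>"] bexI[of _ "W - frechet_derivative M (at (snd d l)) \<xi>"])
        (auto simp: matrix_vector_mult_diff_rdistrib)
  qed
  also have "\<dots> \<longleftrightarrow> (\<forall>w. \<exists>\<xi>\<in>?E'. snd (inv G (mixed_derivative c d q p l \<xi> v)) = w)"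
    by (simp add: M' va)
  also have "\<dots> \<longleftrightarrow> (\<forall>\<xi>\<in>?E'. snd (inv G (mixed_derivative c d q p l \<xi> v)) = 0 \<longrightarrow> \<xi> = 0)"
  proof (rule linear_onto_iff_injective_on)
    show "linear (\<lambda>\<xi>. snd (inv G (mixed_derivative c d q p l \<xi> v)))"
      using linear_compose[OF linear_mixed_derivative linear_compose[OF iG linear_snd]] by (simp add: comp_def)
    \<comment> \<open>In the dual plane the pencil of \<open>p\<close> is the set of points on the
      line \<open>p\<close>, so its tangent space is also a subspace of dimension
      \<open>n\<close>.\<close>
    have lp: "(l, p) \<in> F\<inverse>" using pl by simp
    show "subspace ?E'" "dim ?E' = DIM(real^'n)"
      using smooth_plane.subspace_tangent_coords[OF dual d lp] smooth_plane.dim_tangent_coords[OF dual d lp]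
      by (simp_all add: points_on_converse)
  qed
  \<comment> \<open>The mixed derivative lies in the kernel, which is \<open>G (0, y)\<close> for
    varying \<open>y\<close>, so its second coordinate loses no information.\<close>
  also have "\<dots> \<longleftrightarrow> (\<forall>\<xi>\<in>?E'. mixed_derivative c d q p l \<xi> v = 0 \<longrightarrow> \<xi> = 0)"
  proof -
    have "snd (inv G (mixed_derivative c d q p l \<xi> v)) = 0 \<longleftrightarrow> mixed_derivative c d q p l \<xi> v = 0"
      if "\<xi> \<in> ?E'" for \<xi>
    proof -
      have "mixed_derivative c d q p l \<xi> v \<in> range (\<lambda>y. G (0, y))"
        using mixed_derivative_kernel[OF that] unfolding kD[symmetric] by simp
      then obtain y where "mixed_derivative c d q p l \<xi> v = G (0, y)" by blast
      then show ?thesis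
        using Gi linear_0[OF G(1)] by (metis snd_conv zero_prod_def)
    qed
    then show ?thesis by simp
  qed
  finally show ?thesis .
qed

end

end

section \<open>Duality\<close>

text \<open>\<open>T_p l\<close> is the graph of the zero matrix in an adapted frame. Needed to
  apply regularity, whose condition concerns only members of the Grassmannian.\<close>

lemma (in smooth_plane) tangent_space_in_grassmannian:
  assumes c: "c \<in> P" "p \<in> fst c" and pl: "(p, l) \<in> F"
  shows "tangent_space P (points_on F l) p \<in> points (grassmannian P p)"
proof -
  obtain q where q: "q \<in> points P" "(q, l) \<notin> F" using obtain_point_off[OF pl] .
  let ?D = "line_projection c q l p"
  note lp = line_projection[OF c pl q]
  have E: "tangent_coords P c (points_on F l) p = range ?D" using lp(2) by (auto intro: range_eqI lp(3)[symmetric])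
  have "dim (range ?D) = CARD('n)" using dim_tangent_coords[OF c pl] E by simp
  from projection_frame[OF lp(1) lp(3)[OF lp(2)] this dim_kernel_line_projection[OF c pl q]]
  obtain G :: "(real^'n) \<times> (real^'n) \<Rightarrow> (real^'n) \<times> (real^'n)"
    where G: "linear G" "bij G" and rD: "range ?D = range (\<lambda>x. G (x, 0))"
    by (elim exE conjE)
  have "tangent_space P (points_on F l) p = plane_of P c p G 0"
    unfolding tangent_space_eq[OF P c] E rD graph_plane_compose by (simp add: image_image)
  then have "tangent_space P (points_on F l) p \<in> fst (grassmannian_chart P c p G)"
    unfolding grassmannian_chart_simps(1)[OF P c G] by blast
  then show ?thesis using grassmannian_chart_in[OF P c G] unfolding points_def by blast
qed

context smooth_plane
begin

section \<open>The mixed derivatives of a plane and of its dual\<close>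

context
  fixes c d p l q m
  assumes c: "c \<in> P" "p \<in> fst c" and d: "d \<in> L" "l \<in> fst d" and pl: "(p, l) \<in> F"
    and q: "q \<in> points P" "(q, l) \<notin> F" and m: "m \<in> points L" "(p, m) \<notin> F"
begin

text \<open>
  The point \<open>(xq)y\<close> of the family lies on the line \<open>y\<close>, so that joining it to \<open>ym\<close> gives back \<open>y\<close>.
\<close>

lemma dual_family_family:
  "\<forall>\<^sub>F z in nhds (snd c p, snd d l). smooth_near (family c d q) z \<and>
    smooth_near (smooth_plane.family (F\<inverse>) d c m) (snd z, family c d q z) \<and>
    smooth_plane.family (F\<inverse>) d c m (snd z, family c d q z) = snd z"
proof -
  interpret dual: smooth_plane L P "F\<inverse>" by (rule dual)
  have lp: "(l, p) \<in> F\<inverse>" "(m, p) \<notin> F\<inverse>" using pl m by auto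
  note fam = family_near[OF c d pl q] and dfam = dual.family_near[OF d c lp(1) m(1) lp(2)]
  let ?a = "(snd c p, snd d l)"
  have R0: "family c d q ?a = snd c p"
    using perspectivity_fixed(3)[OF pl q(2,1)]
    by (simp add: family_def chart_inv_point[OF c] chart_inv_line[OF c d pl q])
  have "smooth_near (\<lambda>z. (snd z, family c d q z)) ?a"
    by (intro smooth_near_Pair smooth_near_snd fam(1))
  then have lim: "filterlim (\<lambda>z. (snd z, family c d q z)) (nhds (snd d l, snd c p)) (nhds ?a)"
    using smooth_near_isCont R0 tendsto_at_iff_tendsto_nhds[of "\<lambda>z. (snd z, family c d q z)" ?a]
    by (fastforce simp: isCont_def)
  note ev = filterlim_iff[THEN iffD1, rule_format, OF lim]
  have "filterlim snd (nhds (snd d l)) (nhds ?a)"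
    using tendsto_snd[OF filterlim_ident[of "nhds ?a"]] by simp
  from filterlim_iff[THEN iffD1, rule_format, OF this dual.eventually_chart[OF d]]
  have "\<forall>\<^sub>F z in nhds ?a. chart_inv d (snd z) \<in> fst d \<and> snd d (chart_inv d (snd z)) = snd z" .
  from this fam(2) smooth_near_eventually[OF fam(1)] ev[OF dfam(2)] ev[OF smooth_near_eventually[OF dfam(1)]]
  show ?thesis
  proof eventually_elim
    case (elim z)
    define x where "x = chart_inv c (fst z)"
    define y where "y = chart_inv d (snd z)"
    define x' where "x' = meet F (join F x q) y"
    have x: "x \<in> points P" "x \<noteq> q" "y \<in> points L" "join F x q \<noteq> y" "x' \<in> fst c"
      using elim by (simp_all add: x_def y_def x'_def)
    have fz: "chart_inv c (family c d q z) = x'"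
      using chart_inv_chart[OF P c(1) x(5)] by (simp add: family_def x_def y_def x'_def)
    have on: "(x', y) \<in> F" unfolding x'_def by (rule perspectivity_incident(1)[OF x(1) q(1) x(2,3,4)])
    have ym: "y \<noteq> m" and neq: "meet F y m \<noteq> x'"
      using elim by (simp_all add: join_converse fz y_def)
    have "join F (meet F y m) x' = y"
      using meet_incident(1)[OF x(3) m(1) ym] on neq by (intro join_eq)
    then have "smooth_plane.family (F\<inverse>) d c m (snd z, family c d q z) = snd z"
      using elim by (simp add: dual.family_def join_converse meet_converse fz flip: y_def)
    then show ?case using elim by simp
  qed
qed

text \<open>The product rule along the pencil has two terms, one with \<open>B(\<xi>, v)\<close> and
  one with the mixed derivative of the dual family; their sum vanishes. The arguments
  \<open>\<xi>\<close> and \<open>v\<close> exchange roles.\<close>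

lemma mixed_derivative_dual:
  assumes v: "v \<in> tangent_coords P c (points_on F l) p"
    and \<xi>: "\<xi> \<in> tangent_coords L d (lines_through F p) l"
    and 0: "mixed_derivative c d q p l \<xi> v = 0"
  shows "smooth_plane.mixed_derivative (F\<inverse>) d c m l p v \<xi> = 0"
proof -
  interpret dual: smooth_plane L P "F\<inverse>" by (rule dual)
  have lp: "(l, p) \<in> F\<inverse>" "(m, p) \<notin> F\<inverse>" using pl m by auto
  let ?R = "family c d q" and ?H = "dual.family d c m"
  let ?a = "snd c p" and ?b = "snd d l"
  have H: "smooth_near ?H (?b, ?a)" by (rule dual.family_near(1)[OF d c lp(1) m(1) lp(2)])
  \<comment> \<open>Differentiates \<open>H(y, R(x, y)) = y\<close> in the direction
    \<open>(v, 0)\<close>, in which the right-hand side is constant. It holds on a neighbourhood,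
    which allows a second differentiation.\<close>
  have kill: "\<forall>\<^sub>F z in nhds (?a, ?b).
      frechet_derivative ?H (at (snd z, ?R z)) (0, frechet_derivative ?R (at z) (v, 0)) = 0"
  proof -
    have "\<forall>\<^sub>F z in nhds (?a, ?b). \<forall>\<^sub>F z' in nhds z. ?H (snd z', ?R z') = snd z'"
      unfolding eventually_eventually using dual_family_family by eventually_elim simp
    with dual_family_family show ?thesis
    proof eventually_elim
      case (elim z)
      then have R: "smooth_near ?R z" and Hz: "smooth_near ?H (snd z, ?R z)" by auto
      have "((\<lambda>z. (snd z, ?R z)) has_derivative (\<lambda>h. (snd h, frechet_derivative ?R (at z) h))) (at z)"
        by (intro has_derivative_Pair smooth_near_has_derivative[OF R] bounded_linear_imp_has_derivative
            bounded_linear_snd)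
      from has_derivative_compose[OF this smooth_near_has_derivative[OF Hz]]
      have "frechet_derivative (\<lambda>z. ?H (snd z, ?R z)) (at z) =
          (\<lambda>h. frechet_derivative ?H (at (snd z, ?R z)) (snd h, frechet_derivative ?R (at z) h))"
        by (rule frechet_derivative_at[symmetric])
      moreover have "frechet_derivative (\<lambda>z. ?H (snd z, ?R z)) (at z) = frechet_derivative snd (at z)"
        using elim(2) by (rule frechet_derivative_eventually_cong)
      moreover have "frechet_derivative snd (at z) = snd"
        by (rule frechet_derivative_at[symmetric]) (rule bounded_linear_imp_has_derivative[OF bounded_linear_snd])
      ultimately have "(\<lambda>h. frechet_derivative ?H (at (snd z, ?R z)) (snd h, frechet_derivative ?R (at z) h)) = snd"
        by simp
      from fun_cong[OF this, of "(v, 0)"] show ?case by simp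
    qed
  qed
  obtain \<gamma> where \<gamma>: "smooth_curve_through L (lines_through F p) l \<gamma>"
    and d\<gamma>: "((\<lambda>t. snd d (\<gamma> t)) has_vector_derivative \<xi>) (at 0)"
    using \<xi> unfolding tangent_coords_def by blast
  note g = smooth_curve_through_chart[OF L \<gamma> d]
  \<comment> \<open>The projection of \<open>v\<close> to the moving line \<open>\<gamma> t\<close>.
    It starts at \<open>v\<close>, because \<open>v\<close> is tangent to \<open>l\<close>, and its
    velocity is the mixed derivative, which vanishes by assumption.\<close>
  define w where "w = (\<lambda>t. line_projection c q (\<gamma> t) p v)"
  have w: "(w has_vector_derivative 0) (at 0)"
    using mixed_derivative_curve(1)[OF c d pl q \<gamma> d\<gamma>, of v] 0 by (simp add: w_def)
  have w0: "w 0 = v" using line_projection(3)[OF c pl q v] g(1) by (simp add: w_def)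
  have "filterlim (\<lambda>t. snd d (\<gamma> t)) (nhds ?b) (nhds 0)"
    using smooth_near_isCont[OF g(2)] g(1) tendsto_at_iff_tendsto_nhds[of "\<lambda>t. snd d (\<gamma> t)" 0] by (simp add: isCont_def)
  then have lim: "filterlim (\<lambda>t. (?a, snd d (\<gamma> t))) (nhds (?a, ?b)) (nhds 0)"
    by (intro tendsto_Pair tendsto_const)
  let ?\<Theta> = "\<lambda>u y. frechet_derivative ?H (at (y, ?a)) (0, u)"
  note ev = filterlim_iff[THEN iffD1, rule_format, OF lim]
  \<comment> \<open>On lines through \<open>p\<close> the family fixes \<open>p\<close>, so the
    derivative of \<open>H\<close> is always taken at the point \<open>p\<close>. The basis
    expansion separates the two dependences on \<open>t\<close>, the vector \<open>w t\<close> and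
    the line \<open>\<gamma> t\<close>, into factors for the product rule.\<close>
  have zero: "\<forall>\<^sub>F t in nhds 0. (\<Sum>i\<in>Basis. (w t \<bullet> i) *\<^sub>R ?\<Theta> i (snd d (\<gamma> t))) = 0"
    using mixed_derivative_curve(2)[OF c d pl q \<gamma> d\<gamma>, of v] ev[OF kill] ev[OF dual_family_family]
  proof eventually_elim
    case (elim t)
    then have t: "(p, \<gamma> t) \<in> F" "(q, \<gamma> t) \<notin> F" "\<gamma> t \<in> fst d"
      and wt: "w t = frechet_derivative ?R (at (?a, snd d (\<gamma> t))) (v, 0)" by (simp_all add: w_def)
    have R: "?R (?a, snd d (\<gamma> t)) = ?a"
      using perspectivity_fixed(3)[OF t(1,2) q(1)]
      by (simp add: family_def chart_inv_point[OF c] chart_inv_chart[OF L d(1) t(3)])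
    have 1: "?\<Theta> (w t) (snd d (\<gamma> t)) = 0" and 2: "smooth_near ?H (snd d (\<gamma> t), ?a)"
      using elim(2,3) R by (simp_all add: wt)
    have lin: "linear (\<lambda>u. ?\<Theta> u (snd d (\<gamma> t)))"
    proof -
      have "(\<lambda>u. ?\<Theta> u (snd d (\<gamma> t))) = frechet_derivative (\<lambda>x. ?H (snd d (\<gamma> t), x)) (at ?a)"
        by (rule ext) (rule frechet_derivative_Pair_const(2)[OF 2, symmetric])
      then show ?thesis
        using has_derivative_linear[OF smooth_near_has_derivative[OF smooth_near_Pair_const(2)[OF 2]]] by simp
    qed
    have "(\<Sum>i\<in>Basis. (w t \<bullet> i) *\<^sub>R ?\<Theta> i (snd d (\<gamma> t))) = ?\<Theta> (\<Sum>i\<in>Basis. (w t \<bullet> i) *\<^sub>R i) (snd d (\<gamma> t))"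
      by (simp only: linear_sum[OF lin] linear_cmul[OF lin])
    then show ?case using 1 by (simp only: euclidean_representation)
  qed
  let ?K = "\<lambda>u. frechet_derivative (\<lambda>z. frechet_derivative ?H (at z) (0, u)) (at (?b, ?a)) (\<xi>, 0)"
  have \<Theta>: "((\<lambda>t. ?\<Theta> u (snd d (\<gamma> t))) has_vector_derivative ?K u) (at 0)" for u
  proof -
    note s = smooth_near_frechet_derivative[OF H, of "(0, u)"]
    show ?thesis
      using has_vector_derivative_compose_smooth[OF d\<gamma>, of "?\<Theta> u"] smooth_near_Pair_const(1)[OF s] g(1)
        frechet_derivative_Pair_const(1)[OF s] by simp
  qed
  have "((\<lambda>t. \<Sum>i\<in>Basis. (w t \<bullet> i) *\<^sub>R ?\<Theta> i (snd d (\<gamma> t))) has_vector_derivative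
      (\<Sum>i\<in>Basis. (w 0 \<bullet> i) *\<^sub>R ?K i + (0 \<bullet> i) *\<^sub>R ?\<Theta> i (snd d (\<gamma> 0)))) (at 0)"
    by (intro has_vector_derivative_sum bounded_bilinear.has_vector_derivative[OF bounded_bilinear_scaleR]
        bounded_linear.has_vector_derivative[OF bounded_linear_inner_left] w \<Theta>)
  from has_vector_derivative_eventually_cong[OF zero this]
  have "((\<lambda>t. 0) has_vector_derivative (\<Sum>i\<in>Basis. (v \<bullet> i) *\<^sub>R ?K i)) (at (0::real))"
    by (simp add: w0)
  from has_vector_derivative_unique[OF this has_vector_derivative_const]
  have sum: "(\<Sum>i\<in>Basis. (v \<bullet> i) *\<^sub>R ?K i) = 0" .
  note s = smooth_near_frechet_derivative[OF H, of "(\<xi>, 0)"]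
  \<comment> \<open>The calculation above differentiates \<open>H\<close> first in the point and
    then in the line; \<open>dual.mixed_derivative\<close> does it the other way round.\<close>
  have K: "?K u = frechet_derivative (\<lambda>x. frechet_derivative ?H (at (?b, x)) (\<xi>, 0)) (at ?a) u" for u
    using second_derivative_symmetric[OF H] frechet_derivative_Pair_const(2)[OF s] by simp
  have lin: "linear (frechet_derivative (\<lambda>x. frechet_derivative ?H (at (?b, x)) (\<xi>, 0)) (at ?a))"
    using has_derivative_linear[OF smooth_near_has_derivative[OF smooth_near_Pair_const(2)[OF s]]] .
  have "frechet_derivative (\<lambda>x. frechet_derivative ?H (at (?b, x)) (\<xi>, 0)) (at ?a) (\<Sum>i\<in>Basis. (v \<bullet> i) *\<^sub>R i) = 0"
    using sum unfolding K by (simp only: linear_sum[OF lin] linear_cmul[OF lin])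
  then show ?thesis by (simp only: euclidean_representation dual.mixed_derivative_def)
qed

end

text \<open>A nonzero \<open>\<xi>\<close> with \<open>B(\<xi>, v) = 0\<close> would make the dual
  mixed derivative vanish at \<open>v\<close>. But regularity of the dual plane at the flag
  \<open>(l, p)\<close>, for the real line spanned by \<open>\<xi>\<close>, then gives
  \<open>v = 0\<close>.\<close>

lemma regular_if_dual_regular:
  assumes reg: "regular_plane L P (F\<inverse>)"
  shows "regular_plane P L F"
  unfolding regular_plane_def transverse_on_def
proof (intro ballI allI impI)
  interpret dual: smooth_plane L P "F\<inverse>" by (rule dual)
  fix p r l
  assume p: "p \<in> points P" and r: "real_line_in (tangent_space P (points P) p) r"
    and l: "l \<in> lines_through F p"
    and sub: "tangent_space P (points_on F l) p \<in> {V \<in> points (grassmannian P p). r \<subseteq> V}"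
  have pl: "(p, l) \<in> F" and lp: "(l, p) \<in> F\<inverse>" using l by (auto simp: lines_through_def)
  have lL: "l \<in> points L" using pl F by auto
  obtain c where c: "c \<in> P" "p \<in> fst c" using p unfolding points_def by blast
  obtain d where d: "d \<in> L" "l \<in> fst d" using lL unfolding points_def by blast
  obtain q where q: "q \<in> points P" "(q, l) \<notin> F" using point_off[OF lL] by blast
  obtain m where m: "m \<in> points L" "(p, m) \<notin> F" using line_off[OF p] by blast
  have tv0: "tangent_vector P c p 0 = (\<lambda>c. 0)" "tangent_vector L d l 0 = (\<lambda>c. 0)"
    using linear_0[OF linear_tangent_vector[OF P c]] linear_0[OF linear_tangent_vector[OF L d]] by auto
  obtain v where v: "v \<noteq> 0" "r = {\<lambda>e. k *\<^sub>R tangent_vector P c p v e | k. True}"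
  proof -
    obtain w where w: "w \<in> range (tangent_vector P c p)" "w \<noteq> (\<lambda>c. 0)" "r = {\<lambda>e. k *\<^sub>R w e | k. True}"
      using r unfolding real_line_in_def tangent_space_points[OF P c] by (elim bexE conjE)
    from w(1) obtain v where v: "w = tangent_vector P c p v" by (elim rangeE)
    have "v \<noteq> 0" using w(2) tv0(1) unfolding v by metis
    then show thesis using w(3) unfolding v by (rule that)
  qed
  have "(\<lambda>e. 1 *\<^sub>R tangent_vector P c p v e) \<in> tangent_space P (points_on F l) p"
    using sub v(2) by blast
  then have vE: "v \<in> tangent_coords P c (points_on F l) p"
    unfolding tangent_space_eq[OF P c] using inj_tangent_vector[OF P c] by (auto simp: inj_image_mem_iff)
  have "\<xi> = 0"
    if \<xi>: "\<xi> \<in> tangent_coords L d (lines_through F p) l" and 0: "mixed_derivative c d q p l \<xi> v = 0" for \<xi>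
  proof (rule ccontr)
    assume nz: "\<xi> \<noteq> 0"
    have dual0: "dual.mixed_derivative d c m l p v \<xi> = 0"
      by (rule mixed_derivative_dual[OF c d pl q m vE \<xi> 0])
    let ?s = "{\<lambda>e. k *\<^sub>R tangent_vector L d l \<xi> e | k. True}"
    have "tangent_vector L d l \<xi> \<noteq> (\<lambda>e. 0)"
      using nz inj_tangent_vector[OF L d] tv0(2) by (metis injD)
    then have s: "real_line_in (tangent_space L (points L) l) ?s"
      unfolding real_line_in_def tangent_space_points[OF L d] by blast
    have \<xi>': "\<xi> \<in> tangent_coords L d (points_on (F\<inverse>) p) l" using \<xi> by (simp add: points_on_converse)
    have "subspace (tangent_coords L d (points_on (F\<inverse>) p) l)"
      by (rule dual.subspace_tangent_coords[OF d lp])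
    then have "k *\<^sub>R \<xi> \<in> tangent_coords L d (points_on (F\<inverse>) p) l" for k
      using \<xi>' by (rule subspace_scale)
    moreover have "(\<lambda>e. k *\<^sub>R tangent_vector L d l \<xi> e) = tangent_vector L d l (k *\<^sub>R \<xi>)" for k
      by (rule ext) (simp only: linear_cmul[OF linear_tangent_vector[OF L d]])
    ultimately have "?s \<subseteq> tangent_space L (points_on (F\<inverse>) p) l"
      unfolding tangent_space_eq[OF L d] by auto
    moreover have "tangent_space L (points_on (F\<inverse>) p) l \<in> points (grassmannian L l)"
      by (rule dual.tangent_space_in_grassmannian[OF d lp])
    moreover have "p \<in> lines_through (F\<inverse>) l" using pl by (simp add: lines_through_def)
    ultimately have "dual.transverse_at l p ?s"
      using reg lL s unfolding regular_plane_def transverse_on_def dual.transverse_at_def by blast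
    moreover have "(m, p) \<notin> F\<inverse>" using m by simp
    ultimately have "\<forall>u\<in>tangent_coords P c (lines_through (F\<inverse>) l) p. dual.mixed_derivative d c m l p u \<xi> = 0 \<longrightarrow> u = 0"
      using dual.transverse_at_iff[OF d c lp m(1) _ \<xi>' nz] by blast
    then show False using vE dual0 v(1) by (simp add: lines_through_converse)
  qed
  then have "transverse_at p l r"
    unfolding v(2) transverse_at_iff[OF c d pl q vE v(1)] by blast
  then show "{\<lambda>c. u c + v c | u v.
        u \<in> differential_image L (grassmannian P p) (lines_through F p) (\<lambda>l. tangent_space P (points_on F l) p) l \<and>
        v \<in> tangent_space (grassmannian P p) {V \<in> points (grassmannian P p). r \<subseteq> V}
          (tangent_space P (points_on F l) p)} =
     tangent_space (grassmannian P p) (points (grassmannian P p)) (tangent_space P (points_on F l) p)"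
    unfolding transverse_at_def .
qed

end

section \<open>Incidence geometry\<close>

lemma projective_plane_incidence:
  assumes pp: "projective_plane P L F"
  shows "l \<in> L \<Longrightarrow> \<exists>q\<in>P. (q, l) \<notin> F" and "p \<in> P \<Longrightarrow> \<exists>m\<in>L. (p, m) \<notin> F"
    and "p \<in> P \<Longrightarrow> \<exists>l m k. (p, l) \<in> F \<and> (p, m) \<in> F \<and> (p, k) \<in> F \<and> l \<noteq> m \<and> l \<noteq> k \<and> m \<noteq> k"
    and "l \<in> L \<Longrightarrow> \<exists>p q r. (p, l) \<in> F \<and> (q, l) \<in> F \<and> (r, l) \<in> F \<and> p \<noteq> q \<and> p \<noteq> r \<and> q \<noteq> r"
proof -
  have FPL: "F \<subseteq> P \<times> L"
    and join: "\<And>p q. p \<in> P \<Longrightarrow> q \<in> P \<Longrightarrow> p \<noteq> q \<Longrightarrow> \<exists>!l. l \<in> L \<and> (p, l) \<in> F \<and> (q, l) \<in> F"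
    and meet: "\<And>l m. l \<in> L \<Longrightarrow> m \<in> L \<Longrightarrow> l \<noteq> m \<Longrightarrow> \<exists>!p. p \<in> P \<and> (p, l) \<in> F \<and> (p, m) \<in> F"
    using pp unfolding projective_plane_def by auto
  have unique: "l = m" if "(p, l) \<in> F" "(q, l) \<in> F" "(p, m) \<in> F" "(q, m) \<in> F" "p \<noteq> q" for p q l m
    using that join[of p q] FPL by blast
  obtain Q where Q: "Q \<subseteq> P" "card Q = 4" "\<And>l. l \<in> L \<Longrightarrow> card {p \<in> Q. (p, l) \<in> F} < 3"
    using pp unfolding projective_plane_def by auto
  have fQ: "finite Q" using Q(2) by (metis card.infinite zero_neq_numeral)
  have nocol: False if "a \<in> Q" "b \<in> Q" "e \<in> Q" "a \<noteq> b" "a \<noteq> e" "b \<noteq> e" "(a, l) \<in> F" "(b, l) \<in> F" "(e, l) \<in> F" for a b e l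
  proof -
    have "{a, b, e} \<subseteq> {p \<in> Q. (p, l) \<in> F}" using that by auto
    then have "card {a, b, e} \<le> card {p \<in> Q. (p, l) \<in> F}" using fQ by (intro card_mono) auto
    then show False using Q(3)[of l] that FPL by auto
  qed
  have off: "\<exists>q\<in>Q. (q, l) \<notin> F" if "l \<in> L" for l
  proof (rule ccontr)
    assume "\<not> ?thesis"
    then have "{p \<in> Q. (p, l) \<in> F} = Q" by auto
    then show False using Q(2) Q(3)[OF that] by simp
  qed
  then show point_off: "l \<in> L \<Longrightarrow> \<exists>q\<in>P. (q, l) \<notin> F" for l using Q(1) by blast
  have others: "\<exists>b e f. b \<in> Q \<and> e \<in> Q \<and> f \<in> Q \<and> b \<noteq> a \<and> e \<noteq> a \<and> f \<noteq> a \<and> b \<noteq> e \<and> b \<noteq> f \<and> e \<noteq> f" if "a \<in> Q" for a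
  proof -
    have "card (Q - {a}) = 3" using that Q(2) fQ by simp
    then obtain b e f where "Q - {a} = {b, e, f}" "b \<noteq> e" "b \<noteq> f" "e \<noteq> f"
      using card_3_iff by metis
    moreover from this have "b \<in> Q - {a}" "e \<in> Q - {a}" "f \<in> Q - {a}" by blast+
    ultimately show ?thesis by blast
  qed
  have lines: "\<exists>l. l \<in> L \<and> (p, l) \<in> F \<and> (q, l) \<in> F" if "p \<in> P" "q \<in> P" "p \<noteq> q" for p q
    using join[OF that] by blast
  \<comment> \<open>The joins of \<open>p\<close> to the other three points of the quadrangle are
    distinct, as no three of the four points are collinear.\<close>
  have Q_lines: "\<exists>l m k. (p, l) \<in> F \<and> (p, m) \<in> F \<and> (p, k) \<in> F \<and> l \<noteq> m \<and> l \<noteq> k \<and> m \<noteq> k" if p: "p \<in> Q" for p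
  proof -
    obtain b e f where b: "b \<in> Q" "e \<in> Q" "f \<in> Q" "b \<noteq> p" "e \<noteq> p" "f \<noteq> p" "b \<noteq> e" "b \<noteq> f" "e \<noteq> f"
      using others[OF p] by blast
    obtain l where l: "(p, l) \<in> F" "(b, l) \<in> F" using lines[of p b] p b Q(1) by blast
    obtain m where m: "(p, m) \<in> F" "(e, m) \<in> F" using lines[of p e] p b Q(1) by blast
    obtain k where k: "(p, k) \<in> F" "(f, k) \<in> F" using lines[of p f] p b Q(1) by blast
    have "l \<noteq> m" using nocol[of p b e l] p b l m by auto
    moreover have "l \<noteq> k" using nocol[of p b f l] p b l k by auto
    moreover have "m \<noteq> k" using nocol[of p e f m] p b m k by auto
    ultimately show ?thesis using l m k by blast
  qed
  \<comment> \<open>Three lines through a quadrangle point off \<open>l\<close> meet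
    \<open>l\<close> in three different points.\<close>
  show three_points: "\<exists>p q r. (p, l) \<in> F \<and> (q, l) \<in> F \<and> (r, l) \<in> F \<and> p \<noteq> q \<and> p \<noteq> r \<and> q \<noteq> r" if l: "l \<in> L" for l
  proof -
    obtain o' where o: "o' \<in> Q" "(o', l) \<notin> F" using off[OF l] by blast
    obtain a b e where abe: "(o', a) \<in> F" "(o', b) \<in> F" "(o', e) \<in> F" "a \<noteq> b" "a \<noteq> e" "b \<noteq> e"
      using Q_lines[OF o(1)] by blast
    have ex: "\<exists>x. (x, l) \<in> F \<and> (x, a) \<in> F" if "(o', a) \<in> F" for a
      using meet[of l a] l that o(2) FPL by blast
    obtain x y z where xyz: "(x, l) \<in> F" "(x, a) \<in> F" "(y, l) \<in> F" "(y, b) \<in> F" "(z, l) \<in> F" "(z, e) \<in> F"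
      using ex[OF abe(1)] ex[OF abe(2)] ex[OF abe(3)] by blast
    have "x \<noteq> o'" "y \<noteq> o'" "z \<noteq> o'" using xyz o by auto
    then have "x \<noteq> y" "x \<noteq> z" "y \<noteq> z"
      using unique[of o' a x b] unique[of o' a x e] unique[of o' b y e] abe xyz by auto
    with xyz show ?thesis by blast
  qed
  \<comment> \<open>If every line passed through \<open>p\<close>, then for noncollinear
    \<open>a\<close>, \<open>b\<close>, \<open>e\<close> the lines \<open>ab\<close> and
    \<open>be\<close> would give \<open>p = b\<close>, and \<open>ab\<close> and \<open>ae\<close>
    would give \<open>p = a\<close>.\<close>
  show line_off: "\<exists>m\<in>L. (p, m) \<notin> F" if p: "p \<in> P" for p
  proof (rule ccontr)
    assume "\<not> ?thesis"
    then have all: "(p, m) \<in> F" if "m \<in> L" for m using that by blast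
    have "Q \<noteq> {}" using Q(2) by auto
    then obtain a where a: "a \<in> Q" by blast
    obtain b e where b: "b \<in> Q" "e \<in> Q" "b \<noteq> a" "e \<noteq> a" "b \<noteq> e" using others[OF a] by blast
    obtain l where l: "l \<in> L" "(a, l) \<in> F" "(b, l) \<in> F" using lines[of a b] a b Q(1) by blast
    obtain m where m: "m \<in> L" "(b, m) \<in> F" "(e, m) \<in> F" using lines[of b e] a b Q(1) by blast
    obtain k where k: "k \<in> L" "(a, k) \<in> F" "(e, k) \<in> F" using lines[of a e] a b Q(1) by blast
    have "l \<noteq> m" "l \<noteq> k" using nocol[of a b e l] a b l m k by auto
    then have "p = b" "p = a"
      using unique[of p l b m] unique[of p l a k] all l m k by blast+
    then show False using b by simp
  qed
  \<comment> \<open>Joins of \<open>p\<close> to three points of a line that misses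
    \<open>p\<close>.\<close>
  show "\<exists>l m k. (p, l) \<in> F \<and> (p, m) \<in> F \<and> (p, k) \<in> F \<and> l \<noteq> m \<and> l \<noteq> k \<and> m \<noteq> k" if p: "p \<in> P" for p
  proof -
    obtain m where m: "m \<in> L" "(p, m) \<notin> F" using line_off[OF p] by blast
    obtain x y z where xyz: "(x, m) \<in> F" "(y, m) \<in> F" "(z, m) \<in> F" "x \<noteq> y" "x \<noteq> z" "y \<noteq> z"
      using three_points[OF m(1)] by blast
    have ex: "\<exists>l. (p, l) \<in> F \<and> (x, l) \<in> F" if "(x, m) \<in> F" for x
      using lines[of p x] p that m(2) FPL by blast
    obtain a b e where abe: "(p, a) \<in> F" "(x, a) \<in> F" "(p, b) \<in> F" "(y, b) \<in> F" "(p, e) \<in> F" "(z, e) \<in> F"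
      using ex[OF xyz(1)] ex[OF xyz(2)] ex[OF xyz(3)] by blast
    have "a \<noteq> m" "b \<noteq> m" "e \<noteq> m" using abe m by auto
    then have "a \<noteq> b" "a \<noteq> e" "b \<noteq> e"
      using unique[of x a y m] unique[of x a z m] unique[of y b z m] abe xyz by auto
    with abe show ?thesis by blast
  qed
qed

lemma smooth_plane_if_smooth_projective_plane:
  assumes "smooth_projective_plane P L F"
  shows "smooth_plane P L F"
proof -
  have pp: "projective_plane (points P) (points L) F"
    and a: "smooth_atlas P" "smooth_atlas L"
    and sm: "smooth_map_on (product_atlas P P) L
       {(p, q). p \<in> points P \<and> q \<in> points P \<and> p \<noteq> q} (\<lambda>(p, q). join F p q)"
     "smooth_map_on (product_atlas L L) P
       {(l, m). l \<in> points L \<and> m \<in> points L \<and> l \<noteq> m} (\<lambda>(l, m). meet F l m)"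
    using assms by (simp_all add: smooth_projective_plane_def compact_smooth_manifold_def smooth_manifold_atlas)
  note inc = projective_plane_incidence[OF pp] and pp' = pp[unfolded projective_plane_def]
  have F: "F \<subseteq> points P \<times> points L"
    and J: "\<forall>p\<in>points P. \<forall>q\<in>points P. p \<noteq> q \<longrightarrow> (\<exists>!l. l \<in> points L \<and> (p, l) \<in> F \<and> (q, l) \<in> F)"
    and M: "\<forall>l\<in>points L. \<forall>m\<in>points L. l \<noteq> m \<longrightarrow> (\<exists>!p. p \<in> points P \<and> (p, l) \<in> F \<and> (p, m) \<in> F)"
    using conjunct1[OF pp'] conjunct1[OF conjunct2[OF pp']] conjunct1[OF conjunct2[OF conjunct2[OF pp']]] .
  have join: "\<exists>!l. (p, l) \<in> F \<and> (q, l) \<in> F" if "p \<in> points P" "q \<in> points P" "p \<noteq> q" for p q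
  proof -
    have "\<exists>!l. l \<in> points L \<and> (p, l) \<in> F \<and> (q, l) \<in> F" using J that by simp
    then show ?thesis using F by blast
  qed
  have meet: "\<exists>!p. (p, l) \<in> F \<and> (p, m) \<in> F" if "l \<in> points L" "m \<in> points L" "l \<noteq> m" for l m
  proof -
    have "\<exists>!p. p \<in> points P \<and> (p, l) \<in> F \<and> (p, m) \<in> F" using M that by simp
    then show ?thesis using F by blast
  qed
  show ?thesis
    by (rule smooth_plane.intro[OF a F join meet sm inc])
qed

theorem corollary12:
  fixes P :: "('p, (real^'n) \<times> (real^'n)) chart set"
    and L :: "('l, (real^'n) \<times> (real^'n)) chart set"
    and F :: "('p \<times> 'l) set"
  assumes "smooth_projective_plane P L F"
  shows "regular_plane L P (F\<inverse>) \<longleftrightarrow> regular_plane P L F"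
proof -
  interpret smooth_plane P L F by (rule smooth_plane_if_smooth_projective_plane[OF assms])
  show ?thesis
    using regular_if_dual_regular smooth_plane.regular_if_dual_regular[OF dual] by auto
qed

end
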